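(* Let $n\ge2$, $d\ge1$, and let $f$ be a real-valued $\mathcal{C}^d$-smooth function on $S^{n-1}$ such that $\int_{S^{n-1}}f\,d\sigma_{n-1}=0$. Assume that $$\lVert D^{(k)}f\rVert_{\mathrm{Op},2}\le n^{-(d-k)/2},\qquad k=1,\dots,d-1,$$ and $|D^{(d)}f(\theta)|_{\mathrm{Op}}\le1$ for all $\theta\in S^{n-1}$. Then $$\int_{S^{n-1}}\exp\Big\{\frac{(n-1)\,|f|^{2/d}}{8e}\Big\}\,d\sigma_{n-1}\le 2.$$
   Context: $S^{n-1}$ is the unit sphere in $\mathbb{R}^n$ and $\sigma_{n-1}$ the uniform probability measure on it. A function on $S^{n-1}$ is $\mathcal{C}^d$-smooth if it extends to a $\mathcal{C}^d$-smooth function on an open subset of $\mathbb{R}^n$ containing $S^{n-1}$. The spherical gradient is $\nabla_Sf(\theta)=\nabla f(\theta)-\langle\nabla f(\theta),\theta\rangle\theta$ (projection of the Euclidean gradient of any smooth extension to the tangent space $\theta^\perp$). Spherical partial derivatives are $D_if=\langle\nabla_Sf,e_i\rangle$, $i=1,\dots,n$, with $e_i$ the standard unit vectors of $\mathbb{R}^n$; higher order ones are defined by iteration, $D_{i_1\dots i_k}f=D_{i_1}(D_{i_2\dots i_k}f)$, e.g. $D_{ij}f=\langle\nabla_S\langle\nabla_Sf,e_j\rangle,e_i\rangle$ (in general not symmetric in the indices). $D^{(k)}f(\theta)$ is the hypermatrix with entries $D_{i_1\dots i_k}f(\theta)$, regarded as a $k$-linear form on $\mathbb{R}^n$, with operator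 norm $|D^{(k)}f(\theta)|_{\mathrm{Op}}=\sup\{D^{(k)}f(\theta)[v_1,\dots,v_k]:v_j\in\mathbb{R}^n,\ |v_1|=\dots=|v_k|=1\}$, and $\lVert D^{(k)}f\rVert_{\mathrm{Op},2}=(\int_{S^{n-1}}|D^{(k)}f|_{\mathrm{Op}}^2\,d\sigma_{n-1})^{1/2}$. *)

theory Defs
  imports "HOL-Probability.Probability"
begin

text \<open>
  Functions on the unit sphere are represented by total functions on \<open>real ^ 'n\<close> of which only the
  values on \<open>sphere 0 1\<close> matter.
\<close>

section \<open>The uniform distribution on the sphere\<close>

text \<open>
  The normalised cone measure: the law of \<open>x / |x|\<close> for a point \<open>x\<close> chosen uniformly in the unit
  ball. It is the unique rotation invariant Borel probability measure on the sphere. (The image of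
  \<open>0\<close> is \<open>0\<close>, which is off the sphere; that is a null event.)
\<close>

definition sphere_measure :: "(real ^ 'n) measure" where
  "sphere_measure =
     restrict_space (distr (uniform_measure lborel (ball 0 1)) borel sgn) (sphere 0 1)"

lemma space_sphere_measure [simp]: "space sphere_measure = sphere 0 1"
  by (simp add: sphere_measure_def space_restrict_space)

lemma sets_sphere_measure [measurable_cong]:
  "sets sphere_measure = sets (restrict_space borel (sphere 0 1))"
  unfolding sphere_measure_def by (rule sets_restrict_space_cong) simp

lemma measurable_sgn_borel [measurable]: "(sgn :: real ^ 'n \<Rightarrow> real ^ 'n) \<in> borel_measurable borel"
proof -
  have "(\<lambda>x :: real ^ 'n. x /\<^sub>R norm x) \<in> borel_measurable borel"
    by measurable
  then show ?thesis by (simp add: sgn_div_norm[abs_def])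
qed

lemma emeasure_ball_pos: "emeasure lborel (ball 0 1 :: (real ^ 'n) set) \<noteq> 0"
proof -
  have "0 < measure lborel (ball (0 :: real ^ 'n) 1)"
    by (rule content_ball_pos) simp
  then show ?thesis
    by (metis less_irrefl measure_def enn2real_0)
qed

lemma emeasure_ball_finite: "emeasure lborel (ball 0 1 :: (real ^ 'n) set) \<noteq> \<infinity>"
  using emeasure_lborel_ball_finite[of "0 :: real ^ 'n" 1] by auto

lemma prob_space_sphere_measure: "prob_space (sphere_measure :: (real ^ 'n) measure)"
proof -
  let ?U = "uniform_measure lborel (ball 0 1) :: (real ^ 'n) measure"
  interpret U: prob_space ?U
    by (rule prob_space_uniform_measure[OF emeasure_ball_pos emeasure_ball_finite])
  interpret D: prob_space "distr ?U borel sgn"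
    by (rule U.prob_space_distr) measurable
  have ae: "AE x in distr ?U borel sgn. x \<in> sphere 0 1"
  proof -
    have "AE x in ?U. x \<noteq> 0"
      by (rule AE_uniform_measureI) (auto intro: AE_mp[OF AE_lborel_singleton])
    then have "AE x in ?U. sgn x \<in> sphere 0 1"
      by eventually_elim (simp add: norm_sgn)
    then show ?thesis
      by (subst AE_distr_iff) (auto simp: pred_def)
  qed
  have "emeasure (distr ?U borel sgn) (sphere 0 1) = 1"
    by (rule D.emeasure_eq_1_AE[OF _ ae]) simp
  then show ?thesis unfolding sphere_measure_def
    by (intro prob_space_restrict_space) auto
qed

section \<open>Smooth functions and spherical derivatives\<close>

text \<open>
  \<open>C_on k U F\<close>: on the open set \<open>U\<close>, the function \<open>F\<close> is \<open>k\<close> times continuously differentiable.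
\<close>

primrec C_on :: "nat \<Rightarrow> (real ^ 'n) set \<Rightarrow> (real ^ 'n \<Rightarrow> real) \<Rightarrow> bool" where
  "C_on 0 U F \<longleftrightarrow> continuous_on U F"
| "C_on (Suc k) U F \<longleftrightarrow>
     (\<exists>G. (\<forall>x\<in>U. GDERIV F x :> G x) \<and> (\<forall>i. C_on k U (\<lambda>x. G x $ i)))"

definition C_extension :: "nat \<Rightarrow> (real ^ 'n \<Rightarrow> real) \<Rightarrow> (real ^ 'n) set \<Rightarrow> (real ^ 'n \<Rightarrow> real) \<Rightarrow> bool"
  where "C_extension k f U F \<longleftrightarrow>
     open U \<and> sphere 0 1 \<subseteq> U \<and> C_on k U F \<and> (\<forall>x\<in>sphere 0 1. F x = f x)"

definition C_sphere :: "nat \<Rightarrow> (real ^ 'n \<Rightarrow> real) \<Rightarrow> bool" where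
  "C_sphere k f \<longleftrightarrow> (\<exists>U F. C_extension k f U F)"

text \<open>
  The spherical gradient is read off from any smooth extension; by \<open>sphere_grad_eq\<close> below the
  choice is irrelevant.
\<close>

definition sphere_grad :: "(real ^ 'n \<Rightarrow> real) \<Rightarrow> real ^ 'n \<Rightarrow> real ^ 'n" where
  "sphere_grad f \<theta> =
     (THE v. \<exists>U F g. C_extension 1 f U F \<and> GDERIV F \<theta> :> g \<and> v = g - (g \<bullet> \<theta>) *\<^sub>R \<theta>)"

lemma tangential_gradient_unique:
  fixes F G :: "real ^ 'n \<Rightarrow> real"
  assumes F: "GDERIV F \<theta> :> g" and G: "GDERIV G \<theta> :> h"
    and eq: "\<And>x. x \<in> sphere 0 1 \<Longrightarrow> F x = G x" and \<theta>: "\<theta> \<in> sphere 0 1"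
  shows "g - (g \<bullet> \<theta>) *\<^sub>R \<theta> = h - (h \<bullet> \<theta>) *\<^sub>R \<theta>"
proof (rule ccontr)
  define p where "p = g - h"
  define w where "w = p - (p \<bullet> \<theta>) *\<^sub>R \<theta>"
  define u where "u = sgn w"
  assume "\<not> ?thesis"
  then have w0: "w \<noteq> 0"
    by (auto simp: w_def p_def algebra_simps)
  have \<theta>\<theta>: "\<theta> \<bullet> \<theta> = 1"
    using \<theta> by (simp add: dot_square_norm)
  have w\<theta>: "w \<bullet> \<theta> = 0"
    by (simp add: w_def inner_diff_left \<theta>\<theta>)
  have u\<theta>: "u \<bullet> \<theta> = 0"
    by (simp add: u_def sgn_div_norm w\<theta>)
  have uu: "u \<bullet> u = 1"
    using w0 by (simp add: u_def dot_square_norm norm_sgn)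
  define c where "c t = cos t *\<^sub>R \<theta> + sin t *\<^sub>R u" for t :: real
  have c_sphere: "c t \<in> sphere 0 1" for t
  proof -
    have "c t \<bullet> c t = (cos t)\<^sup>2 + (sin t)\<^sup>2"
      using u\<theta> by (simp add: c_def inner_add_left inner_add_right \<theta>\<theta> uu inner_commute power2_eq_square)
    then show ?thesis by (simp add: norm_eq_sqrt_inner)
  qed
  have dc: "(c has_derivative (\<lambda>t. t *\<^sub>R u)) (at 0)"
    unfolding c_def by (auto intro!: derivative_eq_intros)
  have dFG: "((\<lambda>x. F x - G x) has_derivative (\<lambda>v. v \<bullet> p)) (at (c 0))"
    using has_derivative_diff[OF F[unfolded gderiv_def] G[unfolded gderiv_def]]
    by (simp add: c_def p_def inner_diff_right)
  have "((\<lambda>t. F (c t) - G (c t)) has_derivative (\<lambda>t. (t *\<^sub>R u) \<bullet> p)) (at 0)"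
    by (rule has_derivative_compose[OF dc dFG])
  moreover have "(\<lambda>t. F (c t) - G (c t)) = (\<lambda>t. 0)"
    using eq[OF c_sphere] by auto
  ultimately have "((\<lambda>t::real. 0::real) has_derivative (\<lambda>t. (t *\<^sub>R u) \<bullet> p)) (at 0)"
    by simp
  then have "(\<lambda>t::real. (t *\<^sub>R u) \<bullet> p) = (\<lambda>t. 0)"
    by (rule has_derivative_unique) simp
  then have up: "u \<bullet> p = 0"
    by (metis scaleR_one)
  then have "w \<bullet> p = 0"
    using w0 by (simp add: u_def sgn_div_norm)
  then have "w \<bullet> w = 0"
    using w\<theta> by (subst (2) w_def) (simp add: inner_diff_right)
  then show False using w0 by simp
qed

lemma sphere_grad_eq:
  assumes "C_extension 1 f U F" "GDERIV F \<theta> :> g" "\<theta> \<in> sphere 0 1"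
  shows "sphere_grad f \<theta> = g - (g \<bullet> \<theta>) *\<^sub>R \<theta>"
  unfolding sphere_grad_def
proof (rule the_equality)
  show "\<exists>U F h. C_extension 1 f U F \<and> GDERIV F \<theta> :> h \<and> g - (g \<bullet> \<theta>) *\<^sub>R \<theta> = h - (h \<bullet> \<theta>) *\<^sub>R \<theta>"
    using assms by blast
next
  fix v
  assume "\<exists>U F h. C_extension 1 f U F \<and> GDERIV F \<theta> :> h \<and> v = h - (h \<bullet> \<theta>) *\<^sub>R \<theta>"
  then obtain V K h where K: "C_extension 1 f V K" "GDERIV K \<theta> :> h" "v = h - (h \<bullet> \<theta>) *\<^sub>R \<theta>"
    by blast
  have "K x = F x" if "x \<in> sphere 0 1" for x
    using that K(1) assms(1) by (auto simp: C_extension_def)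
  then show "v = g - (g \<bullet> \<theta>) *\<^sub>R \<theta>"
    using tangential_gradient_unique[OF K(2) assms(2) _ assms(3)] K(3) by blast
qed

definition sphere_deriv :: "'n \<Rightarrow> (real ^ 'n \<Rightarrow> real) \<Rightarrow> real ^ 'n \<Rightarrow> real" where
  "sphere_deriv i f \<theta> = sphere_grad f \<theta> \<bullet> axis i 1"

text \<open>\<open>sphere_derivs [i\<^sub>1, \<dots>, i\<^sub>k] f\<close> applies \<open>i\<^sub>k\<close> first and \<open>i\<^sub>1\<close> last.\<close>

definition sphere_derivs :: "'n list \<Rightarrow> (real ^ 'n \<Rightarrow> real) \<Rightarrow> real ^ 'n \<Rightarrow> real" where
  "sphere_derivs is f = foldr sphere_deriv is f"

text \<open>
  The \<open>k\<close>-linear form of the hypermatrix of \<open>k\<close>-th order spherical derivatives. Its arguments are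
  \<open>v 0, \<dots>, v (k - 1)\<close>, with \<open>v j\<close> paired with the \<open>j\<close>-th entry of the multi-index.
\<close>

definition sphere_form :: "nat \<Rightarrow> (real ^ 'n \<Rightarrow> real) \<Rightarrow> real ^ 'n \<Rightarrow> (nat \<Rightarrow> real ^ 'n) \<Rightarrow> real" where
  "sphere_form k f \<theta> v =
     (\<Sum>is | length is = k. sphere_derivs is f \<theta> * (\<Prod>j<k. v j $ (is ! j)))"

definition sphere_op_norm :: "nat \<Rightarrow> (real ^ 'n \<Rightarrow> real) \<Rightarrow> real ^ 'n \<Rightarrow> real" where
  "sphere_op_norm k f \<theta> = (SUP v \<in> {v. \<forall>j<k. norm (v j) = 1}. sphere_form k f \<theta> v)"

definition sphere_op_norm_L2 :: "nat \<Rightarrow> (real ^ 'n \<Rightarrow> real) \<Rightarrow> real" where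
  "sphere_op_norm_L2 k f = sqrt (\<integral>\<theta>. (sphere_op_norm k f \<theta>)\<^sup>2 \<partial>sphere_measure)"

end

theory Submission
  imports Defs "HOL-Computational_Algebra.Polynomial"
begin

text \<open>
  The proof replaces the logarithmic Sobolev inequality by a path argument of Maurey--Pisier type. Let \<open>x\<close>
  and \<open>y\<close> be independent standard Gaussian vectors. The direction of \<open>cos t *\<^sub>R x + sin t *\<^sub>R y\<close> for \<open>t\<close> between
  \<open>- pi / 2\<close> and \<open>pi / 2\<close> runs along a half great circle, and the law of position and velocity does not
  depend on \<open>t\<close>. Comparing the value of a function at the direction of \<open>x\<close> with the average of its values at
  the directions of \<open>y\<close> and \<open>- y\<close> therefore bounds its centred \<open>2 r\<close>-th moment by \<open>(pi / 2)\<^sup>2\<^sup>r\<close> times the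
  \<open>2 r\<close>-th moment of its gradient times that of one coordinate of a uniform unit vector in dimension
  \<open>n - 1\<close>, which is at most \<open>(r / (n - 1))\<^sup>r\<close>.

  This applies to the operator norms of the iterated derivatives through smooth approximations of the
  supremum (softmax over a finite net), because the gradient of the norm of order \<open>k\<close> is dominated
  by the norm of order \<open>k + 1\<close>. Iterating from order \<open>d\<close> down gives
  \<open>\<integral> f\<^sup>2\<^sup>r \<le> (d * s ^ d)\<^sup>2\<^sup>r\<close> with \<open>s = pi / 2 * sqrt (r / (n - 1))\<close>, and the exponential series of
  \<open>\<bar>f\<bar> powr (2 / d)\<close> is dominated by a geometric series.
\<close>

text \<open>The obstacle is the factor \<open>1 / norm (z t)\<close> in the velocity of the
  direction of \<open>z t\<close>. With Lebesgue measure in \<open>t\<close>, Hoelder's inequality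
  would call for the Gaussian expectation of \<open>norm x\<close> to the power
  \<open>- 2 * r\<close>, which is infinite as soon as \<open>2 * r\<close> reaches the dimension.
  The weight is therefore the angular speed itself: its integral over the half circle is
  \<open>pi\<close> whatever the end points, and dividing by its power \<open>2 * r - 1\<close>
  leaves one factor \<open>1 / norm x\<close>, times \<open>perp e y\<close>, times an even power of
  the cosine of the angle between the gradient and the tangential velocity. The expectations of
  \<open>1 / norm x\<close> and of \<open>perp e y\<close> multiply to the mean angular speed, at
  most 1, so neither has to be evaluated.

  The constant: the bound on the top norm and the means of the lower ones contribute
  \<open>s ^ d\<close> each, hence the factor \<open>d\<close>, and
  \<open>d \<le> (3 / 2) ^ d\<close>. So \<open>1 / (8 * e)\<close> meets \<open>9 / 4\<close> and
  \<open>pi\<^sup>2 / 4\<close>, which gives \<open>x = 9 * pi\<^sup>2 / (128 * e)\<close>, and the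
  series is at most \<open>1 + x / (1 - x * e)\<close>, below 2.\<close>

section \<open>Gaussian measure\<close>

text \<open>
  Uniqueness of translation invariant measures: for \<open>\<mu>\<close> translation invariant, Fubini gives
  \<open>\<mu> A * \<lambda> B = \<lambda> A * \<mu> (- B)\<close>, and the ball \<open>B\<close> has the same measure under both.
\<close>

lemma lborel_distr_orthogonal:
  fixes f :: "'a::euclidean_space \<Rightarrow> 'a"
  assumes f: "orthogonal_transformation f"
  shows "distr lborel borel f = lborel"
proof (rule measure_eqI)
  have lin: "linear f" and nrm: "norm (f x) = norm x" for x
    using f by (auto simp: orthogonal_transformation)
  have [measurable]: "f \<in> borel_measurable borel"
    by (rule borel_measurable_continuous_onI)
      (simp add: lin linear_continuous_on linear_conv_bounded_linear[symmetric])
  define \<mu> :: "'a measure" where "\<mu> = distr lborel borel f"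
  have [measurable_cong, simp]: "sets \<mu> = sets borel" by (simp add: \<mu>_def)
  have surj: "surj f" by (rule orthogonal_transformation_surj[OF f])
  have shift: "(\<integral>\<^sup>+x. h (x + a) \<partial>\<mu>) = (\<integral>\<^sup>+x. h x \<partial>\<mu>)"
    if [measurable]: "h \<in> borel_measurable borel" for h a
  proof -
    \<comment> \<open>Translating by \<open>f b\<close> after \<open>f\<close> is the same as
      translating by \<open>b\<close> before \<open>f\<close>, and \<open>lborel\<close> absorbs the
      latter.\<close>
    obtain b where b: "a = f b" using surj by (auto simp: surj_def)
    have "(\<integral>\<^sup>+x. h (x + a) \<partial>\<mu>) = (\<integral>\<^sup>+x. h (f (b + x)) \<partial>lborel)"
      by (simp add: \<mu>_def nn_integral_distr b linear_add[OF lin] add.commute)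
    also have "\<dots> = (\<integral>\<^sup>+x. h (f x) \<partial>distr lborel borel ((+) b))"
      by (subst nn_integral_distr) auto
    also have "\<dots> = (\<integral>\<^sup>+x. h x \<partial>\<mu>)"
      by (simp add: lborel_distr_plus \<mu>_def nn_integral_distr)
    finally show ?thesis .
  qed
  have shift': "(\<integral>\<^sup>+x. h (x + a) \<partial>lborel) = (\<integral>\<^sup>+x. h x \<partial>lborel)"
    if [measurable]: "h \<in> borel_measurable borel" for h and a :: 'a
    by (subst (2) lborel_distr_plus[of a, symmetric]) (simp add: nn_integral_distr add.commute)
  interpret L: sigma_finite_measure "lborel :: 'a measure" by (rule lborel.sigma_finite_measure_axioms)
  have ball: "emeasure \<mu> (ball 0 r) = emeasure lborel (ball (0::'a) r)" for r
  proof -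
    have "f -` ball 0 r = ball 0 r" by (auto simp: nrm)
    then show ?thesis by (simp add: \<mu>_def emeasure_distr)
  qed
  interpret M: sigma_finite_measure \<mu>
  proof
    show "\<exists>A. countable A \<and> A \<subseteq> sets \<mu> \<and> \<Union> A = space \<mu> \<and> (\<forall>a\<in>A. emeasure \<mu> a \<noteq> \<infinity>)"
    proof (intro exI[of _ "range (\<lambda>n::nat. ball (0::'a) (real n))"] conjI)
      show "\<Union> (range (\<lambda>n::nat. ball (0::'a) (real n))) = space \<mu>"
        using reals_Archimedean2 by (auto simp: \<mu>_def)
      show "\<forall>a\<in>range (\<lambda>n::nat. ball (0::'a) (real n)). emeasure \<mu> a \<noteq> \<infinity>"
        using emeasure_lborel_ball_finite[of "0::'a"] by (auto simp: ball less_top)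
    qed auto
  qed
  interpret P: pair_sigma_finite lborel \<mu> by standard
  let ?B = "ball (0::'a) 1"
  have [measurable]: "?B \<in> sets borel" by simp
  fix A :: "'a set" assume "A \<in> sets (distr lborel borel f)"
  then have A[measurable]: "A \<in> sets borel" by simp
  have ball_shift: "(\<integral>\<^sup>+y. indicator ?B (y - x) \<partial>lborel) = emeasure lborel ?B" for x
  proof -
    have "(\<integral>\<^sup>+y. indicator ?B (y + - x) \<partial>lborel) = (\<integral>\<^sup>+y. indicator ?B y \<partial>lborel)"
      by (rule shift') measurable
    then show ?thesis by simp
  qed
  have "emeasure \<mu> A * emeasure lborel ?B = (\<integral>\<^sup>+x. indicator A x * (\<integral>\<^sup>+y. indicator ?B y \<partial>lborel) \<partial>\<mu>)"
    by (simp add: nn_integral_multc)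
  also have "\<dots> = (\<integral>\<^sup>+x. indicator A x * (\<integral>\<^sup>+y. indicator ?B (y - x) \<partial>lborel) \<partial>\<mu>)"
    by (simp add: ball_shift)
  also have "\<dots> = (\<integral>\<^sup>+x. (\<integral>\<^sup>+y. indicator A x * indicator ?B (y - x) \<partial>lborel) \<partial>\<mu>)"
    by (intro nn_integral_cong nn_integral_cmult[symmetric]) measurable
  also have "\<dots> = (\<integral>\<^sup>+y. (\<integral>\<^sup>+x. indicator A x * indicator ?B (y - x) \<partial>\<mu>) \<partial>lborel)"
    by (rule P.Fubini') measurable
  also have "\<dots> = (\<integral>\<^sup>+y. (\<integral>\<^sup>+x. indicator A (x + y) * indicator ?B x \<partial>\<mu>) \<partial>lborel)"
  proof (rule nn_integral_cong)
    fix y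
    have "(\<integral>\<^sup>+x. indicator A x * indicator ?B (y - x) \<partial>\<mu>) =
        (\<integral>\<^sup>+x. indicator A (x + y) * indicator ?B (y - (x + y)) \<partial>\<mu>)"
      by (rule shift[symmetric]) measurable
    also have "\<dots> = (\<integral>\<^sup>+x. indicator A (x + y) * indicator ?B x \<partial>\<mu>)"
      by (intro nn_integral_cong) (auto split: split_indicator)
    finally show "(\<integral>\<^sup>+x. indicator A x * indicator ?B (y - x) \<partial>\<mu>) =
        (\<integral>\<^sup>+x. indicator A (x + y) * indicator ?B x \<partial>\<mu>)" .
  qed
  also have "\<dots> = (\<integral>\<^sup>+x. (\<integral>\<^sup>+y. indicator A (y + x) * indicator ?B x \<partial>lborel) \<partial>\<mu>)"
    by (subst P.Fubini') (auto simp: add.commute)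
  also have "\<dots> = (\<integral>\<^sup>+x. emeasure lborel A * indicator ?B x \<partial>\<mu>)"
    using shift'[of "indicator A"] by (simp add: nn_integral_multc)
  also have "\<dots> = emeasure lborel A * emeasure lborel ?B"
    by (simp add: nn_integral_cmult ball)
  finally have eq: "emeasure \<mu> A * emeasure lborel ?B = emeasure lborel A * emeasure lborel ?B" .
  have "emeasure lborel ?B \<noteq> 0" "emeasure lborel ?B \<noteq> top"
    using content_ball_pos[of 1 "0::'a"] emeasure_lborel_ball_finite[of "0::'a" 1]
    by (auto simp: measure_def)
  with eq show "emeasure (distr lborel borel f) A = emeasure lborel A"
    unfolding \<mu>_def by (metis ennreal_mult_divide_eq)
qed simp

text \<open>Defined on every Euclidean space at once, so that a pair of independent Gaussian vectors
  is again \<open>gauss\<close>, on the product type, and rotating the pair is an orthogonal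
  transformation there.\<close>

definition gauss :: "'a::euclidean_space measure" where
  "gauss = density lborel (\<lambda>x. ennreal (exp (- (norm x)\<^sup>2 / 2) / sqrt (2 * pi) ^ DIM('a)))"

lemma sets_gauss [simp, measurable_cong]: "sets gauss = sets borel"
  and space_gauss [simp]: "space gauss = UNIV"
  by (simp_all add: gauss_def)

lemma prob_space_gauss: "prob_space (gauss :: 'a::euclidean_space measure)"
proof
  have "exp (- (norm x)\<^sup>2 / 2) / sqrt (2 * pi) ^ DIM('a) = (\<Prod>b\<in>Basis. std_normal_density (x \<bullet> b))" for x :: 'a
  proof -
    have "(norm x)\<^sup>2 = (\<Sum>b\<in>Basis. (x \<bullet> b)\<^sup>2)"
      by (subst norm_eq_sqrt_inner, subst euclidean_inner) (simp add: sum_nonneg power2_eq_square)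
    then show ?thesis
      by (simp add: std_normal_density_def prod_dividef exp_sum[symmetric] sum_divide_distrib sum_negf
          power2_eq_square power_divide)
  qed
  then have "emeasure gauss (space (gauss :: 'a measure)) =
      (\<integral>\<^sup>+x. (\<Prod>b\<in>Basis. ennreal (std_normal_density (x \<bullet> b))) \<partial>(lborel :: 'a measure))"
    by (simp add: gauss_def emeasure_density prod_ennreal)
  also have "\<dots> = (\<Prod>b\<in>(Basis::'a set). (\<integral>\<^sup>+x. ennreal (std_normal_density x) \<partial>lborel))"
    by (rule nn_integral_lborel_prod) auto
  also have "(\<integral>\<^sup>+x. ennreal (std_normal_density x) \<partial>lborel) = 1"
    using prob_space.emeasure_space_1[OF prob_space_normal_density[of 1 0]]
    by (simp add: emeasure_density)
  finally show "emeasure gauss (space (gauss :: 'a measure)) = 1" by simp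
qed

interpretation gauss: prob_space gauss by (rule prob_space_gauss)

lemma orthogonal_transformation_measurable [measurable_dest]:
  fixes f :: "'a::euclidean_space \<Rightarrow> 'a"
  shows "orthogonal_transformation f \<Longrightarrow> f \<in> borel_measurable borel"
  by (intro borel_measurable_continuous_onI)
    (simp add: orthogonal_transformation_linear linear_continuous_on linear_conv_bounded_linear[symmetric])

lemma nn_integral_gauss_orthogonal:
  fixes f :: "'a::euclidean_space \<Rightarrow> 'a"
  assumes f: "orthogonal_transformation f" and [measurable]: "h \<in> borel_measurable borel"
  shows "(\<integral>\<^sup>+x. h (f x) \<partial>gauss) = (\<integral>\<^sup>+x. h x \<partial>gauss)"
proof -
  note [measurable] = orthogonal_transformation_measurable[OF f]
  have nrm: "norm (f x) = norm x" for x
    using f by (auto simp: orthogonal_transformation)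
  have "(\<integral>\<^sup>+x. h x \<partial>gauss) =
      (\<integral>\<^sup>+x. ennreal (exp (- (norm x)\<^sup>2 / 2) / sqrt (2 * pi) ^ DIM('a)) * h x \<partial>distr lborel borel f)"
    by (simp add: gauss_def nn_integral_density lborel_distr_orthogonal[OF f])
  also have "\<dots> = (\<integral>\<^sup>+x. h (f x) \<partial>gauss)"
    by (simp add: gauss_def nn_integral_density nn_integral_distr nrm)
  finally show ?thesis ..
qed

text \<open>The norm on the product type is Euclidean, so squared norms add and the density
  factorises.\<close>

lemma nn_integral_gauss_prod:
  fixes h :: "'a::euclidean_space \<times> 'b::euclidean_space \<Rightarrow> ennreal"
  assumes [measurable]: "h \<in> borel_measurable borel"
  shows "(\<integral>\<^sup>+z. h z \<partial>gauss) = (\<integral>\<^sup>+x. (\<integral>\<^sup>+y. h (x, y) \<partial>gauss) \<partial>gauss)"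
proof -
  let ?a = "\<lambda>x::'a. ennreal (exp (- (norm x)\<^sup>2 / 2) / sqrt (2 * pi) ^ DIM('a))"
  let ?b = "\<lambda>x::'b. ennreal (exp (- (norm x)\<^sup>2 / 2) / sqrt (2 * pi) ^ DIM('b))"
  have [measurable]: "h \<in> borel_measurable (borel \<Otimes>\<^sub>M borel)"
    by (simp add: borel_prod)
  have "(\<integral>\<^sup>+z. h z \<partial>gauss) = (\<integral>\<^sup>+z. (case z of (x, y) \<Rightarrow> ?a x * (?b y * h (x, y))) \<partial>lborel)"
    unfolding gauss_def
    by (subst nn_integral_density)
      (auto intro!: nn_integral_cong simp: norm_Pair power_add exp_add[symmetric] add_divide_distrib
         ennreal_mult[symmetric] mult.assoc[symmetric])
  also have "\<dots> = (\<integral>\<^sup>+x. (\<integral>\<^sup>+y. ?a x * (?b y * h (x, y)) \<partial>lborel) \<partial>lborel)"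
    by (simp add: lborel_prod[symmetric] lborel.nn_integral_fst[symmetric])
  also have "\<dots> = (\<integral>\<^sup>+x. (\<integral>\<^sup>+y. h (x, y) \<partial>gauss) \<partial>gauss)"
    unfolding gauss_def by (simp add: nn_integral_density nn_integral_cmult lborel.borel_measurable_nn_integral)
  finally show ?thesis .
qed

text \<open>This is what Gaussian vectors are for: position and velocity at parameter
  \<open>t\<close> are the image of \<open>(x, y)\<close> under an orthogonal map of the product
  space, so their joint law is the same for all \<open>t\<close>.\<close>

lemma nn_integral_gauss_rotate:
  fixes h :: "'a::euclidean_space \<times> 'a \<Rightarrow> ennreal"
  assumes [measurable]: "h \<in> borel_measurable borel"
  shows "(\<integral>\<^sup>+x. (\<integral>\<^sup>+y. h (cos t *\<^sub>R x + sin t *\<^sub>R y, cos t *\<^sub>R y - sin t *\<^sub>R x) \<partial>gauss) \<partial>gauss)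
    = (\<integral>\<^sup>+x. (\<integral>\<^sup>+y. h (x, y) \<partial>gauss) \<partial>gauss)"
proof -
  define f :: "'a \<times> 'a \<Rightarrow> 'a \<times> 'a" where
    "f z = (cos t *\<^sub>R fst z + sin t *\<^sub>R snd z, cos t *\<^sub>R snd z - sin t *\<^sub>R fst z)" for z
  have "linear f"
    by (rule linearI) (auto simp: f_def algebra_simps)
  moreover have "norm (f z) = norm z" for z
  proof -
    have "f z \<bullet> f z = (cos t)\<^sup>2 * (z \<bullet> z) + (sin t)\<^sup>2 * (z \<bullet> z)"
      unfolding f_def inner_prod_def fst_conv snd_conv
      by (simp add: inner_simps inner_commute power2_eq_square algebra_simps)
    also have "\<dots> = z \<bullet> z"
      by (simp add: distrib_right[symmetric])
    finally show ?thesis by (simp add: norm_eq_sqrt_inner)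
  qed
  ultimately have f: "orthogonal_transformation f"
    by (simp add: orthogonal_transformation)
  note [measurable] = orthogonal_transformation_measurable[OF f]
  have "(\<integral>\<^sup>+x. (\<integral>\<^sup>+y. h (f (x, y)) \<partial>gauss) \<partial>gauss) = (\<integral>\<^sup>+x. (\<integral>\<^sup>+y. h (x, y) \<partial>gauss) \<partial>gauss)"
    using nn_integral_gauss_orthogonal[OF f assms] by (simp add: nn_integral_gauss_prod)
  then show ?thesis by (simp add: f_def)
qed

section \<open>Polar decomposition: norm and direction are independent\<close>

lemma nn_integral_sphere_measure:
  fixes g :: "real ^ 'n \<Rightarrow> ennreal"
  assumes [measurable]: "g \<in> borel_measurable borel"
  shows "(\<integral>\<^sup>+\<theta>. g \<theta> \<partial>sphere_measure) =
    (\<integral>\<^sup>+x. indicator (ball 0 1) x * g (sgn x) \<partial>lborel) / emeasure lborel (ball (0 :: real ^ 'n) 1)"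
proof -
  have [measurable]: "ball (0 :: real ^ 'n) 1 \<in> sets borel" "sphere (0 :: real ^ 'n) 1 \<in> sets borel"
    by simp_all
  have "(\<integral>\<^sup>+\<theta>. g \<theta> \<partial>sphere_measure) =
      (\<integral>\<^sup>+\<theta>. g \<theta> * indicator (sphere 0 1) \<theta> \<partial>distr (uniform_measure lborel (ball 0 1)) borel sgn)"
    unfolding sphere_measure_def by (rule nn_integral_restrict_space) simp
  also have "\<dots> = (\<integral>\<^sup>+x. g (sgn x) * indicator (sphere 0 1) (sgn x) \<partial>uniform_measure lborel (ball 0 1))"
    by (rule nn_integral_distr) measurable
  also have "\<dots> = (\<integral>\<^sup>+x. (g (sgn x) * indicator (sphere 0 1) (sgn x)) * indicator (ball 0 1) x \<partial>lborel)
      / emeasure lborel (ball (0 :: real ^ 'n) 1)"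
    by (rule nn_integral_uniform_measure) measurable
  also have "(\<integral>\<^sup>+x. (g (sgn x) * indicator (sphere 0 1) (sgn x)) * indicator (ball 0 1) x \<partial>lborel)
      = (\<integral>\<^sup>+x. indicator (ball 0 1) x * g (sgn x) \<partial>lborel)"
  proof (rule nn_integral_cong_AE)
    show "AE x in lborel. (g (sgn x) * indicator (sphere 0 1) (sgn x)) * indicator (ball 0 1) x
        = indicator (ball 0 1) x * g (sgn x)"
      using AE_lborel_singleton[of 0] by eventually_elim (simp add: norm_sgn mult.commute)
  qed
  finally show ?thesis .
qed

lemma nn_integral_ball_sgn:
  fixes g :: "'a::euclidean_space \<Rightarrow> ennreal"
  assumes [measurable]: "g \<in> borel_measurable borel" and r: "0 < r"
    and [measurable]: "(sgn :: 'a \<Rightarrow> 'a) \<in> borel_measurable borel"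
  shows "(\<integral>\<^sup>+x. indicator (ball 0 r) x * g (sgn x) \<partial>lborel) =
    ennreal (r ^ DIM('a)) * (\<integral>\<^sup>+x. indicator (ball 0 1) x * g (sgn x) \<partial>lborel)"
proof -
  have [measurable]: "ball (0 :: 'a) s \<in> sets borel" for s
    by simp
  have sgn: "sgn (r *\<^sub>R x) = sgn x" for x :: 'a
    using r by (simp add: sgn_div_norm)
  have ind: "indicator (ball 0 r) (r *\<^sub>R x) = (indicator (ball 0 1) x :: ennreal)" for x :: 'a
    using r by (simp add: indicator_def)
  have "(\<integral>\<^sup>+x. indicator (ball 0 r) x * g (sgn x) \<partial>lborel) =
     (\<integral>\<^sup>+x. indicator (ball 0 r) x * g (sgn x) \<partial>density (distr lborel borel (\<lambda>x. 0 + r *\<^sub>R x)) (\<lambda>_. \<bar>r\<bar> ^ DIM('a)))"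
    using r by (subst lborel_affine[of r 0]) simp_all
  also have "\<dots> = (\<integral>\<^sup>+x. ennreal (r ^ DIM('a)) * (indicator (ball 0 1) x * g (sgn x)) \<partial>lborel)"
    using r by (simp add: nn_integral_density nn_integral_distr sgn ind)
  finally show ?thesis by (simp add: nn_integral_cmult)
qed

text \<open>Push both \<open>g (sgn x) dx\<close> and the constant multiple \<open>?S dx\<close>
  forward under the norm. By the scaling of balls the two measures agree on every
  \<open>{..<r}\<close>; these half-lines are closed under intersection and generate the Borel sets,
  so the measures coincide. Finiteness of \<open>?S\<close> makes them finite on the generators,
  which the uniqueness theorem requires.\<close>

lemma nn_integral_lborel_radial:
  fixes g :: "real ^ 'n \<Rightarrow> ennreal"
  assumes [measurable]: "g \<in> borel_measurable borel" "k \<in> borel_measurable borel"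
    and fin: "(\<integral>\<^sup>+\<theta>. g \<theta> \<partial>sphere_measure) \<noteq> \<infinity>"
  shows "(\<integral>\<^sup>+x. k (norm x) * g (sgn x) \<partial>lborel) =
    (\<integral>\<^sup>+x. k (norm (x :: real ^ 'n)) \<partial>lborel) * (\<integral>\<^sup>+\<theta>. g \<theta> \<partial>sphere_measure)"
proof -
  let ?V = "\<lambda>r. emeasure lborel (ball (0 :: real ^ 'n) r)"
  let ?S = "\<integral>\<^sup>+\<theta>. g \<theta> \<partial>sphere_measure"
  have [measurable]: "ball (0 :: real ^ 'n) r \<in> sets borel" for r
    by simp
  define M where "M = distr (density lborel (\<lambda>x. g (sgn x))) borel (norm :: real ^ 'n \<Rightarrow> real)"
  define N where "N = distr (density lborel (\<lambda>x. ?S)) borel (norm :: real ^ 'n \<Rightarrow> real)"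
  have vol: "?V r = ennreal (r ^ CARD('n)) * ?V 1" if "0 < r" for r
    using nn_integral_ball_sgn[of "\<lambda>_ :: real ^ 'n. 1" r] that by simp
  have nv: "norm -` {..<r} = ball (0 :: real ^ 'n) r" for r
    by auto
  have M: "emeasure M {..<r} = (\<integral>\<^sup>+x. indicator (ball 0 r) x * g (sgn x) \<partial>lborel)" for r
    unfolding M_def by (simp add: emeasure_distr nv emeasure_density mult.commute)
  have N: "emeasure N {..<r} = ?V r * ?S" for r
    unfolding N_def by (simp add: emeasure_distr nv emeasure_density nn_integral_cmult mult.commute)
  have MN: "emeasure M {..<r} = emeasure N {..<r}" for r
  proof (cases "0 < r")
    case True
    let ?I = "\<integral>\<^sup>+x. indicator (ball 0 1) x * g (sgn x) \<partial>lborel"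
    have "?I = ?I * ?V 1 / ?V 1"
      by (rule ennreal_mult_divide_eq[symmetric]) (use emeasure_ball_pos emeasure_ball_finite in auto)
    also have "\<dots> = ?V 1 * ?S"
      by (simp only: nn_integral_sphere_measure[OF assms(1)] ennreal_times_divide mult.commute)
    finally have "?I = ?V 1 * ?S" .
    then show ?thesis
      using True by (simp add: M N nn_integral_ball_sgn[of g r] vol[of r] mult.assoc)
  next
    case False
    then show ?thesis by (simp add: M N ball_empty)
  qed
  have "M = N"
  proof (rule measure_eqI_generator_eq[of "range lessThan" UNIV])
    show "Int_stable (range lessThan :: real set set)"
    proof (clarsimp simp: Int_stable_def)
      show "{..<a} \<inter> {..<b} \<in> range lessThan" for a b :: real
        by (rule range_eqI[of _ _ "min a b"]) auto
    qed
    show "sets M = sigma_sets UNIV (range lessThan)" "sets N = sigma_sets UNIV (range lessThan)"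
      by (simp_all add: M_def N_def borel_Iio sets_measure_of)
    show "range (\<lambda>i::nat. {..<real i}) \<subseteq> range lessThan" by auto
    show "(\<Union>i::nat. {..<real i}) = UNIV" using reals_Archimedean2 by auto
    show "emeasure M {..<real i} \<noteq> \<infinity>" for i
      unfolding MN N using fin emeasure_lborel_ball_finite[of "0 :: real ^ 'n" "real i"]
      by (simp add: ennreal_mult_eq_top_iff less_top)
  qed (use MN in auto)
  then have "(\<integral>\<^sup>+s. k s \<partial>M) = (\<integral>\<^sup>+s. k s \<partial>N)" by simp
  then show ?thesis
    by (simp add: M_def N_def nn_integral_distr nn_integral_density nn_integral_cmult mult.commute)
qed

text \<open>The Gaussian density is itself a function of the norm and is absorbed into
  \<open>k\<close>.\<close>

lemma nn_integral_gauss_radial: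
  fixes g :: "real ^ 'n \<Rightarrow> ennreal"
  assumes [measurable]: "g \<in> borel_measurable borel" "k \<in> borel_measurable borel"
    and fin: "(\<integral>\<^sup>+\<theta>. g \<theta> \<partial>sphere_measure) \<noteq> \<infinity>"
  shows "(\<integral>\<^sup>+x. k (norm x) * g (sgn x) \<partial>gauss) =
    (\<integral>\<^sup>+x. k (norm (x :: real ^ 'n)) \<partial>gauss) * (\<integral>\<^sup>+\<theta>. g \<theta> \<partial>sphere_measure)"
proof -
  let ?h = "\<lambda>s. ennreal (exp (- s\<^sup>2 / 2) / sqrt (2 * pi) ^ DIM(real ^ 'n))"
  have "(\<integral>\<^sup>+x. (?h (norm x) * k (norm x)) * g (sgn x) \<partial>lborel) =
      (\<integral>\<^sup>+x. ?h (norm x) * k (norm (x :: real ^ 'n)) \<partial>lborel) * (\<integral>\<^sup>+\<theta>. g \<theta> \<partial>sphere_measure)"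
    by (rule nn_integral_lborel_radial[of g "\<lambda>s. ?h s * k s"]) (use fin in auto)
  then show ?thesis
    unfolding gauss_def by (simp add: nn_integral_density mult.assoc)
qed

lemma nn_integral_gauss_sgn:
  fixes g :: "real ^ 'n \<Rightarrow> ennreal"
  assumes "g \<in> borel_measurable borel" "(\<integral>\<^sup>+\<theta>. g \<theta> \<partial>sphere_measure) \<noteq> \<infinity>"
  shows "(\<integral>\<^sup>+x. g (sgn x) \<partial>gauss) = (\<integral>\<^sup>+\<theta>. g \<theta> \<partial>sphere_measure)"
  using nn_integral_gauss_radial[of g "\<lambda>_. 1"] assms
  by (simp add: prob_space.emeasure_space_1[OF prob_space_gauss, simplified])

section \<open>Rotation paths\<close>

text \<open>
  Hoelder's inequality with weight \<open>\<omega>\<close>, obtained by integrating Young's inequality (here Bernoulli's)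
  at the optimal scale \<open>l\<close>.
\<close>

lemma power_integral_le_weighted:
  fixes q \<omega> :: "real \<Rightarrow> real"
  assumes "a \<le> b" and q: "continuous_on {a..b} q" and \<omega>: "continuous_on {a..b} \<omega>"
    and pos: "\<And>t. t \<in> {a..b} \<Longrightarrow> 0 < \<omega> t" and L: "integral {a..b} \<omega> \<le> L" "0 < L"
  shows "(integral {a..b} (\<lambda>t. \<bar>q t\<bar>)) ^ Suc p \<le> L ^ p * integral {a..b} (\<lambda>t. \<bar>q t\<bar> ^ Suc p / \<omega> t ^ p)"
proof -
  define I where "I = integral {a..b} (\<lambda>t. \<bar>q t\<bar>)"
  define J where "J = integral {a..b} (\<lambda>t. \<bar>q t\<bar> ^ Suc p / \<omega> t ^ p)"
  have iq: "(\<lambda>t. \<bar>q t\<bar>) integrable_on {a..b}"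
    by (intro integrable_continuous_real continuous_intros q)
  have i\<omega>: "\<omega> integrable_on {a..b}"
    by (intro integrable_continuous_real \<omega>)
  have iJ: "(\<lambda>t. \<bar>q t\<bar> ^ Suc p / \<omega> t ^ p) integrable_on {a..b}"
    using pos by (intro integrable_continuous_real continuous_intros q \<omega>) force
  have I0: "0 \<le> I" unfolding I_def by (rule integral_nonneg[OF iq]) simp
  have J0: "0 \<le> J" unfolding J_def
    by (rule integral_nonneg[OF iJ]) (use pos in \<open>force intro: divide_nonneg_pos\<close>)
  show ?thesis
  proof (cases "I = 0")
    case True
    then show ?thesis using J0 L unfolding I_def[symmetric] J_def[symmetric] by simp
  next
    case False
    define l where "l = I / L"
    have l: "0 < l" using False I0 L by (simp add: l_def)
    have young: "real (Suc p) * \<bar>q t\<bar> \<le> real p * l * \<omega> t + \<bar>q t\<bar> ^ Suc p / \<omega> t ^ p / l ^ p"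
      if t: "t \<in> {a..b}" for t
    proof -
      define s where "s = \<bar>q t\<bar> / (l * \<omega> t)"
      have lw: "0 < l * \<omega> t" using l pos[OF t] by simp
      have s: "0 \<le> s" "\<bar>q t\<bar> = s * (l * \<omega> t)" using l pos[OF t] by (simp_all add: s_def)
      have "1 + real (Suc p) * (s - 1) \<le> (1 + (s - 1)) ^ Suc p"
        by (rule Bernoulli_inequality) (use s in simp)
      then have "real (Suc p) * s \<le> real p + s ^ Suc p"
        by (simp add: algebra_simps)
      then have "(real (Suc p) * s) * (l * \<omega> t) \<le> (real p + s ^ Suc p) * (l * \<omega> t)"
        using lw by (intro mult_right_mono) auto
      also have "\<dots> = real p * l * \<omega> t + \<bar>q t\<bar> ^ Suc p / \<omega> t ^ p / l ^ p"
        using l pos[OF t] by (simp add: s(2) power_mult_distrib field_simps)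
      finally show ?thesis by (simp add: s(2) mult_ac)
    qed
    have "real (Suc p) * I = integral {a..b} (\<lambda>t. real (Suc p) * \<bar>q t\<bar>)"
      by (simp only: I_def integral_mult_right)
    also have "\<dots> \<le> integral {a..b} (\<lambda>t. real p * l * \<omega> t + \<bar>q t\<bar> ^ Suc p / \<omega> t ^ p / l ^ p)"
      by (intro integral_le integrable_add integrable_on_mult_right integrable_on_divide iq i\<omega> iJ young)
    also have "\<dots> = real p * l * integral {a..b} \<omega> + J / l ^ p"
      unfolding J_def by (subst integral_add)
        (intro integrable_on_mult_right integrable_on_divide i\<omega> iJ, intro integrable_on_mult_right integrable_on_divide i\<omega> iJ, simp only: integral_mult_right integral_divide)
    also have "\<dots> \<le> real p * l * L + J / l ^ p"
      using L l by (intro add_right_mono mult_left_mono) auto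
    also have "real p * l * L = real p * I" using L by (simp add: l_def)
    finally have "I \<le> J / l ^ p" by (simp add: algebra_simps)
    then have "I * l ^ p \<le> J" using l by (simp add: pos_le_divide_eq)
    then have "I ^ Suc p \<le> L ^ p * J"
      using L by (simp add: l_def power_divide field_simps)
    then show ?thesis by (simp add: I_def J_def)
  qed
qed

text \<open>The rate at which the direction of a point at \<open>x\<close> turns when it moves with
  velocity \<open>y\<close>: the area of the parallelogram spanned by \<open>x\<close> and
  \<open>y\<close>, divided by the squared distance from the origin.\<close>

definition angular_speed :: "'a::euclidean_space \<Rightarrow> 'a \<Rightarrow> real" where
  "angular_speed x y = sqrt ((norm x)\<^sup>2 * (norm y)\<^sup>2 - (x \<bullet> y)\<^sup>2) / (norm x)\<^sup>2"

text \<open>The Gram determinant is the squared area spanned by two vectors, and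
  \<open>(z t, w t)\<close> arises from \<open>(x, y)\<close> by a matrix of determinant 1. Hence
  the angular speed along the path is a constant divided by
  \<open>(norm (z t))\<^sup>2\<close>.\<close>

lemma gram_rotate:
  fixes x y :: "'a::euclidean_space"
  defines "z \<equiv> \<lambda>t. cos t *\<^sub>R x + sin t *\<^sub>R y" and "w \<equiv> \<lambda>t. cos t *\<^sub>R y - sin t *\<^sub>R x"
  shows "(norm (z t))\<^sup>2 * (norm (w t))\<^sup>2 - (z t \<bullet> w t)\<^sup>2 = (norm x)\<^sup>2 * (norm y)\<^sup>2 - (x \<bullet> y)\<^sup>2"
proof -
  let ?c = "cos t" and ?s = "sin t"
  have z: "(norm (z t))\<^sup>2 = ?c\<^sup>2 * (x \<bullet> x) + 2 * ?c * ?s * (x \<bullet> y) + ?s\<^sup>2 * (y \<bullet> y)"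
    unfolding z_def power2_norm_eq_inner by (simp add: inner_simps inner_commute power2_eq_square algebra_simps)
  have w: "(norm (w t))\<^sup>2 = ?c\<^sup>2 * (y \<bullet> y) - 2 * ?c * ?s * (x \<bullet> y) + ?s\<^sup>2 * (x \<bullet> x)"
    unfolding w_def power2_norm_eq_inner by (simp add: inner_simps inner_commute power2_eq_square algebra_simps)
  have zw: "z t \<bullet> w t = ?c * ?s * (y \<bullet> y - x \<bullet> x) + (?c\<^sup>2 - ?s\<^sup>2) * (x \<bullet> y)"
    by (simp add: w_def z_def inner_simps inner_commute power2_eq_square algebra_simps)
  have "(?c\<^sup>2 * A + 2 * ?c * ?s * B + ?s\<^sup>2 * C) * (?c\<^sup>2 * C - 2 * ?c * ?s * B + ?s\<^sup>2 * A)
      - (?c * ?s * (C - A) + (?c\<^sup>2 - ?s\<^sup>2) * B)\<^sup>2 = (?c\<^sup>2 + ?s\<^sup>2)\<^sup>2 * (A * C - B\<^sup>2)" for A B C :: real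
    by algebra
  then show ?thesis
    unfolding z w zw by (simp add: dot_square_norm)
qed

lemma rotate_nonzero:
  fixes x y :: "'a::euclidean_space"
  assumes "(x \<bullet> y)\<^sup>2 < (norm x)\<^sup>2 * (norm y)\<^sup>2"
  shows "cos t *\<^sub>R x + sin t *\<^sub>R y \<noteq> 0"
proof
  assume "cos t *\<^sub>R x + sin t *\<^sub>R y = 0"
  then show False using gram_rotate[where x=x and y=y and t=t] assms by simp
qed

text \<open>
  On the half circle of parameters the direction of \<open>z t\<close> moves from \<open>- y\<close> through \<open>x\<close> to \<open>y\<close>, so it turns
  by exactly \<open>pi\<close>, whatever the angle between \<open>x\<close> and \<open>y\<close>.
\<close>

lemma integral_angular_speed:
  fixes x y :: "'a::euclidean_space"
  defines "z \<equiv> \<lambda>t. cos t *\<^sub>R x + sin t *\<^sub>R y" and "w \<equiv> \<lambda>t. cos t *\<^sub>R y - sin t *\<^sub>R x"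
  assumes indep: "(x \<bullet> y)\<^sup>2 < (norm x)\<^sup>2 * (norm y)\<^sup>2"
  shows "continuous_on S (\<lambda>t. angular_speed (z t) (w t))"
    and "0 < angular_speed (z t) (w t)"
    and "integral {- (pi / 2)..pi / 2} (\<lambda>t. angular_speed (z t) (w t)) \<le> pi"
proof -
  define D where "D = sqrt ((norm x)\<^sup>2 * (norm y)\<^sup>2 - (x \<bullet> y)\<^sup>2)"
  have D: "0 < D" "D\<^sup>2 = (norm x)\<^sup>2 * (norm y)\<^sup>2 - (x \<bullet> y)\<^sup>2" using indep by (simp_all add: D_def)
  have z0: "z t \<noteq> 0" for t unfolding z_def by (rule rotate_nonzero[OF indep])
  have \<omega>: "angular_speed (z t) (w t) = D / (norm (z t))\<^sup>2" for t
    unfolding angular_speed_def D_def z_def w_def gram_rotate ..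
  have cont: "continuous_on S (\<lambda>t. D / (norm (z t))\<^sup>2)" for S
    using z0 unfolding z_def by (intro continuous_intros) auto
  show "continuous_on S (\<lambda>t. angular_speed (z t) (w t))" unfolding \<omega> by (rule cont)
  show "0 < angular_speed (z t) (w t)" for t unfolding \<omega> using D z0 by simp
  have y0: "y \<noteq> 0" using indep by auto
  \<comment> \<open>The antiderivative of \<open>D / (norm (z t))\<^sup>2\<close>: dividing the
    square norm by \<open>(cos t)\<^sup>2\<close> gives a quadratic polynomial in
    \<open>tan t\<close>, and completing its square gives the fact \<open>eq\<close> below. As the
    coefficient of \<open>tan t\<close> is positive, \<open>F\<close> rises from
    \<open>- pi / 2\<close> to \<open>pi / 2\<close>.\<close>
  define F where "F t = arctan (x \<bullet> y / D + (norm y)\<^sup>2 / D * tan t)" for t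
  have y: "0 < (norm y)\<^sup>2 / D" using D y0 by simp
  have ft: "filterlim (\<lambda>t. x \<bullet> y / D + (norm y)\<^sup>2 / D * tan t) at_top (at_left (pi / 2))"
    by (intro filterlim_tendsto_add_at_top[OF tendsto_const]
        filterlim_tendsto_pos_mult_at_top[OF tendsto_const y] filterlim_tan_at_left)
  have fb: "filterlim (\<lambda>t. x \<bullet> y / D + (norm y)\<^sup>2 / D * tan t) at_bot (at_right (- (pi / 2)))"
    by (subst filterlim_tendsto_add_at_bot_iff[OF tendsto_const])
      (intro filterlim_tendsto_pos_mult_at_bot[OF tendsto_const y] filterlim_tan_at_right)
  have der: "(F has_real_derivative D / (norm (z t))\<^sup>2) (at t)" if "- (pi / 2) < t" "t < pi / 2" for t
  proof -
    have c: "cos t \<noteq> 0" using that cos_gt_zero_pi[of t] by simp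
    have n: "(norm (z t))\<^sup>2 = (cos t)\<^sup>2 * (norm x)\<^sup>2 + 2 * cos t * sin t * (x \<bullet> y) + (sin t)\<^sup>2 * (norm y)\<^sup>2"
      unfolding z_def power2_norm_eq_inner by (simp add: inner_simps inner_commute power2_eq_square algebra_simps)
    have t: "tan t = sin t / cos t" by (simp add: tan_def)
    have "(norm y)\<^sup>2 * (norm (z t))\<^sup>2 = (cos t)\<^sup>2 * (D\<^sup>2 + (x \<bullet> y + (norm y)\<^sup>2 * tan t)\<^sup>2)"
      unfolding n t D(2) using c by (simp add: power2_eq_square field_simps)
    then have eq: "D\<^sup>2 + (x \<bullet> y + (norm y)\<^sup>2 * tan t)\<^sup>2 = (norm y)\<^sup>2 * (norm (z t))\<^sup>2 / (cos t)\<^sup>2"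
      using c by (simp add: field_simps)
    have "(F has_real_derivative ((norm y)\<^sup>2 * inverse ((cos t)\<^sup>2) / D) * inverse (1 + ((x \<bullet> y + (norm y)\<^sup>2 * tan t) / D)\<^sup>2)) (at t)"
      unfolding F_def using c D(1) by (auto intro!: derivative_eq_intros simp: add_divide_distrib)
    also have "((norm y)\<^sup>2 * inverse ((cos t)\<^sup>2) / D) * inverse (1 + ((x \<bullet> y + (norm y)\<^sup>2 * tan t) / D)\<^sup>2)
       = (norm y)\<^sup>2 * D / ((cos t)\<^sup>2 * (D\<^sup>2 + (x \<bullet> y + (norm y)\<^sup>2 * tan t)\<^sup>2))"
    proof -
      have "1 + (u / D)\<^sup>2 = (D\<^sup>2 + u\<^sup>2) / D\<^sup>2" for u using D(1) by (simp add: power_divide add_divide_distrib)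
      then show ?thesis using D(1) c by (simp add: field_simps power2_eq_square)
    qed
    also have "\<dots> = D / (norm (z t))\<^sup>2"
      unfolding eq using c y0 by simp
    finally show ?thesis .
  qed
  \<comment> \<open>The tangent has poles at both ends of the interval, so \<open>F\<close> is
    available only through its one-sided limits there; hence the fundamental theorem for improper
    integrals of nonnegative functions.\<close>
  have "interval_lebesgue_integral lborel (ereal (- (pi / 2))) (ereal (pi / 2)) (\<lambda>t. D / (norm (z t))\<^sup>2) = pi / 2 - - (pi / 2)"
  proof (rule interval_integral_FTC_nonneg)
    show "DERIV F t :> D / (norm (z t))\<^sup>2" if "ereal (- (pi / 2)) < ereal t" "ereal t < ereal (pi / 2)" for t
      using der that by simp
    show "isCont (\<lambda>t. D / (norm (z t))\<^sup>2) t" for t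
      using cont[of UNIV] by (simp add: continuous_on_eq_continuous_at)
    show "((F \<circ> real_of_ereal) \<longlongrightarrow> - (pi / 2)) (at_right (ereal (- (pi / 2))))"
      unfolding ereal_tendsto_simps F_def using filterlim_compose[OF tendsto_arctan_at_bot fb] by simp
    show "((F \<circ> real_of_ereal) \<longlongrightarrow> pi / 2) (at_left (ereal (pi / 2)))"
      unfolding ereal_tendsto_simps F_def using filterlim_compose[OF tendsto_arctan_at_top ft] by simp
  qed (use D in auto)
  then have "(LBINT t:{- (pi / 2)..pi / 2}. D / (norm (z t))\<^sup>2) = pi"
    by (simp add: interval_integral_Icc)
  then have "integral {- (pi / 2)..pi / 2} (\<lambda>t. D / (norm (z t))\<^sup>2) = pi"
    by (subst (asm) set_borel_integral_eq_integral(2))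
      (intro borel_integrable_atLeastAtMost' cont, simp)
  then show "integral {- (pi / 2)..pi / 2} (\<lambda>t. angular_speed (z t) (w t)) \<le> pi"
    unfolding \<omega> by simp
qed

text \<open>Stated for a Euclidean gradient field \<open>G\<close> instead of through
  \<open>sphere_grad\<close>: the moment inequality then applies to any function differentiable at
  the points of the sphere, in particular to the softmax approximations, without exhibiting an open
  domain for them.\<close>

definition tangent_gradient :: "('a::euclidean_space \<Rightarrow> 'a) \<Rightarrow> 'a \<Rightarrow> 'a" where
  "tangent_gradient G \<theta> = G \<theta> - (G \<theta> \<bullet> \<theta>) *\<^sub>R \<theta>"

text \<open>On the left the quotient rule for \<open>a /\<^sub>R n\<close> removes the radial part
  of the velocity; on the right the radial part is removed from the gradient. The two agree because
  the projection is self-adjoint.\<close>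

lemma tangential_chain_rule:
  fixes a b g :: "'a::euclidean_space" and n s :: real
  shows "(inverse n *\<^sub>R (s *\<^sub>R b) + (- (inverse n * ((s *\<^sub>R b) \<bullet> (a /\<^sub>R n)) * inverse n)) *\<^sub>R a) \<bullet> g
    = s *\<^sub>R ((g - (g \<bullet> (a /\<^sub>R n)) *\<^sub>R (a /\<^sub>R n)) \<bullet> b / n)"
proof -
  have "(inverse n *\<^sub>R (s *\<^sub>R b) + (- (inverse n * ((s *\<^sub>R b) \<bullet> (a /\<^sub>R n)) * inverse n)) *\<^sub>R a) \<bullet> g
      = inverse n * s * (b \<bullet> g) - inverse n * s * inverse n * (b \<bullet> a) * inverse n * (a \<bullet> g)"
    by (simp only: inner_add_left inner_scaleR_left inner_scaleR_right) (simp add: algebra_simps)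
  also have "\<dots> = s * ((b \<bullet> g - inverse n * (a \<bullet> g) * (inverse n * (b \<bullet> a))) / n)"
    unfolding divide_inverse by (simp only: algebra_simps)
  also have "\<dots> = s *\<^sub>R ((g - (g \<bullet> (a /\<^sub>R n)) *\<^sub>R (a /\<^sub>R n)) \<bullet> b / n)"
    by (simp only: inner_diff_left inner_scaleR_left inner_scaleR_right real_scaleR_def
        inner_commute[of g a] inner_commute[of a b] inner_commute[of g b])
  finally show ?thesis .
qed

lemma has_derivative_along_rotation:
  fixes F :: "'a::euclidean_space \<Rightarrow> real" and x y :: 'a
  defines "z \<equiv> \<lambda>t. cos t *\<^sub>R x + sin t *\<^sub>R y" and "w \<equiv> \<lambda>t. cos t *\<^sub>R y - sin t *\<^sub>R x"
  assumes z0: "z t \<noteq> 0" and F: "GDERIV F (sgn (z t)) :> G (sgn (z t))"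
  shows "((\<lambda>t. F (sgn (z t))) has_vector_derivative tangent_gradient G (sgn (z t)) \<bullet> w t / norm (z t)) (at t)"
proof -
  have dz: "(z has_derivative (\<lambda>s. s *\<^sub>R w t)) (at t)"
    unfolding z_def w_def by (auto intro!: derivative_eq_intros simp: algebra_simps)
  have dn: "((\<lambda>t. norm (z t)) has_derivative (\<lambda>s. (s *\<^sub>R w t) \<bullet> sgn (z t))) (at t)"
    using has_derivative_compose[OF dz GDERIV_norm[OF z0, unfolded gderiv_def]] .
  have "((\<lambda>t. inverse (norm (z t)) *\<^sub>R z t) has_derivative
      (\<lambda>s. inverse (norm (z t)) *\<^sub>R (s *\<^sub>R w t) +
        (- (inverse (norm (z t)) * ((s *\<^sub>R w t) \<bullet> sgn (z t)) * inverse (norm (z t)))) *\<^sub>R z t)) (at t)"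
    by (rule has_derivative_scaleR[OF Deriv.has_derivative_inverse[OF _ dn] dz]) (use z0 in simp)
  then have "((\<lambda>t. sgn (z t)) has_derivative
      (\<lambda>s. inverse (norm (z t)) *\<^sub>R (s *\<^sub>R w t) +
        (- (inverse (norm (z t)) * ((s *\<^sub>R w t) \<bullet> sgn (z t)) * inverse (norm (z t)))) *\<^sub>R z t)) (at t)"
    by (simp add: sgn_div_norm)
  from has_derivative_compose[OF this F[unfolded gderiv_def]]
  have "((\<lambda>t. F (sgn (z t))) has_derivative (\<lambda>s. (inverse (norm (z t)) *\<^sub>R (s *\<^sub>R w t) +
      (- (inverse (norm (z t)) * ((s *\<^sub>R w t) \<bullet> sgn (z t)) * inverse (norm (z t)))) *\<^sub>R z t)
      \<bullet> G (sgn (z t)))) (at t)" .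
  then show ?thesis
    unfolding has_vector_derivative_def
    by (rule has_derivative_eq_rhs)
      (intro ext, unfold tangent_gradient_def sgn_div_norm, rule tangential_chain_rule)
qed

text \<open>
  Averaging over both end points \<open>y\<close> and \<open>- y\<close> is what makes the total angle deterministic.
\<close>

lemma path_difference_le:
  fixes F :: "'a::euclidean_space \<Rightarrow> real" and x y :: 'a
  defines "z \<equiv> \<lambda>t. cos t *\<^sub>R x + sin t *\<^sub>R y" and "w \<equiv> \<lambda>t. cos t *\<^sub>R y - sin t *\<^sub>R x"
  assumes F: "\<And>\<theta>. \<theta> \<in> sphere 0 1 \<Longrightarrow> GDERIV F \<theta> :> G \<theta>"
    and G: "continuous_on (sphere 0 1) G"
    and indep: "(x \<bullet> y)\<^sup>2 < (norm x)\<^sup>2 * (norm y)\<^sup>2"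
  shows "ennreal (\<bar>F (sgn x) - (F (sgn y) + F (- sgn y)) / 2\<bar> ^ Suc p)
    \<le> ennreal (pi ^ p / 2 ^ Suc p) * (\<integral>\<^sup>+t. ennreal (\<bar>tangent_gradient G (sgn (z t)) \<bullet> w t / norm (z t)\<bar> ^ Suc p
          / angular_speed (z t) (w t) ^ p) * indicator {- (pi / 2)..pi / 2} t \<partial>lborel)"
proof -
  define q where "q t = tangent_gradient G (sgn (z t)) \<bullet> w t / norm (z t)" for t
  define \<omega> where "\<omega> t = angular_speed (z t) (w t)" for t
  let ?A = "{- (pi / 2)..pi / 2}"
  have z0: "z t \<noteq> 0" for t unfolding z_def by (rule rotate_nonzero[OF indep])
  have c\<omega>: "continuous_on S \<omega>" and p\<omega>: "0 < \<omega> t" and i\<omega>: "integral ?A \<omega> \<le> pi" for S t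
    unfolding \<omega>_def[abs_def] z_def w_def by (rule integral_angular_speed[OF indep])+
  have cz: "continuous_on S z" and cw: "continuous_on S w" for S
    unfolding z_def w_def by (intro continuous_intros)+
  have cs: "continuous_on S (\<lambda>t. sgn (z t))" for S
    unfolding sgn_div_norm by (intro continuous_intros cz) (use z0 in simp)
  have cG: "continuous_on S (\<lambda>t. G (sgn (z t)))" for S
    by (rule continuous_on_compose2[OF G cs]) (use z0 in \<open>auto simp: norm_sgn\<close>)
  have cq: "continuous_on S q" for S
    unfolding q_def tangent_gradient_def using z0 by (intro continuous_intros cz cw cs cG) auto
  have der: "((\<lambda>t. F (sgn (z t))) has_vector_derivative q t) (at t within S)" for t S
    unfolding q_def z_def w_def
    by (rule has_vector_derivative_at_within[OF has_derivative_along_rotation[where G=G]])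
      (use z0[of t] F in \<open>simp_all add: norm_sgn z_def\<close>)
  have ftc: "\<bar>F (sgn (z b)) - F (sgn (z a))\<bar> \<le> integral {a..b} (\<lambda>t. \<bar>q t\<bar>)" if "a \<le> b" for a b
  proof -
    have "(q has_integral F (sgn (z b)) - F (sgn (z a))) {a..b}"
      using that der by (intro fundamental_theorem_of_calculus)
    then have "F (sgn (z b)) - F (sgn (z a)) = integral {a..b} q" by (simp add: integral_unique)
    also have "\<bar>\<dots>\<bar> \<le> integral {a..b} (\<lambda>t. \<bar>q t\<bar>)"
      using integral_norm_bound_integral[of q "{a..b}" "\<lambda>t. \<bar>q t\<bar>"]
      by (simp add: integrable_continuous_real cq continuous_on_rabs)
    finally show ?thesis .
  qed
  have z: "z 0 = x" "z (pi / 2) = y" "z (- (pi / 2)) = - y" by (simp_all add: z_def)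
  \<comment> \<open>The quarter circles from \<open>- y\<close> to \<open>x\<close> and from
    \<open>x\<close> to \<open>y\<close> enter with the same factor \<open>1 / 2\<close>, so their
    bounds join to half of one integral over the whole range. This is where \<open>2 ^ Suc p\<close>
    comes from.\<close>
  have "F (sgn x) - (F (sgn y) + F (- sgn y)) / 2 =
      (F (sgn (z 0)) - F (sgn (z (- (pi / 2))))) / 2 - (F (sgn (z (pi / 2))) - F (sgn (z 0))) / 2"
    by (simp add: z sgn_minus field_simps)
  then have "\<bar>F (sgn x) - (F (sgn y) + F (- sgn y)) / 2\<bar> \<le>
      integral {- (pi / 2)..0} (\<lambda>t. \<bar>q t\<bar>) / 2 + integral {0..pi / 2} (\<lambda>t. \<bar>q t\<bar>) / 2"
    using ftc[of "- (pi / 2)" 0] ftc[of 0 "pi / 2"] by (simp only: abs_le_iff) (simp add: field_simps)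
  also have "\<dots> = integral ?A (\<lambda>t. \<bar>q t\<bar>) / 2"
  proof -
    have "integral {- (pi / 2)..0} (\<lambda>t. \<bar>q t\<bar>) + integral {0..pi / 2} (\<lambda>t. \<bar>q t\<bar>) = integral ?A (\<lambda>t. \<bar>q t\<bar>)"
      by (intro Henstock_Kurzweil_Integration.integral_combine integrable_continuous_real continuous_on_rabs cq) auto
    then show ?thesis by simp
  qed
  finally have "\<bar>F (sgn x) - (F (sgn y) + F (- sgn y)) / 2\<bar> ^ Suc p \<le> (integral ?A (\<lambda>t. \<bar>q t\<bar>) / 2) ^ Suc p"
    by (intro power_mono) auto
  also have "\<dots> = (integral ?A (\<lambda>t. \<bar>q t\<bar>)) ^ Suc p / 2 ^ Suc p"
    by (simp add: power_divide)
  also have "\<dots> \<le> pi ^ p * integral ?A (\<lambda>t. \<bar>q t\<bar> ^ Suc p / \<omega> t ^ p) / 2 ^ Suc p"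
    by (intro divide_right_mono power_integral_le_weighted cq c\<omega> p\<omega> i\<omega>) auto
  finally have "\<bar>F (sgn x) - (F (sgn y) + F (- sgn y)) / 2\<bar> ^ Suc p
      \<le> pi ^ p / 2 ^ Suc p * integral ?A (\<lambda>t. \<bar>q t\<bar> ^ Suc p / \<omega> t ^ p)" by simp
  then have "ennreal (\<bar>F (sgn x) - (F (sgn y) + F (- sgn y)) / 2\<bar> ^ Suc p)
      \<le> ennreal (pi ^ p / 2 ^ Suc p) * ennreal (integral ?A (\<lambda>t. \<bar>q t\<bar> ^ Suc p / \<omega> t ^ p))"
    by (subst ennreal_mult'[symmetric]) (simp_all only: ennreal_leI, simp)
  moreover have "ennreal (integral ?A (\<lambda>t. \<bar>q t\<bar> ^ Suc p / \<omega> t ^ p))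
     = (\<integral>\<^sup>+t. ennreal (\<bar>q t\<bar> ^ Suc p / \<omega> t ^ p) * indicator ?A t \<partial>lborel)"
  proof (rule nn_integral_has_integral_lebesgue'[symmetric])
    show "0 \<le> \<bar>q t\<bar> ^ Suc p / \<omega> t ^ p" for t
      using p\<omega>[of t] by simp
    have "\<omega> t ^ p \<noteq> 0" for t
      using p\<omega>[of t] by simp
    then show "((\<lambda>t. \<bar>q t\<bar> ^ Suc p / \<omega> t ^ p) has_integral integral ?A (\<lambda>t. \<bar>q t\<bar> ^ Suc p / \<omega> t ^ p)) ?A"
      by (intro integrable_integral integrable_continuous_real continuous_intros cq c\<omega>) auto
  qed
  ultimately show ?thesis
    unfolding q_def[symmetric] \<omega>_def[symmetric]
    by (simp only:)
qed

section \<open>Gaussian expectations\<close>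

lemma distr_gauss_orthogonal:
  fixes f :: "'a::euclidean_space \<Rightarrow> 'a"
  assumes f: "orthogonal_transformation f"
  shows "distr gauss borel f = gauss"
proof (rule measure_eqI)
  note [measurable] = orthogonal_transformation_measurable[OF f]
  fix A assume "A \<in> sets (distr gauss borel f)"
  then have [measurable]: "A \<in> sets borel" by simp
  have "(\<integral>\<^sup>+x. indicator A x \<partial>distr gauss borel f) = (\<integral>\<^sup>+x. indicator A (f x) \<partial>gauss)"
    by (rule nn_integral_distr) measurable
  also have "\<dots> = (\<integral>\<^sup>+x. indicator A x \<partial>gauss)"
    by (rule nn_integral_gauss_orthogonal[OF f]) measurable
  finally show "emeasure (distr gauss borel f) A = emeasure gauss A"
    by simp
qed simp

text \<open>Equality in the Cauchy-Schwarz inequality puts \<open>y\<close> on the line through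
  \<open>x\<close>, a null set in dimension at least 2. Off that line the path never meets the
  origin.\<close>

lemma AE_gauss_independent:
  fixes x :: "'a::euclidean_space"
  assumes "2 \<le> DIM('a)" "x \<noteq> 0"
  shows "AE y in gauss. (x \<bullet> y)\<^sup>2 < (norm x)\<^sup>2 * (norm y)\<^sup>2"
proof -
  have "dim (span {x}) < DIM('a)"
    using assms by (simp add: dim_span dim_singleton)
  then have "negligible (span {x})" by (rule negligible_lowdim)
  then have "span {x} \<in> null_sets lborel"
    by (simp add: negligible_iff_null_sets null_sets_completion_iff closed_subspace borel_closed)
  then have "AE y in lborel. y \<notin> span {x}" by (rule AE_not_in)
  then have "AE y in lborel. (x \<bullet> y)\<^sup>2 < (norm x)\<^sup>2 * (norm y)\<^sup>2"
  proof eventually_elim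
    fix y assume y: "y \<notin> span {x}"
    have "\<bar>x \<bullet> y\<bar> \<noteq> norm x * norm y"
    proof
      assume "\<bar>x \<bullet> y\<bar> = norm x * norm y"
      then have "norm x *\<^sub>R y = norm y *\<^sub>R x \<or> norm x *\<^sub>R y = - norm y *\<^sub>R x"
        by (simp add: norm_cauchy_schwarz_abs_eq)
      then have "norm x *\<^sub>R y \<in> span {x}"
        by (metis span_base singletonI span_scale)
      then have "inverse (norm x) *\<^sub>R (norm x *\<^sub>R y) \<in> span {x}"
        by (rule span_scale)
      then show False using assms(2) y by simp
    qed
    then have "\<bar>x \<bullet> y\<bar> < norm x * norm y"
      using Cauchy_Schwarz_ineq2[of x y] by simp
    then have "\<bar>x \<bullet> y\<bar>\<^sup>2 < (norm x * norm y)\<^sup>2"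
      by (intro power_strict_mono) auto
    then show "(x \<bullet> y)\<^sup>2 < (norm x)\<^sup>2 * (norm y)\<^sup>2"
      by (simp add: power_mult_distrib)
  qed
  then show ?thesis unfolding gauss_def by (subst AE_density) auto
qed

lemma AE_gauss_nonzero: "AE x in gauss. x \<noteq> (0 :: 'a::euclidean_space)"
  unfolding gauss_def using AE_lborel_singleton[of "0::'a"] by (subst AE_density) auto

text \<open>With \<open>t\<close> moved outermost, the inner expectation is constant in
  \<open>t\<close> by rotation invariance; \<open>pi\<close> is the length of the parameter
  range.\<close>

lemma nn_integral_gauss_path:
  fixes K :: "'a::euclidean_space \<times> 'a \<Rightarrow> ennreal"
  assumes K: "K \<in> borel_measurable borel"
  shows "(\<integral>\<^sup>+x. (\<integral>\<^sup>+y. (\<integral>\<^sup>+t. K (cos t *\<^sub>R x + sin t *\<^sub>R y, cos t *\<^sub>R y - sin t *\<^sub>R x)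
        * indicator {- (pi / 2)..pi / 2} t \<partial>lborel) \<partial>gauss) \<partial>gauss)
    = ennreal pi * (\<integral>\<^sup>+x. (\<integral>\<^sup>+y. K (x, y) \<partial>gauss) \<partial>gauss)"
proof -
  let ?A = "{- (pi / 2)..pi / 2}"
  let ?K = "\<lambda>x y t. K (cos t *\<^sub>R x + sin t *\<^sub>R y, cos t *\<^sub>R y - sin t *\<^sub>R x) * indicator ?A t"
  note [measurable] = measurable_compose[OF borel_measurable_Pair K]
  interpret P: pair_sigma_finite lborel "gauss :: 'a measure" by standard
  have "(\<integral>\<^sup>+x. (\<integral>\<^sup>+y. (\<integral>\<^sup>+t. ?K x y t \<partial>lborel) \<partial>gauss) \<partial>gauss) = (\<integral>\<^sup>+x. (\<integral>\<^sup>+t. (\<integral>\<^sup>+y. ?K x y t \<partial>gauss) \<partial>lborel) \<partial>gauss)"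
    by (rule nn_integral_cong, rule P.Fubini') measurable
  also have "\<dots> = (\<integral>\<^sup>+t. (\<integral>\<^sup>+x. (\<integral>\<^sup>+y. ?K x y t \<partial>gauss) \<partial>gauss) \<partial>lborel)"
    by (rule P.Fubini') measurable
  also have "\<dots> = (\<integral>\<^sup>+t. (\<integral>\<^sup>+x. (\<integral>\<^sup>+y. K (x, y) \<partial>gauss) \<partial>gauss) * indicator ?A t \<partial>lborel)"
  proof (rule nn_integral_cong)
    fix t
    have "(\<integral>\<^sup>+x. (\<integral>\<^sup>+y. ?K x y t \<partial>gauss) \<partial>gauss) =
        (\<integral>\<^sup>+x. (\<integral>\<^sup>+y. K (cos t *\<^sub>R x + sin t *\<^sub>R y, cos t *\<^sub>R y - sin t *\<^sub>R x) \<partial>gauss) \<partial>gauss) * indicator ?A t"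
      by (subst nn_integral_multc, measurable)+
    then show "(\<integral>\<^sup>+x. (\<integral>\<^sup>+y. ?K x y t \<partial>gauss) \<partial>gauss) = (\<integral>\<^sup>+x. (\<integral>\<^sup>+y. K (x, y) \<partial>gauss) \<partial>gauss) * indicator ?A t"
      by (simp only: nn_integral_gauss_rotate[OF K])
  qed
  also have "\<dots> = ennreal pi * (\<integral>\<^sup>+x. (\<integral>\<^sup>+y. K (x, y) \<partial>gauss) \<partial>gauss)"
    by (subst nn_integral_cmult) (simp_all add: mult.commute)
  finally show ?thesis .
qed

lemma measurable_angular_speed [measurable (raw)]:
  fixes f g :: "'b \<Rightarrow> 'a::euclidean_space"
  assumes [measurable]: "f \<in> borel_measurable M" "g \<in> borel_measurable M"
  shows "(\<lambda>z. angular_speed (f z) (g z)) \<in> borel_measurable M"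
  unfolding angular_speed_def by measurable

lemma measurable_fst_borel [measurable]: "(fst :: 'a::euclidean_space \<times> 'b::euclidean_space \<Rightarrow> 'a) \<in> borel_measurable borel"
  and measurable_snd_borel [measurable]: "(snd :: 'a::euclidean_space \<times> 'b::euclidean_space \<Rightarrow> 'b) \<in> borel_measurable borel"
  by (simp_all add: borel_prod[symmetric])

lemma angular_speed_nonneg: "0 \<le> angular_speed x y"
  using Cauchy_Schwarz_ineq[of x y] by (simp add: angular_speed_def dot_square_norm)

text \<open>The path identity is read backwards: \<open>pi\<close> times the mean speed is the
  expected total angle of the half circle, and that angle is bounded by \<open>pi\<close> for almost
  every pair.\<close>

lemma expectation_angular_speed_le:
  assumes "2 \<le> DIM('a::euclidean_space)"
  shows "(\<integral>\<^sup>+x. (\<integral>\<^sup>+y. ennreal (angular_speed x (y :: 'a)) \<partial>gauss) \<partial>gauss) \<le> 1"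
proof -
  let ?K = "\<lambda>z :: 'a \<times> 'a. ennreal (angular_speed (fst z) (snd z))"
  let ?E = "\<integral>\<^sup>+x. (\<integral>\<^sup>+y. ennreal (angular_speed x (y :: 'a)) \<partial>gauss) \<partial>gauss"
  have "ennreal pi * ?E = (\<integral>\<^sup>+x. (\<integral>\<^sup>+y. (\<integral>\<^sup>+t. ?K (cos t *\<^sub>R x + sin t *\<^sub>R y, cos t *\<^sub>R y - sin t *\<^sub>R x)
        * indicator {- (pi / 2)..pi / 2} t \<partial>lborel) \<partial>gauss) \<partial>gauss)"
    using nn_integral_gauss_path[of ?K] by simp
  also have "\<dots> \<le> (\<integral>\<^sup>+x. (\<integral>\<^sup>+y. ennreal pi \<partial>(gauss :: 'a measure)) \<partial>(gauss :: 'a measure))"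
  proof (rule nn_integral_mono_AE, use AE_gauss_nonzero in eventually_elim)
    fix x :: 'a assume x: "x \<noteq> 0"
    show "(\<integral>\<^sup>+y. (\<integral>\<^sup>+t. ?K (cos t *\<^sub>R x + sin t *\<^sub>R y, cos t *\<^sub>R y - sin t *\<^sub>R x)
        * indicator {- (pi / 2)..pi / 2} t \<partial>lborel) \<partial>gauss) \<le> (\<integral>\<^sup>+y. ennreal pi \<partial>(gauss :: 'a measure))"
    proof (rule nn_integral_mono_AE, use AE_gauss_independent[OF assms x] in eventually_elim)
      fix y assume indep: "(x \<bullet> y)\<^sup>2 < (norm x)\<^sup>2 * (norm y)\<^sup>2"
      let ?w = "\<lambda>t. angular_speed (cos t *\<^sub>R x + sin t *\<^sub>R y) (cos t *\<^sub>R y - sin t *\<^sub>R x)"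
      have "(\<integral>\<^sup>+t. ennreal (?w t) * indicator {- (pi / 2)..pi / 2} t \<partial>lborel) = ennreal (integral {- (pi / 2)..pi / 2} ?w)"
        by (rule nn_integral_has_integral_lebesgue')
          (intro angular_speed_nonneg integrable_integral integrable_continuous_real integral_angular_speed(1)[OF indep])+
      also have "\<dots> \<le> ennreal pi"
        by (rule ennreal_leI, rule integral_angular_speed(3)[OF indep])
      finally show "(\<integral>\<^sup>+t. ?K (cos t *\<^sub>R x + sin t *\<^sub>R y, cos t *\<^sub>R y - sin t *\<^sub>R x)
          * indicator {- (pi / 2)..pi / 2} t \<partial>lborel) \<le> ennreal pi" by simp
    qed
  qed
  also have "\<dots> = ennreal pi * 1"
    by (simp add: prob_space.emeasure_space_1[OF prob_space_gauss, simplified])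
  finally show ?thesis
    by (subst (asm) ennreal_mult_le_mult_iff) auto
qed

text \<open>For a unit vector \<open>e\<close>, the length of the component of \<open>y\<close>
  orthogonal to \<open>e\<close>.\<close>

definition perp :: "'a::euclidean_space \<Rightarrow> 'a \<Rightarrow> real" where
  "perp e y = sqrt ((norm y)\<^sup>2 - (e \<bullet> y)\<^sup>2)"

lemma measurable_perp [measurable]: "perp e \<in> borel_measurable borel"
  unfolding perp_def[abs_def] by measurable

lemma perp_nonneg: "norm e = 1 \<Longrightarrow> 0 \<le> perp e y"
  and perp_square: "norm e = 1 \<Longrightarrow> (perp e y)\<^sup>2 = (norm y)\<^sup>2 - (e \<bullet> y)\<^sup>2"
  using Cauchy_Schwarz_ineq[of e y] by (simp_all add: perp_def dot_square_norm)

text \<open>Separates the norm of \<open>x\<close> from its direction. The expectation of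
  \<open>perp e y\<close> is the same for all unit vectors \<open>e\<close>, so the mean angular
  speed becomes a product of two expectations.\<close>

lemma angular_speed_eq_perp:
  assumes "x \<noteq> 0"
  shows "angular_speed x y = perp (sgn x) y / norm x"
proof -
  have "(norm x)\<^sup>2 * (norm y)\<^sup>2 - (x \<bullet> y)\<^sup>2 = (norm x)\<^sup>2 * ((norm y)\<^sup>2 - (sgn x \<bullet> y)\<^sup>2)"
    using assms by (simp add: sgn_div_norm power2_eq_square field_simps)
  then have "angular_speed x y = norm x * perp (sgn x) y / (norm x)\<^sup>2"
    unfolding angular_speed_def perp_def by (simp only: real_sqrt_mult real_sqrt_abs abs_norm_cancel)
  then show ?thesis using assms by (simp add: power2_eq_square)
qed

lemma nn_integral_perp_eq:
  fixes e e' :: "real ^ 'n"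
  assumes "norm e = 1" "norm e' = 1"
  shows "(\<integral>\<^sup>+y. ennreal (perp e y) \<partial>gauss) = (\<integral>\<^sup>+y. ennreal (perp e' y) \<partial>gauss)"
proof -
  obtain f where f: "orthogonal_transformation f" "f e = e'"
    using orthogonal_transformation_exists_1[OF assms] by blast
  have "perp e' (f y) = perp e y" for y
    using f by (auto simp: perp_def orthogonal_transformation_norm orthogonal_transformation_def)
  then show ?thesis
    using nn_integral_gauss_orthogonal[OF f(1), of "\<lambda>y. ennreal (perp e' y)"] by simp
qed

text \<open>
  Integrability of \<open>perp e\<close> comes for free: its integral times the nonzero expectation of \<open>1 / norm x\<close> is
  the mean angular speed.
\<close>

lemma expectation_perp_norm:
  fixes e :: "real ^ 'n"
  assumes n: "2 \<le> CARD('n)" and e: "norm e = 1"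
  shows "(\<integral>\<^sup>+x. ennreal (1 / norm (x :: real ^ 'n)) \<partial>gauss) * (\<integral>\<^sup>+y. ennreal (perp e y) \<partial>gauss) \<le> 1"
    and "integrable gauss (perp e)"
proof -
  let ?R = "\<integral>\<^sup>+x. ennreal (1 / norm (x :: real ^ 'n)) \<partial>gauss"
  let ?P = "\<integral>\<^sup>+y. ennreal (perp e y) \<partial>gauss"
  have "?R * ?P = (\<integral>\<^sup>+x. ennreal (1 / norm (x :: real ^ 'n)) * ?P \<partial>gauss)"
    by (rule nn_integral_multc[symmetric]) measurable
  also have "\<dots> = (\<integral>\<^sup>+x. (\<integral>\<^sup>+y. ennreal (angular_speed x (y :: real ^ 'n)) \<partial>gauss) \<partial>gauss)"
  proof (rule nn_integral_cong_AE, use AE_gauss_nonzero in eventually_elim)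
    fix x :: "real ^ 'n" assume x: "x \<noteq> 0"
    have "(\<integral>\<^sup>+y. ennreal (angular_speed x y) \<partial>gauss) = (\<integral>\<^sup>+y. ennreal (1 / norm x) * ennreal (perp (sgn x) y) \<partial>gauss)"
      using x by (intro nn_integral_cong) (simp add: angular_speed_eq_perp ennreal_mult'[symmetric])
    also have "\<dots> = ennreal (1 / norm x) * (\<integral>\<^sup>+y. ennreal (perp (sgn x) y) \<partial>gauss)"
      by (rule nn_integral_cmult) measurable
    also have "(\<integral>\<^sup>+y. ennreal (perp (sgn x) y) \<partial>gauss) = ?P"
      using x e by (intro nn_integral_perp_eq) (simp_all add: norm_sgn)
    finally show "ennreal (1 / norm x) * ?P = (\<integral>\<^sup>+y. ennreal (angular_speed x y) \<partial>gauss)" ..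
  qed
  also have "\<dots> \<le> 1"
    using n by (intro expectation_angular_speed_le) simp
  finally show RP: "?R * ?P \<le> 1" .
  \<comment> \<open>A product bounded by 1 does not by itself exclude an infinite factor, since 0
    times infinity is 0 here.\<close>
  have "?R \<noteq> 0"
  proof
    assume "?R = 0"
    then have "AE x in gauss. ennreal (1 / norm (x :: real ^ 'n)) = 0"
      by (subst (asm) nn_integral_0_iff_AE) auto
    then have "AE x in gauss. (x :: real ^ 'n) = 0"
      by eventually_elim (simp add: ennreal_eq_0_iff)
    with AE_gauss_nonzero have "AE x in (gauss :: (real ^ 'n) measure). False"
      by eventually_elim simp
    then show False
      using prob_space.AE_False[OF prob_space_gauss] by blast
  qed
  with RP have "?P \<noteq> \<infinity>"
    by (auto simp: ennreal_mult_top top_unique)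
  then show "integrable gauss (perp e)"
    using perp_nonneg[OF e] by (intro integrableI_nonneg) (auto simp: less_top)
qed

text \<open>\<open>C\<close> completes \<open>e\<close> and \<open>b\<close> to an orthonormal
  basis, and the last claim is Parseval's identity. It splits \<open>(perp e y)\<^sup>2\<close> into
  squares of coordinates that rotations fixing \<open>e\<close> can exchange. In dimension 2 the set
  \<open>C\<close> is empty.\<close>

lemma orthonormal_complement:
  fixes e b :: "'a::euclidean_space"
  assumes e: "norm e = 1" and b: "norm b = 1" and eb: "e \<bullet> b = 0"
  obtains C where "finite C" "card C + 2 = DIM('a)" "\<And>c. c \<in> C \<Longrightarrow> norm c = 1 \<and> e \<bullet> c = 0 \<and> b \<bullet> c = 0"
    "\<And>y. (norm y)\<^sup>2 - (e \<bullet> y)\<^sup>2 = (b \<bullet> y)\<^sup>2 + (\<Sum>c\<in>C. (c \<bullet> y)\<^sup>2)"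
proof -
  define S where "S = {y \<in> UNIV. \<forall>x \<in> span {e, b}. orthogonal x y}"
  have ee: "e \<bullet> e = 1" and bb: "b \<bullet> b = 1" using e b by (simp_all add: dot_square_norm)
  have S: "y \<in> S \<longleftrightarrow> e \<bullet> y = 0 \<and> b \<bullet> y = 0" for y
  proof
    show "e \<bullet> y = 0 \<and> b \<bullet> y = 0" if "y \<in> S"
      using that span_base[of _ "{e, b}"] by (auto simp: S_def orthogonal_def)
    assume "e \<bullet> y = 0 \<and> b \<bullet> y = 0"
    then have "orthogonal y x" if "x \<in> span {e, b}" for x
      by (intro orthogonal_to_span[OF that]) (auto simp: orthogonal_def inner_commute)
    then show "y \<in> S" by (simp add: S_def orthogonal_commute)
  qed
  have "e \<noteq> b" using ee eb by auto
  have "independent {e, b}"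
    by (rule pairwise_orthogonal_independent)
      (use eb e b in \<open>auto simp: pairwise_def orthogonal_def inner_commute\<close>)
  then have "dim (span {e, b}) = 2"
    using \<open>e \<noteq> b\<close> by (simp add: dim_eq_card_independent)
  moreover have "dim S + dim (span {e, b}) = dim (UNIV :: 'a set)"
    unfolding S_def by (rule dim_subspace_orthogonal_to_vectors) auto
  ultimately have dS: "dim S + 2 = DIM('a)" by simp
  have "subspace S" by (auto simp: subspace_def S inner_simps)
  then obtain C where C: "C \<subseteq> S" "pairwise orthogonal C" "\<And>x. x \<in> C \<Longrightarrow> norm x = 1"
    "independent C" "card C = dim S" "span C = S"
    by (rule orthonormal_basis_subspace) blast
  have fin: "finite C" using C(4) by (rule independent_imp_finite)
  show ?thesis
  proof
    show "finite C" "card C + 2 = DIM('a)" using fin C dS by simp_all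
    show "norm c = 1 \<and> e \<bullet> c = 0 \<and> b \<bullet> c = 0" if "c \<in> C" for c
      using that C S by blast
    show "(norm y)\<^sup>2 - (e \<bullet> y)\<^sup>2 = (b \<bullet> y)\<^sup>2 + (\<Sum>c\<in>C. (c \<bullet> y)\<^sup>2)" for y
    proof -
      define z where "z = y - (e \<bullet> y) *\<^sub>R e - (b \<bullet> y) *\<^sub>R b"
      have "z \<in> S"
        unfolding S z_def using ee bb eb by (simp add: inner_simps inner_commute)
      then have z: "(\<Sum>c\<in>C. (z \<bullet> c) *\<^sub>R c) = z"
        using C fin by (intro orthonormal_basis_expand) auto
      have zc: "z \<bullet> c = c \<bullet> y" if "c \<in> C" for c
        using that C(1) S unfolding z_def by (auto simp: inner_simps inner_commute)
      have "z \<bullet> z = z \<bullet> (\<Sum>c\<in>C. (z \<bullet> c) *\<^sub>R c)" by (simp only: z)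
      also have "\<dots> = (\<Sum>c\<in>C. (c \<bullet> y)\<^sup>2)"
        by (simp add: inner_sum_right zc power2_eq_square)
      also have "z \<bullet> z = (norm y)\<^sup>2 - (e \<bullet> y)\<^sup>2 - (b \<bullet> y)\<^sup>2"
        unfolding z_def power2_norm_eq_inner
        using ee bb eb by (simp add: inner_simps inner_commute power2_eq_square algebra_simps)
      finally show ?thesis by simp
    qed
  qed
qed

section \<open>Moments of a direction\<close>

lemma coeff_2_power: "coeff ([:1, 0, 1:] ^ r :: real poly) 2 = real r"
proof (induction r)
  case (Suc r)
  have "coeff ([:1, 0, 1:] ^ r :: real poly) 0 = 1"
    by (simp add: coeff_0_power)
  with Suc show ?case
    by (simp add: numeral_2_eq_2 algebra_simps)
qed simp

text \<open>The domination behind all integrability claims for moments: applied with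
  \<open>\<rho> = perp e y\<close>, it bounds a normalised monomial of any degree by the one
  integrable function \<open>perp e\<close>. At \<open>\<rho> = 0\<close> the weight is 0 by the
  convention for division by 0.\<close>

lemma abs_power_mult_le:
  fixes u v \<rho> :: real
  assumes "\<bar>u\<bar> \<le> \<rho>" "\<bar>v\<bar> \<le> \<rho>"
  shows "\<bar>u ^ i * v ^ j * (\<rho> / \<rho> ^ (i + j))\<bar> \<le> \<rho>"
proof (cases "\<rho> = 0")
  case False
  then have "0 < \<rho>" using assms by linarith
  have "\<bar>u\<bar> ^ i * \<bar>v\<bar> ^ j \<le> \<rho> ^ i * \<rho> ^ j"
    using assms by (intro mult_mono power_mono) auto
  with \<open>0 < \<rho>\<close> show ?thesis
    by (simp add: abs_mult power_abs[symmetric] power_add[symmetric] field_simps)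
qed simp

lemma abs_inner_le_perp:
  assumes e: "norm e = 1" and b: "norm b = 1" and eb: "e \<bullet> b = 0"
  shows "\<bar>b \<bullet> y\<bar> \<le> perp e y"
proof -
  obtain C where C: "\<And>y. (norm y)\<^sup>2 - (e \<bullet> y)\<^sup>2 = (b \<bullet> y)\<^sup>2 + (\<Sum>c\<in>C. (c \<bullet> y)\<^sup>2)"
    by (rule orthonormal_complement[OF assms]) blast
  have "(b \<bullet> y)\<^sup>2 \<le> (perp e y)\<^sup>2"
    unfolding perp_square[OF e] C by (simp add: sum_nonneg)
  then show ?thesis
    using perp_nonneg[OF e, of y] by (simp add: abs_le_square_iff[symmetric])
qed

text \<open>The rotation is built as the identity plus a correction in the plane of \<open>b\<close>
  and \<open>c\<close>, which makes it evident that coordinates along vectors orthogonal to both are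
  unchanged.\<close>

lemma plane_rotation:
  fixes b c :: "'a::euclidean_space"
  assumes b: "norm b = 1" and c: "norm c = 1" and bc: "b \<bullet> c = 0"
  obtains f where "orthogonal_transformation f"
    "\<And>y. b \<bullet> f y = cos t * (b \<bullet> y) + sin t * (c \<bullet> y)"
    "\<And>e y. e \<bullet> b = 0 \<Longrightarrow> e \<bullet> c = 0 \<Longrightarrow> e \<bullet> f y = e \<bullet> y"
proof -
  have bb: "b \<bullet> b = 1" and cc: "c \<bullet> c = 1" and cb: "c \<bullet> b = 0"
    using b c bc by (simp_all add: dot_square_norm inner_commute)
  define p q where "p y = (cos t - 1) * (b \<bullet> y) + sin t * (c \<bullet> y)"
    and "q y = (cos t - 1) * (c \<bullet> y) - sin t * (b \<bullet> y)" for y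
  define f where "f y = y + p y *\<^sub>R b + q y *\<^sub>R c" for y
  have "linear f"
    unfolding f_def p_def q_def by (rule linearI) (simp_all add: inner_simps algebra_simps)
  moreover have "norm (f y) = norm y" for y
  proof -
    have "f y \<bullet> f y = y \<bullet> y + (2 * p y * (b \<bullet> y) + 2 * q y * (c \<bullet> y) + (p y)\<^sup>2 + (q y)\<^sup>2)"
      unfolding f_def using bb cc bc cb
      by (simp add: inner_simps inner_commute[of y b] inner_commute[of y c] power2_eq_square algebra_simps)
    also have "2 * p y * (b \<bullet> y) + 2 * q y * (c \<bullet> y) + (p y)\<^sup>2 + (q y)\<^sup>2
        = ((cos t)\<^sup>2 + (sin t)\<^sup>2 - 1) * ((b \<bullet> y)\<^sup>2 + (c \<bullet> y)\<^sup>2)"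
    proof -
      have "2 * ((k - 1) * u + l * w) * u + 2 * ((k - 1) * w - l * u) * w + ((k - 1) * u + l * w)\<^sup>2
          + ((k - 1) * w - l * u)\<^sup>2 = (k\<^sup>2 + l\<^sup>2 - 1) * (u\<^sup>2 + w\<^sup>2)" for k l u w :: real
        by (simp add: power2_eq_square algebra_simps)
      then show ?thesis by (simp only: p_def q_def)
    qed
    finally have "f y \<bullet> f y = y \<bullet> y"
      by simp
    then show ?thesis by (simp add: norm_eq_sqrt_inner)
  qed
  ultimately have "orthogonal_transformation f"
    by (simp add: orthogonal_transformation)
  then show ?thesis
  proof (rule that)
    show "b \<bullet> f y = cos t * (b \<bullet> y) + sin t * (c \<bullet> y)" for y
      using bb bc by (simp add: f_def p_def inner_simps algebra_simps)
    show "e \<bullet> f y = e \<bullet> y" if "e \<bullet> b = 0" "e \<bullet> c = 0" for e y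
      using that by (simp add: f_def inner_simps)
  qed
qed

text \<open>
  Rotation invariance in the plane of \<open>b\<close> and \<open>c\<close> makes the expectation of \<open>(b \<bullet> y + s * (c \<bullet> y)) ^ (2 * Suc r)\<close>
  against the weight equal to \<open>(1 + s\<^sup>2) ^ Suc r\<close> times its value at \<open>s = 0\<close>; the claim compares the
  coefficients of \<open>s\<^sup>2\<close>.
\<close>

lemma moment_rotation:
  fixes e b c :: "'a::euclidean_space"
  assumes int: "integrable gauss (perp e)"
    and e: "norm e = 1" and b: "norm b = 1" and c: "norm c = 1"
    and eb: "e \<bullet> b = 0" and ec: "e \<bullet> c = 0" and bc: "b \<bullet> c = 0"
  shows "(2 * real r + 1) * (\<integral>y. (b \<bullet> y) ^ (2 * r) * (c \<bullet> y)\<^sup>2 * (perp e y / perp e y ^ (2 * Suc r)) \<partial>gauss)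
    = (\<integral>y. (b \<bullet> y) ^ (2 * Suc r) * (perp e y / perp e y ^ (2 * Suc r)) \<partial>gauss)"
proof -
  let ?N = "2 * Suc r"
  define \<Phi> where "\<Phi> y = perp e y / perp e y ^ ?N" for y
  have [measurable]: "\<Phi> \<in> borel_measurable borel" unfolding \<Phi>_def[abs_def] by measurable
  have intg: "integrable gauss (\<lambda>y. (b \<bullet> y) ^ i * (c \<bullet> y) ^ j * \<Phi> y)" if "i + j = ?N" for i j
  proof (rule Bochner_Integration.integrable_bound[OF int])
    show "AE y in gauss. norm ((b \<bullet> y) ^ i * (c \<bullet> y) ^ j * \<Phi> y) \<le> norm (perp e y)"
    proof (rule AE_I2)
      fix y
      have "\<bar>(b \<bullet> y) ^ i * (c \<bullet> y) ^ j * \<Phi> y\<bar> \<le> perp e y"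
        unfolding \<Phi>_def that[symmetric]
        by (intro abs_power_mult_le abs_inner_le_perp e b c eb ec)
      then show "norm ((b \<bullet> y) ^ i * (c \<bullet> y) ^ j * \<Phi> y) \<le> norm (perp e y)" by simp
    qed
  qed measurable
  define E where "E j = real (?N choose j) * (\<integral>y. (b \<bullet> y) ^ (?N - j) * (c \<bullet> y) ^ j * \<Phi> y \<partial>gauss)" for j
  have "poly (\<Sum>j\<le>?N. monom (E j) j) s = poly (smult (E 0) ([:1, 0, 1:] ^ Suc r)) s" for s
  proof -
    \<comment> \<open>The angle for which \<open>(1, s)\<close> is \<open>k\<close> times
      \<open>(cos t, sin t)\<close>; thus \<open>b \<bullet> y + s * (c \<bullet> y)\<close> is
      \<open>k\<close> times the rotated coordinate of \<open>y\<close> along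
      \<open>b\<close>.\<close>
    define t where "t = arctan s"
    define k where "k = sqrt (1 + s\<^sup>2)"
    have k: "k\<^sup>2 = 1 + s\<^sup>2" "k \<noteq> 0" by (simp_all add: k_def add_nonneg_eq_0_iff)
    have t: "k * cos t = 1" "k * sin t = s"
      using k by (simp_all add: t_def cos_arctan sin_arctan k_def[symmetric])
    obtain f where f: "orthogonal_transformation f"
      "\<And>y. b \<bullet> f y = cos t * (b \<bullet> y) + sin t * (c \<bullet> y)"
      "\<And>e y. e \<bullet> b = 0 \<Longrightarrow> e \<bullet> c = 0 \<Longrightarrow> e \<bullet> f y = e \<bullet> y"
      by (rule plane_rotation[OF b c bc, of t]) blast
    note [measurable] = orthogonal_transformation_measurable[OF f(1)]
    have \<Phi>f: "\<Phi> (f y) = \<Phi> y" for y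
      by (simp add: \<Phi>_def perp_def f(3)[OF eb ec] orthogonal_transformation_norm[OF f(1)])
    have kf: "k * (b \<bullet> f y) = b \<bullet> y + s * (c \<bullet> y)" for y
    proof -
      have "k * (b \<bullet> f y) = (k * cos t) * (b \<bullet> y) + (k * sin t) * (c \<bullet> y)"
        by (simp add: f(2) algebra_simps)
      then show ?thesis by (simp only: t mult_1)
    qed
    have "(\<Sum>j\<le>?N. E j * s ^ j) = (\<Sum>j\<le>?N. (\<integral>y. real (?N choose j) * s ^ j * ((b \<bullet> y) ^ (?N - j) * (c \<bullet> y) ^ j * \<Phi> y) \<partial>gauss))"
      by (intro sum.cong refl, subst integral_mult_right_zero) (simp add: E_def)
    also have "\<dots> = (\<integral>y. (\<Sum>j\<le>?N. real (?N choose j) * s ^ j * ((b \<bullet> y) ^ (?N - j) * (c \<bullet> y) ^ j * \<Phi> y)) \<partial>gauss)"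
      by (intro Bochner_Integration.integral_sum[symmetric] integrable_mult_right intg) simp
    also have "\<dots> = (\<integral>y. k ^ ?N * ((b \<bullet> f y) ^ ?N * \<Phi> (f y)) \<partial>gauss)"
    proof (rule Bochner_Integration.integral_cong[OF refl])
      fix y
      have "(\<Sum>j\<le>?N. real (?N choose j) * s ^ j * ((b \<bullet> y) ^ (?N - j) * (c \<bullet> y) ^ j * \<Phi> y))
          = (\<Sum>j\<le>?N. real (?N choose j) * (s * (c \<bullet> y)) ^ j * (b \<bullet> y) ^ (?N - j)) * \<Phi> y"
        unfolding sum_distrib_right by (intro sum.cong refl) (simp only: power_mult_distrib mult_ac)
      also have "\<dots> = (s * (c \<bullet> y) + b \<bullet> y) ^ ?N * \<Phi> y"
        by (simp only: binomial_ring)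
      also have "\<dots> = (k * (b \<bullet> f y)) ^ ?N * \<Phi> (f y)"
        by (simp only: kf \<Phi>f add.commute)
      finally show "(\<Sum>j\<le>?N. real (?N choose j) * s ^ j * ((b \<bullet> y) ^ (?N - j) * (c \<bullet> y) ^ j * \<Phi> y))
          = k ^ ?N * ((b \<bullet> f y) ^ ?N * \<Phi> (f y))"
        by (simp only: power_mult_distrib mult.assoc)
    qed
    also have "\<dots> = k ^ ?N * (\<integral>y. (b \<bullet> f y) ^ ?N * \<Phi> (f y) \<partial>gauss)"
      by simp
    also have "(\<integral>y. (b \<bullet> f y) ^ ?N * \<Phi> (f y) \<partial>gauss) = (\<integral>y. (b \<bullet> y) ^ ?N * \<Phi> y \<partial>distr gauss borel f)"
      by (rule integral_distr[symmetric]) measurable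
    also have "\<dots> = E 0" by (simp add: distr_gauss_orthogonal[OF f(1)] E_def)
    also have "k ^ ?N = (1 + s\<^sup>2) ^ Suc r" by (simp only: power_mult k(1))
    finally have "(\<Sum>j\<le>?N. E j * s ^ j) = (1 + s\<^sup>2) ^ Suc r * E 0" .
    moreover have "poly [:1, 0, 1:] s = 1 + s\<^sup>2"
      by (simp add: power2_eq_square)
    ultimately show ?thesis
      by (simp only: poly_sum poly_monom poly_smult poly_power mult.commute)
  qed
  then have "(\<Sum>j\<le>?N. monom (E j) j) = smult (E 0) ([:1, 0, 1:] ^ Suc r)"
    by (simp add: poly_eq_poly_eq_iff[symmetric] fun_eq_iff)
  then have "coeff (\<Sum>j\<le>?N. monom (E j) j) 2 = coeff (smult (E 0) ([:1, 0, 1:] ^ Suc r)) 2"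
    by (rule arg_cong)
  then have "E 2 = E 0 * real (Suc r)"
    unfolding coeff_smult coeff_2_power coeff_sum coeff_monom sum.delta[OF finite_atMost] by simp
  moreover have "E 2 = real (Suc r) * ((2 * real r + 1) * (\<integral>y. (b \<bullet> y) ^ (2 * r) * (c \<bullet> y)\<^sup>2 * \<Phi> y \<partial>gauss))"
  proof -
    \<comment> \<open>The factor \<open>Suc r\<close> of this binomial coefficient cancels against
      the coefficient \<open>Suc r\<close> of the square term on the other side and leaves
      \<open>2 * r + 1\<close>.\<close>
    have "?N choose 2 = Suc r * (2 * r + 1)"
      by (simp add: choose_two)
    then have "real (?N choose 2) = real (Suc r) * (2 * real r + 1)"
      by (metis of_nat_mult of_nat_add of_nat_1 of_nat_numeral)
    then show ?thesis by (simp add: E_def)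
  qed
  ultimately have "real (Suc r) * ((2 * real r + 1) * (\<integral>y. (b \<bullet> y) ^ (2 * r) * (c \<bullet> y)\<^sup>2 * \<Phi> y \<partial>gauss))
      = real (Suc r) * E 0" by (simp only: mult.commute)
  then have "(2 * real r + 1) * (\<integral>y. (b \<bullet> y) ^ (2 * r) * (c \<bullet> y)\<^sup>2 * \<Phi> y \<partial>gauss) = E 0"
    by (subst (asm) mult_left_cancel) auto
  then show ?thesis by (simp add: E_def \<Phi>_def)
qed

text \<open>Sum the rotation identity over \<open>c\<close> in \<open>C\<close>: since the
  \<open>(c \<bullet> y)\<^sup>2\<close> add up to
  \<open>(perp e y)\<^sup>2 - (b \<bullet> y)\<^sup>2\<close>, the right-hand side becomes a
  multiple of \<open>M r - M (Suc r)\<close>. This is the recursion for the even moments of a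
  coordinate of a uniform unit vector in one dimension less, obtained without integration by
  parts.\<close>

lemma moment_recursion:
  fixes e b :: "'a::euclidean_space"
  assumes int: "integrable gauss (perp e)"
    and e: "norm e = 1" and b: "norm b = 1" and eb: "e \<bullet> b = 0"
  defines "M \<equiv> \<lambda>r. \<integral>y. (b \<bullet> y) ^ (2 * r) * (perp e y / perp e y ^ (2 * r)) \<partial>gauss"
  shows "(real DIM('a) - 1 + 2 * real r) * M (Suc r) = (2 * real r + 1) * M r"
proof -
  let ?\<Phi> = "\<lambda>y. perp e y / perp e y ^ (2 * Suc r)"
  obtain C where C: "finite C" "card C + 2 = DIM('a)"
    "\<And>c. c \<in> C \<Longrightarrow> norm c = 1 \<and> e \<bullet> c = 0 \<and> b \<bullet> c = 0"
    "\<And>y. (norm y)\<^sup>2 - (e \<bullet> y)\<^sup>2 = (b \<bullet> y)\<^sup>2 + (\<Sum>c\<in>C. (c \<bullet> y)\<^sup>2)"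
    by (rule orthonormal_complement[OF e b eb]) blast
  have intb: "integrable gauss (\<lambda>y. (b \<bullet> y) ^ (2 * k) * (perp e y / perp e y ^ (2 * k)))" for k
  proof (rule Bochner_Integration.integrable_bound[OF int])
    show "AE y in gauss. norm ((b \<bullet> y) ^ (2 * k) * (perp e y / perp e y ^ (2 * k))) \<le> norm (perp e y)"
    proof (rule AE_I2)
      fix y
      show "norm ((b \<bullet> y) ^ (2 * k) * (perp e y / perp e y ^ (2 * k))) \<le> norm (perp e y)"
        using abs_power_mult_le[OF abs_inner_le_perp[OF e b eb, of y] abs_inner_le_perp[OF e b eb, of y], of "2 * k" 0]
        by simp
    qed
  qed measurable
  have intc: "integrable gauss (\<lambda>y. (b \<bullet> y) ^ (2 * r) * (c \<bullet> y)\<^sup>2 * ?\<Phi> y)" if "c \<in> C" for c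
  proof (rule Bochner_Integration.integrable_bound[OF int])
    show "AE y in gauss. norm ((b \<bullet> y) ^ (2 * r) * (c \<bullet> y)\<^sup>2 * ?\<Phi> y) \<le> norm (perp e y)"
    proof (rule AE_I2)
      fix y
      have "\<bar>c \<bullet> y\<bar> \<le> perp e y" using C(3)[OF that] by (intro abs_inner_le_perp e) auto
      from abs_power_mult_le[OF abs_inner_le_perp[OF e b eb, of y] this, of "2 * r" 2]
      show "norm ((b \<bullet> y) ^ (2 * r) * (c \<bullet> y)\<^sup>2 * ?\<Phi> y) \<le> norm (perp e y)"
        by (simp only: real_norm_def abs_of_nonneg[OF perp_nonneg[OF e]] mult_Suc_right add.commute)
    qed
  qed measurable
  have pt: "(\<Sum>c\<in>C. (b \<bullet> y) ^ (2 * r) * (c \<bullet> y)\<^sup>2 * ?\<Phi> y)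
      = (b \<bullet> y) ^ (2 * r) * (perp e y / perp e y ^ (2 * r)) - (b \<bullet> y) ^ (2 * Suc r) * ?\<Phi> y" for y
  proof -
    have sq: "(\<Sum>c\<in>C. (c \<bullet> y)\<^sup>2) = (perp e y)\<^sup>2 - (b \<bullet> y)\<^sup>2"
      using C(4)[of y] by (simp add: perp_square[OF e])
    \<comment> \<open>Valid also where \<open>perp e y = 0\<close>: both sides are then 0.\<close>
    have p: "(perp e y)\<^sup>2 * ?\<Phi> y = perp e y / perp e y ^ (2 * r)"
      by (simp add: power2_eq_square)
    have "(\<Sum>c\<in>C. (b \<bullet> y) ^ (2 * r) * (c \<bullet> y)\<^sup>2 * ?\<Phi> y) = (b \<bullet> y) ^ (2 * r) * (\<Sum>c\<in>C. (c \<bullet> y)\<^sup>2) * ?\<Phi> y"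
      by (simp only: sum_distrib_left sum_distrib_right)
    also have "\<dots> = (b \<bullet> y) ^ (2 * r) * ((perp e y)\<^sup>2 * ?\<Phi> y) - (b \<bullet> y) ^ (2 * Suc r) * ?\<Phi> y"
      unfolding sq by (simp add: power2_eq_square algebra_simps)
    finally show ?thesis unfolding p .
  qed
  have "real (card C) * M (Suc r) = (\<Sum>c\<in>C. M (Suc r))" by simp
  also have "\<dots> = (\<Sum>c\<in>C. (2 * real r + 1) * (\<integral>y. (b \<bullet> y) ^ (2 * r) * (c \<bullet> y)\<^sup>2 * ?\<Phi> y \<partial>gauss))"
    unfolding M_def by (intro sum.cong refl moment_rotation[symmetric] int e b eb) (use C(3) in auto)
  also have "\<dots> = (2 * real r + 1) * (\<integral>y. (\<Sum>c\<in>C. (b \<bullet> y) ^ (2 * r) * (c \<bullet> y)\<^sup>2 * ?\<Phi> y) \<partial>gauss)"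
    unfolding sum_distrib_left[symmetric] by (subst Bochner_Integration.integral_sum[OF intc]) auto
  also have "(\<integral>y. (\<Sum>c\<in>C. (b \<bullet> y) ^ (2 * r) * (c \<bullet> y)\<^sup>2 * ?\<Phi> y) \<partial>gauss) = M r - M (Suc r)"
    unfolding pt M_def by (rule Bochner_Integration.integral_diff[OF intb intb])
  finally have *: "real (card C) * M (Suc r) = (2 * real r + 1) * (M r - M (Suc r))" .
  have "real (card C) = real DIM('a) - 2" using C(2) by linarith
  with * show ?thesis by (simp add: algebra_simps)
qed

text \<open>Bernoulli's inequality gives \<open>2 \<le> (1 + 1 / r) ^ r\<close>, that is
  \<open>2 * r ^ r \<le> (r + 1) ^ r\<close>, and \<open>2 * r + 1 \<le> 2 * (r + 1)\<close>. It
  drives the induction that bounds the product of the odd numbers below \<open>2 * r\<close> by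
  \<open>r ^ r\<close>.\<close>

lemma odd_times_power_le: "(2 * real r + 1) * real r ^ r \<le> real (Suc r) ^ Suc r"
proof (cases "r = 0")
  case False
  have "1 + real r * (1 / real r) \<le> (1 + 1 / real r) ^ r"
    by (rule Bernoulli_inequality) (auto intro: order_trans[of _ 0])
  then have "2 * real r ^ r \<le> (1 + 1 / real r) ^ r * real r ^ r"
    using False by (intro mult_right_mono) auto
  also have "\<dots> = real (Suc r) ^ r"
    using False by (simp add: power_mult_distrib[symmetric] field_simps)
  finally have "2 * real r ^ r * real (Suc r) \<le> real (Suc r) ^ r * real (Suc r)"
    by (intro mult_right_mono) auto
  moreover have "(2 * real r + 1) * real r ^ r \<le> 2 * real r ^ r * real (Suc r)"
    by (simp add: algebra_simps)
  ultimately show ?thesis unfolding power_Suc2 by (rule order_trans[rotated])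
qed simp

text \<open>The recursion with \<open>2 * r\<close> dropped from the factor on its left: each step
  costs at most \<open>(2 * r + 1) / (n - 1)\<close>, where \<open>n\<close> is the
  dimension.\<close>

lemma moment_le:
  fixes e b :: "'a::euclidean_space"
  assumes int: "integrable gauss (perp e)" and dim: "2 \<le> DIM('a)"
    and e: "norm e = 1" and b: "norm b = 1" and eb: "e \<bullet> b = 0"
  shows "(\<integral>y. (b \<bullet> y) ^ (2 * r) * (perp e y / perp e y ^ (2 * r)) \<partial>gauss)
    \<le> (real r / (real DIM('a) - 1)) ^ r * (\<integral>y. perp e y \<partial>gauss)"
proof (induction r)
  case (Suc r)
  let ?M = "\<lambda>r. \<integral>y. (b \<bullet> y) ^ (2 * r) * (perp e y / perp e y ^ (2 * r)) \<partial>gauss"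
  let ?m = "real DIM('a) - 1" and ?P = "\<integral>y. perp e y \<partial>gauss"
  have m: "1 \<le> ?m" using dim by simp
  have M0: "0 \<le> ?M k" for k
    by (rule integral_nonneg_AE) (use perp_nonneg[OF e] in \<open>auto intro!: mult_nonneg_nonneg divide_nonneg_nonneg zero_le_even_power\<close>)
  have P0: "0 \<le> ?P" by (rule integral_nonneg_AE) (use perp_nonneg[OF e] in auto)
  have "?m * ?M (Suc r) \<le> (?m + 2 * real r) * ?M (Suc r)"
    by (intro mult_right_mono M0) simp
  also have "\<dots> = (2 * real r + 1) * ?M r"
    by (rule moment_recursion[OF int e b eb])
  also have "\<dots> \<le> (2 * real r + 1) * ((real r / ?m) ^ r * ?P)"
    by (intro mult_left_mono Suc.IH) simp
  also have "\<dots> = ((2 * real r + 1) * real r ^ r) * (?P / ?m ^ r)"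
    by (simp add: power_divide)
  also have "\<dots> \<le> real (Suc r) ^ Suc r * (?P / ?m ^ r)"
    using P0 m by (intro mult_right_mono odd_times_power_le) auto
  finally have A: "?m * ?M (Suc r) \<le> real (Suc r) ^ Suc r * (?P / ?m ^ r)" .
  have "?M (Suc r) \<le> real (Suc r) ^ Suc r * (?P / ?m ^ r) / ?m"
    by (rule mult_imp_le_div_pos[OF _ A[unfolded mult.commute[of ?m]]]) (use m in linarith)
  also have "\<dots> = (real (Suc r) / ?m) ^ Suc r * ?P"
    by (simp only: power_divide power_Suc[of ?m]) simp
  finally show ?case .
qed simp

lemma nn_integral_moment_le:
  fixes e v :: "'a::euclidean_space"
  assumes int: "integrable gauss (perp e)" and dim: "2 \<le> DIM('a)"
    and e: "norm e = 1" and ev: "e \<bullet> v = 0"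
  shows "(\<integral>\<^sup>+y. ennreal ((v \<bullet> y) ^ (2 * r) * (perp e y / perp e y ^ (2 * r))) \<partial>gauss)
    \<le> ennreal (norm v ^ (2 * r)) * (ennreal ((real r / (real DIM('a) - 1)) ^ r) * (\<integral>\<^sup>+y. ennreal (perp e y) \<partial>gauss))"
proof -
  have main: "(\<integral>\<^sup>+y. ennreal ((b \<bullet> y) ^ (2 * r) * (perp e y / perp e y ^ (2 * r))) \<partial>gauss)
    \<le> ennreal ((real r / (real DIM('a) - 1)) ^ r) * (\<integral>\<^sup>+y. ennreal (perp e y) \<partial>gauss)"
    if b: "norm b = 1" "e \<bullet> b = 0" for b
  proof -
    have i: "integrable gauss (\<lambda>y. (b \<bullet> y) ^ (2 * r) * (perp e y / perp e y ^ (2 * r)))"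
    proof (rule Bochner_Integration.integrable_bound[OF int])
      show "AE y in gauss. norm ((b \<bullet> y) ^ (2 * r) * (perp e y / perp e y ^ (2 * r))) \<le> norm (perp e y)"
      proof (rule AE_I2)
        fix y
        show "norm ((b \<bullet> y) ^ (2 * r) * (perp e y / perp e y ^ (2 * r))) \<le> norm (perp e y)"
          using abs_power_mult_le[OF abs_inner_le_perp[OF e b, of y] abs_inner_le_perp[OF e b, of y], of "2 * r" 0]
          by simp
      qed
    qed measurable
    have "(\<integral>\<^sup>+y. ennreal ((b \<bullet> y) ^ (2 * r) * (perp e y / perp e y ^ (2 * r))) \<partial>gauss)
      = ennreal (\<integral>y. (b \<bullet> y) ^ (2 * r) * (perp e y / perp e y ^ (2 * r)) \<partial>gauss)"
      by (rule nn_integral_eq_integral[OF i])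
        (use perp_nonneg[OF e] in \<open>auto intro!: mult_nonneg_nonneg divide_nonneg_nonneg zero_le_even_power\<close>)
    also have "\<dots> \<le> ennreal ((real r / (real DIM('a) - 1)) ^ r * (\<integral>y. perp e y \<partial>gauss))"
      by (rule ennreal_leI, rule moment_le[OF int dim e b])
    also have "\<dots> = ennreal ((real r / (real DIM('a) - 1)) ^ r) * ennreal (\<integral>y. perp e y \<partial>gauss)"
      using dim by (intro ennreal_mult') simp
    also have "ennreal (\<integral>y. perp e y \<partial>gauss) = (\<integral>\<^sup>+y. ennreal (perp e y) \<partial>gauss)"
      by (rule nn_integral_eq_integral[OF int, symmetric]) (use perp_nonneg[OF e] in auto)
    finally show ?thesis .
  qed
  show ?thesis
  proof (cases "v = 0")
    case True
    then show ?thesis by (cases "r = 0") (auto simp: power_0_left)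
  next
    case False
    have v: "v \<bullet> y = norm v * (sgn v \<bullet> y)" for y
      using False by (simp add: sgn_div_norm)
    have "(\<integral>\<^sup>+y. ennreal ((v \<bullet> y) ^ (2 * r) * (perp e y / perp e y ^ (2 * r))) \<partial>gauss)
        = (\<integral>\<^sup>+y. ennreal (norm v ^ (2 * r)) * ennreal ((sgn v \<bullet> y) ^ (2 * r) * (perp e y / perp e y ^ (2 * r))) \<partial>gauss)"
      by (simp only: v power_mult_distrib mult.assoc ennreal_mult' zero_le_power norm_ge_zero)
    also have "\<dots> = ennreal (norm v ^ (2 * r)) * (\<integral>\<^sup>+y. ennreal ((sgn v \<bullet> y) ^ (2 * r) * (perp e y / perp e y ^ (2 * r))) \<partial>gauss)"
      by (rule nn_integral_cmult) measurable
    also have "\<dots> \<le> ennreal (norm v ^ (2 * r)) * (ennreal ((real r / (real DIM('a) - 1)) ^ r) * (\<integral>\<^sup>+y. ennreal (perp e y) \<partial>gauss))"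
      using False ev by (intro mult_left_mono main) (auto simp: norm_sgn sgn_div_norm)
    finally show ?thesis .
  qed
qed

section \<open>The moment inequality on the sphere\<close>

lemma integral_gauss_sgn:
  fixes u :: "real ^ 'n \<Rightarrow> real"
  assumes [measurable]: "u \<in> borel_measurable borel" and B: "\<And>x. \<bar>u x\<bar> \<le> B"
  shows "(\<integral>y. u (sgn y) \<partial>gauss) = (\<integral>\<theta>. u \<theta> \<partial>sphere_measure)"
proof -
  interpret S: prob_space "sphere_measure :: (real ^ 'n) measure" by (rule prob_space_sphere_measure)
  have [measurable]: "u \<in> borel_measurable sphere_measure"
    by (subst measurable_cong_sets[OF sets_sphere_measure refl]) (rule measurable_restrict_space1, simp)
  have iS: "integrable sphere_measure u"
    by (rule S.integrable_const_bound[of _ B]) (use B in auto)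
  have iG: "integrable gauss (\<lambda>y. u (sgn y))"
    by (rule gauss.integrable_const_bound[of _ B]) (use B in auto)
  \<comment> \<open>Adding the bound \<open>B\<close> makes the integrand nonnegative, so that the
    transfer for nonnegative integrals applies; \<open>B\<close> cancels because both measures have
    mass 1.\<close>
  have nonneg: "0 \<le> u x + B" for x using B[of x] by linarith
  have "ennreal (\<integral>y. u (sgn y) + B \<partial>gauss) = (\<integral>\<^sup>+y. ennreal (u (sgn y) + B) \<partial>gauss)"
    by (rule nn_integral_eq_integral[symmetric]) (use iG nonneg in auto)
  also have "\<dots> = (\<integral>\<^sup>+\<theta>. ennreal (u \<theta> + B) \<partial>sphere_measure)"
  proof (rule nn_integral_gauss_sgn)
    have "(\<integral>\<^sup>+\<theta>. ennreal (u \<theta> + B) \<partial>sphere_measure) = ennreal (\<integral>\<theta>. u \<theta> + B \<partial>sphere_measure)"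
      by (rule nn_integral_eq_integral) (use iS nonneg in auto)
    then show "(\<integral>\<^sup>+\<theta>. ennreal (u \<theta> + B) \<partial>sphere_measure) \<noteq> \<infinity>" by simp
  qed measurable
  also have "\<dots> = ennreal (\<integral>\<theta>. u \<theta> + B \<partial>sphere_measure)"
    by (rule nn_integral_eq_integral) (use iS nonneg in auto)
  finally have "(\<integral>y. u (sgn y) + B \<partial>gauss) = (\<integral>\<theta>. u \<theta> + B \<partial>sphere_measure)"
    by (subst (asm) ennreal_inj) (auto intro!: integral_nonneg_AE simp: nonneg)
  then show ?thesis
    using iS iG by (simp add: gauss.prob_space[simplified] S.prob_space[simplified])
qed

lemma orthogonal_transformation_uminus: "orthogonal_transformation (uminus :: 'a::euclidean_space \<Rightarrow> 'a)"
  by (simp add: orthogonal_transformation linear_uminus)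

text \<open>The expectation over the velocity \<open>y\<close> with the position \<open>x\<close>
  held fixed. The gradient term carries \<open>norm x\<close> to the power \<open>- 2 * r\<close>,
  and division by the speed gives back \<open>2 * r - 1\<close> of these powers, so one factor
  \<open>1 / norm x\<close> remains, which has finite expectation.\<close>

lemma nn_integral_gradient_kernel_le:
  fixes H :: "real ^ 'n \<Rightarrow> real ^ 'n" and x e :: "real ^ 'n"
  assumes n: "2 \<le> CARD('n)" and r: "0 < r" and x: "x \<noteq> 0" and e: "norm e = 1"
  shows "(\<integral>\<^sup>+y. ennreal (\<bar>tangent_gradient H (sgn x) \<bullet> y / norm x\<bar> ^ (2 * r) / angular_speed x y ^ (2 * r - 1)) \<partial>gauss)
    \<le> ennreal (1 / norm x) * ennreal (norm (tangent_gradient H (sgn x)) ^ (2 * r)) *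
      (ennreal ((real r / (real CARD('n) - 1)) ^ r) * (\<integral>\<^sup>+y. ennreal (perp e y) \<partial>gauss))"
proof -
  define v where "v = tangent_gradient H (sgn x)"
  let ?e = "sgn x"
  have e': "norm ?e = 1" using x by (simp add: norm_sgn)
  then have "?e \<bullet> ?e = 1" by (simp add: dot_square_norm)
  then have ev: "?e \<bullet> v = 0"
    by (simp add: v_def tangent_gradient_def inner_simps inner_commute)
  have "(\<integral>\<^sup>+y. ennreal (\<bar>v \<bullet> y / norm x\<bar> ^ (2 * r) / angular_speed x y ^ (2 * r - 1)) \<partial>gauss)
    = (\<integral>\<^sup>+y. ennreal (1 / norm x) * ennreal ((v \<bullet> y) ^ (2 * r) * (perp ?e y / perp ?e y ^ (2 * r))) \<partial>gauss)"
  proof (rule nn_integral_cong)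
    fix y
    \<comment> \<open>Positivity of \<open>r\<close> makes \<open>2 * r - 1\<close> a genuine
      predecessor. Where \<open>perp ?e y = 0\<close>, both sides vanish by the convention for
      division by 0.\<close>
    obtain k where k: "2 * r = Suc (Suc k)" using r by (cases r) auto
    have p: "\<bar>v \<bullet> y / norm x\<bar> ^ (2 * r) = (v \<bullet> y) ^ (2 * r) / norm x ^ (2 * r)"
      by (simp add: power_even_abs power_divide)
    have "\<bar>v \<bullet> y / norm x\<bar> ^ (2 * r) / angular_speed x y ^ (2 * r - 1)
        = 1 / norm x * ((v \<bullet> y) ^ (2 * r) * (perp ?e y / perp ?e y ^ (2 * r)))"
      using x unfolding p unfolding angular_speed_eq_perp[OF x] k power_divide
      by (cases "perp ?e y = 0") (auto simp: field_simps)
    then show "ennreal (\<bar>v \<bullet> y / norm x\<bar> ^ (2 * r) / angular_speed x y ^ (2 * r - 1))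
        = ennreal (1 / norm x) * ennreal ((v \<bullet> y) ^ (2 * r) * (perp ?e y / perp ?e y ^ (2 * r)))"
      by (simp only: ennreal_mult' zero_le_divide_1_iff norm_ge_zero)
  qed
  also have "\<dots> = ennreal (1 / norm x) * (\<integral>\<^sup>+y. ennreal ((v \<bullet> y) ^ (2 * r) * (perp ?e y / perp ?e y ^ (2 * r))) \<partial>gauss)"
    by (rule nn_integral_cmult) measurable
  also have "\<dots> \<le> ennreal (1 / norm x) * (ennreal (norm v ^ (2 * r)) *
      (ennreal ((real r / (real DIM(real ^ 'n) - 1)) ^ r) * (\<integral>\<^sup>+y. ennreal (perp ?e y) \<partial>gauss)))"
    using n by (intro mult_left_mono nn_integral_moment_le expectation_perp_norm(2) e' ev) auto
  also have "(\<integral>\<^sup>+y. ennreal (perp ?e y) \<partial>gauss) = (\<integral>\<^sup>+y. ennreal (perp e y) \<partial>gauss)"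
    by (rule nn_integral_perp_eq[OF e' e])
  finally show ?thesis by (simp add: v_def mult.assoc)
qed

text \<open>A Poincare inequality for even moments. Jensen's inequality in \<open>y\<close> bounds
  the centred moment by that of the path difference, the path estimate introduces the gradient, and
  integrating out the velocity leaves the gradient moment times \<open>?R * ?P\<close>, which is at
  most 1.\<close>

lemma sphere_moment_inequality:
  fixes F :: "real ^ 'n \<Rightarrow> real"
  assumes n: "2 \<le> CARD('n)" and r: "0 < r"
    and F: "\<And>\<theta>. \<theta> \<in> sphere 0 1 \<Longrightarrow> GDERIV F \<theta> :> G \<theta>"
    and G: "continuous_on (sphere 0 1) G"
  shows "(\<integral>\<^sup>+\<theta>. ennreal ((F \<theta> - (\<integral>\<theta>. F \<theta> \<partial>sphere_measure)) ^ (2 * r)) \<partial>sphere_measure)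
    \<le> ennreal ((pi / 2) ^ (2 * r) * (real r / (real CARD('n) - 1)) ^ r)
      * (\<integral>\<^sup>+\<theta>. ennreal (norm (tangent_gradient G \<theta>) ^ (2 * r)) \<partial>sphere_measure)"
proof -
  let ?S = "sphere (0 :: real ^ 'n) 1"
  \<comment> \<open>Only the behaviour on the sphere is controlled; cutting off by the indicator
    gives functions that are Borel measurable on the whole space, as composition with
    \<open>sgn\<close> requires.\<close>
  define u where "u \<theta> = indicator ?S \<theta> *\<^sub>R F \<theta>" for \<theta>
  define H where "H \<theta> = indicator ?S \<theta> *\<^sub>R G \<theta>" for \<theta>
  define m where "m = (\<integral>\<theta>. F \<theta> \<partial>sphere_measure)"
  define N where "N \<theta> = norm (tangent_gradient H \<theta>) ^ (2 * r)" for \<theta>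
  have uF: "u \<theta> = F \<theta>" and HG: "H \<theta> = G \<theta>" if "\<theta> \<in> ?S" for \<theta>
    using that by (simp_all add: u_def H_def)
  have cF: "continuous_on ?S F"
    using has_derivative_continuous[OF F[unfolded gderiv_def]]
    by (intro continuous_at_imp_continuous_on ballI)
  have Sb: "?S \<in> sets borel" by simp
  have [measurable]: "u \<in> borel_measurable borel"
    unfolding u_def by (rule borel_measurable_continuous_on_indicator[OF Sb cF])
  have [measurable]: "H \<in> borel_measurable borel"
    unfolding H_def by (rule borel_measurable_continuous_on_indicator[OF Sb G])
  have tH[measurable]: "tangent_gradient H \<in> borel_measurable borel"
    unfolding tangent_gradient_def[abs_def] by measurable
  have [measurable]: "N \<in> borel_measurable borel"
    unfolding N_def[abs_def] by measurable
  obtain B where B: "\<And>\<theta>. \<bar>u \<theta>\<bar> \<le> B"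
  proof -
    have "bounded (F ` ?S)" by (intro compact_imp_bounded compact_continuous_image cF) simp
    then obtain B where B: "\<And>\<theta>. \<theta> \<in> ?S \<Longrightarrow> \<bar>F \<theta>\<bar> \<le> B"
      unfolding bounded_iff ball_simps real_norm_def by blast
    have "\<bar>u \<theta>\<bar> \<le> max B 0" for \<theta>
      using B[of \<theta>] by (cases "\<theta> \<in> ?S") (auto simp: u_def)
    then show ?thesis by (rule that)
  qed
  obtain C where C: "\<And>\<theta>. \<theta> \<in> ?S \<Longrightarrow> N \<theta> \<le> C"
  proof -
    have "bounded ((\<lambda>\<theta>. norm (tangent_gradient G \<theta>) ^ (2 * r)) ` ?S)"
      unfolding tangent_gradient_def
      by (intro compact_imp_bounded compact_continuous_image continuous_intros G) simp
    then obtain C where "\<And>\<theta>. \<theta> \<in> ?S \<Longrightarrow> \<bar>norm (tangent_gradient G \<theta>) ^ (2 * r)\<bar> \<le> C"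
      unfolding bounded_iff ball_simps real_norm_def by blast
    then have "N \<theta> \<le> C" if "\<theta> \<in> ?S" for \<theta>
      using that HG[OF that] by (force simp: N_def tangent_gradient_def)
    then show ?thesis by (rule that)
  qed
  interpret S: prob_space "sphere_measure :: (real ^ 'n) measure" by (rule prob_space_sphere_measure)
  have finN: "(\<integral>\<^sup>+\<theta>. ennreal (N \<theta>) \<partial>sphere_measure) \<noteq> \<infinity>"
  proof -
    have "(\<integral>\<^sup>+\<theta>. ennreal (N \<theta>) \<partial>sphere_measure) \<le> (\<integral>\<^sup>+\<theta>. ennreal C \<partial>(sphere_measure :: (real ^ 'n) measure))"
      using C by (intro nn_integral_mono ennreal_leI) simp
    also have "\<dots> = ennreal C" using S.emeasure_space_1 by simp
    finally show ?thesis by (auto simp: top_unique)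
  qed
  define a where "a x y = u (sgn x) - (u (sgn y) + u (- sgn y)) / 2" for x y :: "real ^ 'n"
  have [measurable]: "(\<lambda>z. a (f z) (g z)) \<in> borel_measurable M"
    if [measurable]: "f \<in> borel_measurable M" "g \<in> borel_measurable M" for f g and M :: "'z measure"
    unfolding a_def by measurable
  let ?L = "\<integral>\<^sup>+x. (\<integral>\<^sup>+y. ennreal (a x y ^ (2 * r)) \<partial>gauss) \<partial>gauss"
  let ?c = "ennreal (pi ^ (2 * r - 1) / 2 ^ (2 * r))"
  define K where "K z = ennreal (\<bar>tangent_gradient H (sgn (fst z)) \<bullet> snd z / norm (fst z)\<bar> ^ (2 * r)
      / angular_speed (fst z) (snd z) ^ (2 * r - 1))" for z :: "(real ^ 'n) \<times> (real ^ 'n)"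
  have K[measurable]: "K \<in> borel_measurable borel" unfolding K_def[abs_def] by measurable
  have dim: "2 \<le> DIM(real ^ 'n)" using n by simp

  have lower: "(\<integral>\<^sup>+\<theta>. ennreal ((F \<theta> - m) ^ (2 * r)) \<partial>sphere_measure) \<le> ?L"
  proof -
    have m: "m = (\<integral>\<theta>. u \<theta> \<partial>sphere_measure)"
      unfolding m_def by (rule Bochner_Integration.integral_cong) (simp_all add: uF)
    have i1: "integrable gauss (\<lambda>y. u (sgn y))" and i2: "integrable gauss (\<lambda>y. u (- sgn y))"
      by (rule gauss.integrable_const_bound[of _ B]; use B in auto)+
    have e1: "(\<integral>y. u (sgn y) \<partial>gauss) = m"
      unfolding m by (rule integral_gauss_sgn[OF _ B]) measurable
    have e2: "(\<integral>y. u (- sgn y) \<partial>gauss) = m"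
    proof -
      have "(\<integral>y. u (- sgn y) \<partial>gauss) = (\<integral>y. u (sgn (- y)) \<partial>gauss)" by (simp add: sgn_minus)
      also have "\<dots> = (\<integral>y. u (sgn y) \<partial>distr gauss borel uminus)"
        by (rule integral_distr[symmetric]) measurable
      finally show ?thesis
        by (simp add: distr_gauss_orthogonal[OF orthogonal_transformation_uminus] e1)
    qed
    \<comment> \<open>\<open>y\<close> and \<open>- y\<close> have the same law, so averaging over
      both end points still has expectation \<open>m\<close>; then the even power is convex.\<close>
    have jensen: "ennreal ((u (sgn x) - m) ^ (2 * r)) \<le> (\<integral>\<^sup>+y. ennreal (a x y ^ (2 * r)) \<partial>gauss)" for x
    proof -
      have ia: "integrable gauss (a x)" unfolding a_def[abs_def] using i1 i2 by simp
      have bound: "\<bar>a x y\<bar> \<le> 2 * B" for y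
        using B[of "sgn x"] B[of "sgn y"] B[of "- sgn y"]
        unfolding a_def abs_le_iff by (simp add: field_simps)
      have "norm (a x y ^ (2 * r)) \<le> (2 * B) ^ (2 * r)" for y
        unfolding real_norm_def power_abs by (rule power_mono[OF bound abs_ge_zero])
      then have ip: "integrable gauss (\<lambda>y. a x y ^ (2 * r))"
        by (intro gauss.integrable_const_bound[of _ "(2 * B) ^ (2 * r)"] AE_I2) measurable
      have ea: "(\<integral>y. a x y \<partial>gauss) = u (sgn x) - m"
        unfolding a_def using i1 i2 by (simp add: e1 e2 gauss.prob_space[simplified])
      have "(u (sgn x) - m) ^ (2 * r) \<le> (\<integral>y. a x y ^ (2 * r) \<partial>gauss)"
        unfolding ea[symmetric]
        by (rule gauss.jensens_inequality[where I=UNIV and q="\<lambda>s. s ^ (2 * r)"])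
          (auto intro: ia ip convex_power_even)
      then show ?thesis
        by (subst nn_integral_eq_integral[OF ip]) (auto intro: ennreal_leI)
    qed
    have "(\<integral>\<^sup>+\<theta>. ennreal ((F \<theta> - m) ^ (2 * r)) \<partial>sphere_measure) = (\<integral>\<^sup>+\<theta>. ennreal ((u \<theta> - m) ^ (2 * r)) \<partial>sphere_measure)"
      by (rule nn_integral_cong) (simp add: uF)
    also have "\<dots> = (\<integral>\<^sup>+x. ennreal ((u (sgn x) - m) ^ (2 * r)) \<partial>gauss)"
    proof (rule nn_integral_gauss_sgn[symmetric])
      have "(\<integral>\<^sup>+\<theta>. ennreal ((u \<theta> - m) ^ (2 * r)) \<partial>sphere_measure)
          \<le> (\<integral>\<^sup>+\<theta>. ennreal ((B + \<bar>m\<bar>) ^ (2 * r)) \<partial>(sphere_measure :: (real ^ 'n) measure))"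
      proof (intro nn_integral_mono ennreal_leI)
        fix \<theta>
        have "\<bar>u \<theta> - m\<bar> \<le> B + \<bar>m\<bar>" using B[of \<theta>] by linarith
        then have "\<bar>u \<theta> - m\<bar> ^ (2 * r) \<le> (B + \<bar>m\<bar>) ^ (2 * r)" by (intro power_mono) auto
        then show "(u \<theta> - m) ^ (2 * r) \<le> (B + \<bar>m\<bar>) ^ (2 * r)" by (simp add: power_even_abs)
      qed
      also have "\<dots> = ennreal ((B + \<bar>m\<bar>) ^ (2 * r))" using S.emeasure_space_1 by simp
      finally show "(\<integral>\<^sup>+\<theta>. ennreal ((u \<theta> - m) ^ (2 * r)) \<partial>sphere_measure) \<noteq> \<infinity>"
        by (auto simp: top_unique)
    qed measurable
    also have "\<dots> \<le> ?L" by (intro nn_integral_mono jensen)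
    finally show ?thesis .
  qed

  have path: "?L \<le> ?c * (ennreal pi * (\<integral>\<^sup>+x. (\<integral>\<^sup>+y. K (x, y) \<partial>gauss) \<partial>gauss))"
  proof -
    let ?J = "\<lambda>x y. \<integral>\<^sup>+t. K (cos t *\<^sub>R x + sin t *\<^sub>R y, cos t *\<^sub>R y - sin t *\<^sub>R x) * indicator {- (pi / 2)..pi / 2} t \<partial>lborel"
    note [measurable] = measurable_compose[OF borel_measurable_Pair K]
    have "?L \<le> (\<integral>\<^sup>+x. (\<integral>\<^sup>+y. ?c * ?J x y \<partial>gauss) \<partial>gauss)"
    proof (rule nn_integral_mono_AE, use AE_gauss_nonzero in eventually_elim)
      fix x :: "real ^ 'n" assume x: "x \<noteq> 0"
      show "(\<integral>\<^sup>+y. ennreal (a x y ^ (2 * r)) \<partial>gauss) \<le> (\<integral>\<^sup>+y. ?c * ?J x y \<partial>gauss)"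
      proof (rule nn_integral_mono_AE, use AE_gauss_independent[OF dim x] in eventually_elim)
        fix y assume indep: "(x \<bullet> y)\<^sup>2 < (norm x)\<^sup>2 * (norm y)\<^sup>2"
        then have y: "y \<noteq> 0" by auto
        have s: "Suc (2 * r - 1) = 2 * r" using r by simp
        have "a x y = F (sgn x) - (F (sgn y) + F (- sgn y)) / 2"
          using x y by (simp add: a_def uF norm_sgn)
        then have "a x y ^ (2 * r) = \<bar>F (sgn x) - (F (sgn y) + F (- sgn y)) / 2\<bar> ^ (2 * r)"
          by (simp add: power_even_abs)
        moreover have "continuous_on ?S H"
          by (rule continuous_on_eq[OF G]) (simp add: HG)
        moreover have "GDERIV F \<theta> :> H \<theta>" if "\<theta> \<in> ?S" for \<theta>
          using F[OF that] HG[OF that] by simp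
        ultimately show "ennreal (a x y ^ (2 * r)) \<le> ?c * ?J x y"
          unfolding K_def fst_conv snd_conv
          using path_difference_le[OF _ _ indep, where F=F and G=H and p="2 * r - 1", unfolded s]
          by (simp only:)
      qed
    qed
    also have "\<dots> = ?c * (\<integral>\<^sup>+x. (\<integral>\<^sup>+y. ?J x y \<partial>gauss) \<partial>gauss)"
      by (subst nn_integral_cmult, measurable)+
    finally show ?thesis by (simp only: nn_integral_gauss_path[OF K])
  qed

  have kernel: "(\<integral>\<^sup>+x. (\<integral>\<^sup>+y. K (x, y) \<partial>gauss) \<partial>gauss)
      \<le> ennreal ((real r / (real CARD('n) - 1)) ^ r) * (\<integral>\<^sup>+\<theta>. ennreal (N \<theta>) \<partial>sphere_measure)"
  proof -
    obtain e :: "real ^ 'n" where e: "norm e = 1" using vector_choose_size[of 1] by auto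
    let ?P = "\<integral>\<^sup>+y. ennreal (perp e y) \<partial>gauss" and ?R = "\<integral>\<^sup>+x. ennreal (1 / norm (x :: real ^ 'n)) \<partial>gauss"
    let ?k = "ennreal ((real r / (real CARD('n) - 1)) ^ r)"
    have "(\<integral>\<^sup>+x. (\<integral>\<^sup>+y. K (x, y) \<partial>gauss) \<partial>gauss) \<le> (\<integral>\<^sup>+x. ennreal (1 / norm x) * ennreal (N (sgn x)) * (?k * ?P) \<partial>gauss)"
    proof (rule nn_integral_mono_AE, use AE_gauss_nonzero in eventually_elim)
      fix x :: "real ^ 'n" assume "x \<noteq> 0"
      from nn_integral_gradient_kernel_le[OF n r this e, of H]
      show "(\<integral>\<^sup>+y. K (x, y) \<partial>gauss) \<le> ennreal (1 / norm x) * ennreal (N (sgn x)) * (?k * ?P)"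
        by (simp only: K_def N_def fst_conv snd_conv)
    qed
    also have "\<dots> = (\<integral>\<^sup>+x. ennreal (1 / norm x) * ennreal (N (sgn x)) \<partial>gauss) * (?k * ?P)"
      by (rule nn_integral_multc) measurable
    also have "(\<integral>\<^sup>+x. ennreal (1 / norm x) * ennreal (N (sgn x)) \<partial>gauss) = ?R * (\<integral>\<^sup>+\<theta>. ennreal (N \<theta>) \<partial>sphere_measure)"
      by (rule nn_integral_gauss_radial[where k="\<lambda>s. ennreal (1 / s)"]) (use finN in simp_all)
    also have "?R * (\<integral>\<^sup>+\<theta>. ennreal (N \<theta>) \<partial>sphere_measure) * (?k * ?P)
        = ?k * (\<integral>\<^sup>+\<theta>. ennreal (N \<theta>) \<partial>sphere_measure) * (?R * ?P)"
      by (simp only: mult_ac)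
    also have "\<dots> \<le> ?k * (\<integral>\<^sup>+\<theta>. ennreal (N \<theta>) \<partial>sphere_measure) * 1"
      by (intro mult_left_mono expectation_perp_norm(1)[OF n e]) simp
    finally show ?thesis by simp
  qed

  have NG: "(\<integral>\<^sup>+\<theta>. ennreal (N \<theta>) \<partial>sphere_measure) = (\<integral>\<^sup>+\<theta>. ennreal (norm (tangent_gradient G \<theta>) ^ (2 * r)) \<partial>sphere_measure)"
    by (rule nn_integral_cong) (simp add: N_def tangent_gradient_def HG)
  have "(\<integral>\<^sup>+\<theta>. ennreal ((F \<theta> - m) ^ (2 * r)) \<partial>sphere_measure)
      \<le> ?c * (ennreal pi * (ennreal ((real r / (real CARD('n) - 1)) ^ r) * (\<integral>\<^sup>+\<theta>. ennreal (N \<theta>) \<partial>sphere_measure)))"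
    by (intro order_trans[OF lower] order_trans[OF path] mult_left_mono kernel) auto
  also have "\<dots> = (?c * ennreal pi * ennreal ((real r / (real CARD('n) - 1)) ^ r)) * (\<integral>\<^sup>+\<theta>. ennreal (N \<theta>) \<partial>sphere_measure)"
    by (simp only: mult.assoc)
  \<comment> \<open>The power \<open>2 * r - 1\<close> of \<open>pi\<close> is the total weight in
    Hoelder's inequality, and the last factor \<open>pi\<close> is the length of the parameter
    range.\<close>
  also have "?c * ennreal pi = ennreal ((pi / 2) ^ (2 * r))"
  proof -
    have "pi ^ (2 * r - 1) * pi = pi ^ (2 * r)"
      by (rule power_minus_mult) (use r in simp)
    then have "pi ^ (2 * r - 1) / 2 ^ (2 * r) * pi = (pi / 2) ^ (2 * r)"
      by (simp only: power_divide times_divide_eq_left)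
    then show ?thesis by (simp add: ennreal_mult''[symmetric])
  qed
  also have "ennreal ((pi / 2) ^ (2 * r)) * ennreal ((real r / (real CARD('n) - 1)) ^ r)
      = ennreal ((pi / 2) ^ (2 * r) * (real r / (real CARD('n) - 1)) ^ r)"
    by (rule ennreal_mult'[symmetric]) simp
  finally show ?thesis unfolding NG m_def .
qed

section \<open>Spherical derivatives\<close>

lemma gderiv_imp_isCont: "GDERIV F x :> g \<Longrightarrow> isCont F x"
  unfolding gderiv_def by (rule has_derivative_continuous)

lemma C_on_imp_continuous: "C_on k U F \<Longrightarrow> continuous_on U F"
  by (cases k) (auto intro!: continuous_at_imp_continuous_on intro: gderiv_imp_isCont)

lemma C_on_Suc_imp: "C_on (Suc k) U F \<Longrightarrow> C_on k U F"
proof (induction k arbitrary: F)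
  case 0
  then have "continuous_on U F" by (rule C_on_imp_continuous)
  then show ?case by simp
next
  case (Suc k)
  from Suc.prems obtain G where G: "\<forall>x\<in>U. GDERIV F x :> G x" "\<forall>i. C_on (Suc k) U (\<lambda>x. G x $ i)"
    unfolding C_on.simps(2)[of "Suc k"] by blast
  with Suc.IH have "\<forall>i. C_on k U (\<lambda>x. G x $ i)" by blast
  with G show ?case unfolding C_on.simps by blast
qed

lemma C_on_const: "C_on k U (\<lambda>x. c)"
proof (induction k arbitrary: c)
  case (Suc k)
  have "GDERIV (\<lambda>x. c) x :> 0" for x :: "real ^ 'n" by (rule GDERIV_const)
  with Suc show ?case by (auto intro!: exI[of _ "\<lambda>x. 0"])
qed simp

lemma C_on_add:
  assumes "C_on k U F" "C_on k U H"
  shows "C_on k U (\<lambda>x. F x + H x)"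
  using assms
proof (induction k arbitrary: F H)
  case 0
  then show ?case by (simp add: continuous_on_add)
next
  case (Suc k)
  then obtain dF dH where "\<forall>x\<in>U. GDERIV F x :> dF x" "\<forall>i. C_on k U (\<lambda>x. dF x $ i)"
    "\<forall>x\<in>U. GDERIV H x :> dH x" "\<forall>i. C_on k U (\<lambda>x. dH x $ i)" by auto
  then show ?case unfolding C_on.simps
    by (intro exI[of _ "\<lambda>x. dF x + dH x"]) (auto intro: GDERIV_add Suc.IH)
qed

lemma C_on_mult:
  assumes "C_on k U F" "C_on k U H"
  shows "C_on k U (\<lambda>x. F x * H x)"
  using assms
proof (induction k arbitrary: F H)
  case 0
  then show ?case by (simp add: continuous_on_mult)
next
  case (Suc k)
  then have FH: "C_on k U F" "C_on k U H" by (auto intro: C_on_Suc_imp simp del: C_on.simps)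
  from Suc.prems obtain dF dH where "\<forall>x\<in>U. GDERIV F x :> dF x" "\<forall>i. C_on k U (\<lambda>x. dF x $ i)"
    "\<forall>x\<in>U. GDERIV H x :> dH x" "\<forall>i. C_on k U (\<lambda>x. dH x $ i)" by auto
  then show ?case unfolding C_on.simps
    by (intro exI[of _ "\<lambda>x. F x *\<^sub>R dH x + H x *\<^sub>R dF x"])
      (auto intro!: GDERIV_mult C_on_add Suc.IH FH)
qed

lemma C_on_component: "C_on k U (\<lambda>x :: real ^ 'n. x $ i)"
proof (cases k)
  case (Suc l)
  have "GDERIV (\<lambda>x. x $ i) x :> axis i 1" for x :: "real ^ 'n"
    unfolding gderiv_def by (simp add: inner_axis bounded_linear_vec_nth bounded_linear_imp_has_derivative)
  then show ?thesis
    unfolding Suc by (auto intro!: exI[of _ "\<lambda>x. axis i 1"] C_on_const)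
qed (simp add: continuous_on_component)

lemma C_on_sum:
  assumes "finite I" "\<And>i. i \<in> I \<Longrightarrow> C_on k U (F i)"
  shows "C_on k U (\<lambda>x. \<Sum>i\<in>I. F i x)"
  using assms by (induction I) (auto intro: C_on_const C_on_add)

lemma C_extension_le:
  assumes "C_extension k f U F" "l \<le> k"
  shows "C_extension l f U F"
  using assms(2,1)
proof (induction rule: dec_induct)
  case (step n)
  then show ?case by (auto simp: C_extension_def intro: C_on_Suc_imp simp del: C_on.simps)
qed

text \<open>Replacing \<theta> by \<open>x\<close> in the projection formula extends the derivative
  to the same open set \<open>U\<close>. The extension is a polynomial in \<open>x\<close> and the
  components of \<open>G\<close>, so just one order of smoothness is lost and the construction can
  be iterated.\<close>

lemma C_extension_sphere_deriv:
  assumes "C_extension (Suc k) f U F"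
  obtains G where "\<And>x. x \<in> U \<Longrightarrow> GDERIV F x :> G x" "\<And>i. C_on k U (\<lambda>x. G x $ i)"
    "\<And>\<theta>. \<theta> \<in> sphere 0 1 \<Longrightarrow> sphere_grad f \<theta> = tangent_gradient G \<theta>"
    "\<And>i. C_extension k (sphere_deriv i f) U (\<lambda>x. tangent_gradient G x $ i)"
proof -
  from assms obtain G where G: "\<And>x. x \<in> U \<Longrightarrow> GDERIV F x :> G x" "\<And>i. C_on k U (\<lambda>x. G x $ i)"
    by (auto simp: C_extension_def)
  have U: "sphere 0 1 \<subseteq> U" using assms by (simp add: C_extension_def)
  have ext1: "C_extension 1 f U F" by (rule C_extension_le[OF assms]) simp
  have grad: "sphere_grad f \<theta> = tangent_gradient G \<theta>" if "\<theta> \<in> sphere 0 1" for \<theta>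
    unfolding tangent_gradient_def
    by (rule sphere_grad_eq[OF ext1 G(1)]) (use that U in auto)
  have "tangent_gradient G x $ i = G x $ i + (\<Sum>j\<in>UNIV. G x $ j * x $ j) * (- 1 * x $ i)" for x i
    by (simp add: tangent_gradient_def inner_vec_def)
  then have "C_on k U (\<lambda>x. tangent_gradient G x $ i)" for i
    by (simp only:) (intro C_on_add C_on_mult C_on_sum C_on_const C_on_component G finite)
  then have "C_extension k (sphere_deriv i f) U (\<lambda>x. tangent_gradient G x $ i)" for i
    using assms grad by (simp add: C_extension_def sphere_deriv_def inner_axis)
  with G grad that show ?thesis by blast
qed

lemma C_sphere_derivs:
  assumes "C_sphere (length is + k) f"
  shows "C_sphere k (sphere_derivs is f)"
  using assms
proof (induction "is" arbitrary: k)
  case Nil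
  then show ?case by (simp add: sphere_derivs_def)
next
  case (Cons i "is")
  then have "C_sphere (Suc k) (sphere_derivs is f)" by simp
  then obtain U F where "C_extension (Suc k) (sphere_derivs is f) U F"
    unfolding C_sphere_def by blast
  then obtain G where "C_extension k (sphere_deriv i (sphere_derivs is f)) U (\<lambda>x. tangent_gradient G x $ i)"
    by (rule C_extension_sphere_deriv) blast
  then show ?case by (auto simp: C_sphere_def sphere_derivs_def)
qed

lemma C_sphere_le: "C_sphere k f \<Longrightarrow> l \<le> k \<Longrightarrow> C_sphere l f"
  unfolding C_sphere_def by (blast intro: C_extension_le)

lemma C_sphere_continuous: "C_sphere k f \<Longrightarrow> continuous_on (sphere 0 1) f"
  unfolding C_sphere_def C_extension_def
  by (metis C_on_imp_continuous continuous_on_eq continuous_on_subset)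

text \<open>The \<open>g i\<close> may have extensions to different open sets. Only values and
  gradients at points of the sphere are kept, so no common domain has to be formed.\<close>

lemma C_sphere_linear_combination:
  assumes "finite I" "\<And>i. i \<in> I \<Longrightarrow> C_sphere 1 (g i)"
  obtains A H where "\<And>\<theta>. \<theta> \<in> sphere 0 1 \<Longrightarrow> A \<theta> = (\<Sum>i\<in>I. g i \<theta> * c i)"
    "\<And>\<theta>. \<theta> \<in> sphere 0 1 \<Longrightarrow> GDERIV A \<theta> :> H \<theta>" "continuous_on (sphere 0 1) H"
    "\<And>\<theta>. \<theta> \<in> sphere 0 1 \<Longrightarrow> tangent_gradient H \<theta> = (\<Sum>i\<in>I. c i *\<^sub>R sphere_grad (g i) \<theta>)"
proof -
  have "\<forall>i\<in>I. \<exists>F G. (\<forall>\<theta>\<in>sphere 0 1. F \<theta> = g i \<theta> \<and> GDERIV F \<theta> :> G \<theta> \<and> sphere_grad (g i) \<theta> = tangent_gradient G \<theta>)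
      \<and> continuous_on (sphere 0 1) G"
  proof
    fix i assume "i \<in> I"
    from assms(2)[OF this] obtain U F where F: "C_extension (Suc 0) (g i) U F"
      unfolding C_sphere_def One_nat_def by blast
    then have U: "sphere 0 1 \<subseteq> U" and v: "\<forall>\<theta>\<in>sphere 0 1. F \<theta> = g i \<theta>" by (auto simp: C_extension_def)
    from F obtain G where G: "\<And>x. x \<in> U \<Longrightarrow> GDERIV F x :> G x" "\<And>j. C_on 0 U (\<lambda>x. G x $ j)"
      "\<And>\<theta>. \<theta> \<in> sphere 0 1 \<Longrightarrow> sphere_grad (g i) \<theta> = tangent_gradient G \<theta>"
      by (rule C_extension_sphere_deriv) blast
    have "continuous_on U (\<lambda>x. G x $ j)" for j using G(2)[of j] by simp
    then have "continuous_on U (\<lambda>x. \<chi> j. G x $ j)" by (intro continuous_on_vec_lambda)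
    then have "continuous_on (sphere 0 1) G" using U by (auto intro: continuous_on_subset)
    with G U v show "\<exists>F G. (\<forall>\<theta>\<in>sphere 0 1. F \<theta> = g i \<theta> \<and> GDERIV F \<theta> :> G \<theta> \<and> sphere_grad (g i) \<theta> = tangent_gradient G \<theta>)
      \<and> continuous_on (sphere 0 1) G" by blast
  qed
  then obtain F G where FG: "\<And>i \<theta>. i \<in> I \<Longrightarrow> \<theta> \<in> sphere 0 1 \<Longrightarrow>
      F i \<theta> = g i \<theta> \<and> GDERIV (F i) \<theta> :> G i \<theta> \<and> sphere_grad (g i) \<theta> = tangent_gradient (G i) \<theta>"
    "\<And>i. i \<in> I \<Longrightarrow> continuous_on (sphere 0 1) (G i)"
    by (metis (no_types, lifting))
  show ?thesis
  proof
    show "(\<Sum>i\<in>I. F i \<theta> * c i) = (\<Sum>i\<in>I. g i \<theta> * c i)" if "\<theta> \<in> sphere 0 1" for \<theta>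
      using FG(1)[OF _ that] by simp
    show "GDERIV (\<lambda>x. \<Sum>i\<in>I. F i x * c i) \<theta> :> (\<Sum>i\<in>I. c i *\<^sub>R G i \<theta>)" if "\<theta> \<in> sphere 0 1" for \<theta>
    proof -
      have "((\<lambda>x. \<Sum>i\<in>I. F i x * c i) has_derivative (\<lambda>h. \<Sum>i\<in>I. (h \<bullet> G i \<theta>) * c i)) (at \<theta>)"
        using FG(1)[OF _ that] unfolding gderiv_def
        by (intro has_derivative_sum has_derivative_mult_left) auto
      then show ?thesis unfolding gderiv_def by (simp add: inner_sum_right mult.commute)
    qed
    show "continuous_on (sphere 0 1) (\<lambda>\<theta>. \<Sum>i\<in>I. c i *\<^sub>R G i \<theta>)"
      by (intro continuous_intros FG(2))
    show "tangent_gradient (\<lambda>\<theta>. \<Sum>i\<in>I. c i *\<^sub>R G i \<theta>) \<theta> = (\<Sum>i\<in>I. c i *\<^sub>R sphere_grad (g i) \<theta>)"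
      if "\<theta> \<in> sphere 0 1" for \<theta>
      using FG(1)[OF _ that]
      by (simp add: tangent_gradient_def inner_sum_left scaleR_sum_left sum_subtractf scaleR_diff_right)
  qed
qed

section \<open>Multilinear forms of derivatives and their operator norms\<close>

lemma finite_multi_indices [simp]: "finite {is :: ('n::finite) list. length is = k}"
  using finite_lists_length_eq[of "UNIV :: 'n set" k] by simp

text \<open>The last derivative taken is the first entry of the multi-index, so putting
  \<open>w\<close> in front of the arguments differentiates the form of order \<open>k\<close> in
  the direction \<open>w\<close>. This is why the norm of order \<open>k + 1\<close> controls the
  gradient of the norm of order \<open>k\<close>.\<close>

lemma sphere_form_Suc:
  fixes v :: "nat \<Rightarrow> real ^ 'n"
  shows "sphere_form (Suc k) f \<theta> (case_nat w v) =
    (\<Sum>is | length is = k. (\<Prod>j<k. v j $ (is ! j)) *\<^sub>R sphere_grad (sphere_derivs is f) \<theta>) \<bullet> w"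
proof -
  have bij: "bij_betw (\<lambda>(i, is). i # is) (UNIV \<times> {is. length is = k}) {is :: 'n list. length is = Suc k}"
    by (rule bij_betwI[where g="\<lambda>is. (hd is, tl is)"]) (auto simp: length_Suc_conv)
  have "sphere_form (Suc k) f \<theta> (case_nat w v) = (\<Sum>(i, is)\<in>UNIV \<times> {is. length is = k}.
      sphere_derivs (i # is) f \<theta> * (\<Prod>j<Suc k. case_nat w v j $ ((i # is) ! j)))"
    unfolding sphere_form_def
    by (subst sum.reindex_bij_betw[OF bij, symmetric]) (simp add: case_prod_unfold)
  also have "\<dots> = (\<Sum>i\<in>UNIV. \<Sum>is | length is = k. sphere_grad (sphere_derivs is f) \<theta> $ i * (w $ i * (\<Prod>j<k. v j $ (is ! j))))"
    unfolding sum.cartesian_product[symmetric]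
    by (simp add: sphere_derivs_def sphere_deriv_def inner_axis prod.lessThan_Suc_shift del: prod.lessThan_Suc)
  also have "\<dots> = (\<Sum>is | length is = k. \<Sum>i\<in>UNIV. sphere_grad (sphere_derivs is f) \<theta> $ i * (w $ i * (\<Prod>j<k. v j $ (is ! j))))"
    by (rule sum.swap)
  also have "\<dots> = (\<Sum>is | length is = k. (\<Prod>j<k. v j $ (is ! j)) *\<^sub>R sphere_grad (sphere_derivs is f) \<theta>) \<bullet> w"
    unfolding inner_sum_left by (intro sum.cong refl) (simp add: inner_vec_def sum_distrib_left mult_ac)
  finally show ?thesis .
qed

definition unit_args :: "nat \<Rightarrow> (nat \<Rightarrow> real ^ 'n) set" where
  "unit_args k = {v. \<forall>j<k. norm (v j) = 1}"

lemma abs_prod_components_le: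
  fixes v :: "nat \<Rightarrow> real ^ 'n"
  assumes v: "v \<in> unit_args k"
  shows "\<bar>\<Prod>j<k. v j $ (is ! j)\<bar> \<le> 1"
  unfolding abs_prod
  by (rule prod_le_1) (use v component_le_norm_cart[of "v _"] in \<open>auto simp: unit_args_def, metis\<close>)

text \<open>The bound is uniform in \<open>v\<close>, so it passes to the supremum and makes the
  operator norm continuous.\<close>

lemma sphere_form_diff_le:
  fixes v :: "nat \<Rightarrow> real ^ 'n"
  assumes v: "v \<in> unit_args k"
  shows "\<bar>sphere_form k f \<theta> v - sphere_form k f \<eta> v\<bar>
    \<le> (\<Sum>is | length is = k. \<bar>sphere_derivs is f \<theta> - sphere_derivs is f \<eta>\<bar>)"
proof -
  note p = abs_prod_components_le[OF v]
  have "sphere_form k f \<theta> v - sphere_form k f \<eta> v =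
      (\<Sum>is | length is = k. (sphere_derivs is f \<theta> - sphere_derivs is f \<eta>) * (\<Prod>j<k. v j $ (is ! j)))"
    unfolding sphere_form_def by (simp add: sum_subtractf left_diff_distrib)
  also have "\<bar>\<dots>\<bar> \<le> (\<Sum>is | length is = k. \<bar>sphere_derivs is f \<theta> - sphere_derivs is f \<eta>\<bar>)"
    by (rule order_trans[OF sum_abs], rule sum_mono) (simp add: abs_mult p mult_left_le)
  finally show ?thesis .
qed

lemma bdd_above_sphere_form:
  fixes f :: "real ^ 'n \<Rightarrow> real"
  shows "bdd_above ((\<lambda>v. sphere_form k f \<theta> v) ` unit_args k)"
proof (rule bdd_aboveI2)
  fix v :: "nat \<Rightarrow> real ^ 'n" assume v: "v \<in> unit_args k"
  note p = abs_prod_components_le[OF v]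
  have "\<bar>sphere_form k f \<theta> v\<bar> \<le> (\<Sum>is | length is = k. \<bar>sphere_derivs is f \<theta>\<bar>)"
    unfolding sphere_form_def
    by (rule order_trans[OF sum_abs], rule sum_mono) (simp add: abs_mult p mult_left_le)
  then show "sphere_form k f \<theta> v \<le> (\<Sum>is | length is = k. \<bar>sphere_derivs is f \<theta>\<bar>)" by simp
qed

lemma sphere_form_le_op_norm: "v \<in> unit_args k \<Longrightarrow> sphere_form k f \<theta> v \<le> sphere_op_norm k f \<theta>"
  unfolding sphere_op_norm_def unit_args_def[symmetric]
  by (rule cSUP_upper[OF _ bdd_above_sphere_form])

lemma unit_args_nonempty: "unit_args k \<noteq> ({} :: (nat \<Rightarrow> real ^ 'n) set)"
proof -
  obtain e :: "real ^ 'n" where "norm e = 1" using vector_choose_size[of 1] by auto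
  then have "(\<lambda>_. e) \<in> unit_args k" by (simp add: unit_args_def)
  then show ?thesis by blast
qed

text \<open>The first argument of the form of order \<open>k + 1\<close> is set to the direction of
  the gradient itself, or to any unit vector if the gradient vanishes.\<close>

lemma norm_sphere_grad_combination_le:
  fixes v :: "nat \<Rightarrow> real ^ 'n"
  assumes v: "v \<in> unit_args k"
  shows "norm (\<Sum>is | length is = k. (\<Prod>j<k. v j $ (is ! j)) *\<^sub>R sphere_grad (sphere_derivs is f) \<theta>)
    \<le> sphere_op_norm (Suc k) f \<theta>"
proof -
  let ?g = "\<Sum>is | length is = k. (\<Prod>j<k. v j $ (is ! j)) *\<^sub>R sphere_grad (sphere_derivs is f) \<theta>"
  obtain w :: "real ^ 'n" where w: "norm w = 1" "?g \<bullet> w = norm ?g"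
  proof (cases "?g = 0")
    case True
    obtain e :: "real ^ 'n" where "norm e = 1" using vector_choose_size[of 1] by auto
    with True that show ?thesis by force
  next
    case False
    show ?thesis
      by (rule that[of "sgn ?g"]) (use False in \<open>auto simp: norm_sgn sgn_div_norm dot_square_norm power2_eq_square\<close>)
  qed
  have "case_nat w v \<in> unit_args (Suc k)"
    using v w by (auto simp: unit_args_def split: nat.split)
  from sphere_form_le_op_norm[OF this, of f \<theta>] show ?thesis
    by (simp add: sphere_form_Suc w)
qed

text \<open>From order 1 on, the supremum dominates the norm of a gradient. At order 0 there is no
  argument to change the sign of: the form is \<open>f \<theta>\<close> itself, so that order is
  treated separately in \<open>centered_moment_le\<close>.\<close>

lemma sphere_op_norm_nonneg:
  fixes f :: "real ^ 'n \<Rightarrow> real"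
  shows "0 \<le> sphere_op_norm (Suc k) f \<theta>"
proof -
  obtain v :: "nat \<Rightarrow> real ^ 'n" where "v \<in> unit_args k" using unit_args_nonempty by blast
  from order_trans[OF norm_ge_zero norm_sphere_grad_combination_le[OF this]] show ?thesis .
qed

lemma continuous_on_sphere_op_norm:
  fixes f :: "real ^ 'n \<Rightarrow> real"
  assumes f: "C_sphere d f" and k: "k \<le> d"
  shows "continuous_on (sphere 0 1) (sphere_op_norm k f)"
proof -
  let ?D = "\<lambda>\<theta> \<eta>. \<Sum>is | length is = k. \<bar>sphere_derivs is f \<theta> - sphere_derivs is f \<eta>\<bar>"
  have c: "continuous_on (sphere 0 1) (sphere_derivs is f)" if "length is = k" for "is"
    using that k f by (intro C_sphere_continuous[of "d - k"] C_sphere_derivs) simp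
  have le: "sphere_op_norm k f \<theta> \<le> sphere_op_norm k f \<eta> + ?D \<theta> \<eta>" for \<theta> \<eta>
    unfolding sphere_op_norm_def unit_args_def[symmetric]
  proof (rule cSUP_least[OF unit_args_nonempty])
    fix v :: "nat \<Rightarrow> real ^ 'n" assume v: "v \<in> unit_args k"
    have "sphere_form k f \<theta> v \<le> sphere_form k f \<eta> v + ?D \<theta> \<eta>"
      using sphere_form_diff_le[OF v, of f \<theta> \<eta>] by linarith
    then show "sphere_form k f \<theta> v \<le> (SUP v\<in>unit_args k. sphere_form k f \<eta> v) + ?D \<theta> \<eta>"
      using cSUP_upper[OF v bdd_above_sphere_form, of f \<eta>] by linarith
  qed
  have D: "?D \<theta> \<eta> = ?D \<eta> \<theta>" for \<theta> \<eta> by (simp add: abs_minus_commute)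
  have bd: "norm (sphere_op_norm k f \<theta> - sphere_op_norm k f \<eta>) \<le> ?D \<theta> \<eta>" for \<theta> \<eta>
    using le[of \<theta> \<eta>] le[of \<eta> \<theta>] D[of \<theta> \<eta>] by (simp add: abs_le_iff)
  show ?thesis
    unfolding continuous_on_def
  proof
    fix \<eta> :: "real ^ 'n" assume \<eta>: "\<eta> \<in> sphere 0 1"
    have "continuous_on (sphere 0 1) (\<lambda>\<theta>. ?D \<theta> \<eta>)"
      by (intro continuous_intros c) simp
    then have "((\<lambda>\<theta>. ?D \<theta> \<eta>) \<longlongrightarrow> ?D \<eta> \<eta>) (at \<eta> within sphere 0 1)"
      using \<eta> by (simp only: continuous_on_def)
    then have "((\<lambda>\<theta>. ?D \<theta> \<eta>) \<longlongrightarrow> 0) (at \<eta> within sphere 0 1)" by simp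
    then have "((\<lambda>\<theta>. sphere_op_norm k f \<theta> - sphere_op_norm k f \<eta>) \<longlongrightarrow> 0) (at \<eta> within sphere 0 1)"
      by (rule Lim_null_comparison[OF always_eventually[OF allI[OF bd]]])
    then show "(sphere_op_norm k f \<longlongrightarrow> sphere_op_norm k f \<eta>) (at \<eta> within sphere 0 1)"
      by (simp add: Lim_null[symmetric])
  qed
qed

lemma sphere_form_extension:
  fixes f :: "real ^ 'n \<Rightarrow> real"
  assumes f: "C_sphere d f" and k: "k < d" and v: "v \<in> unit_args k"
  obtains A H where "\<And>\<theta>. \<theta> \<in> sphere 0 1 \<Longrightarrow> A \<theta> = sphere_form k f \<theta> v"
    "\<And>\<theta>. \<theta> \<in> sphere 0 1 \<Longrightarrow> GDERIV A \<theta> :> H \<theta>" "continuous_on (sphere 0 1) H"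
    "\<And>\<theta>. \<theta> \<in> sphere 0 1 \<Longrightarrow> norm (tangent_gradient H \<theta>) \<le> sphere_op_norm (Suc k) f \<theta>"
proof -
  have c: "C_sphere 1 (sphere_derivs is f)" if "is \<in> {is. length is = k}" for "is"
    using that k by (intro C_sphere_derivs C_sphere_le[OF f]) simp
  show ?thesis
  proof (rule C_sphere_linear_combination[OF finite_multi_indices c, where c="\<lambda>is. \<Prod>j<k. v j $ (is ! j)"])
    fix A H assume A: "\<And>\<theta>. \<theta> \<in> sphere 0 1 \<Longrightarrow> A \<theta> = (\<Sum>is | length is = k. sphere_derivs is f \<theta> * (\<Prod>j<k. v j $ (is ! j)))"
      "\<And>\<theta>. \<theta> \<in> sphere 0 1 \<Longrightarrow> GDERIV A \<theta> :> H \<theta>" "continuous_on (sphere 0 1) H"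
      "\<And>\<theta>. \<theta> \<in> sphere 0 1 \<Longrightarrow> tangent_gradient H \<theta> =
        (\<Sum>is | length is = k. (\<Prod>j<k. v j $ (is ! j)) *\<^sub>R sphere_grad (sphere_derivs is f) \<theta>)"
    show thesis
      by (rule that[of A H]) (use A norm_sphere_grad_combination_le[OF v] in \<open>simp_all add: sphere_form_def\<close>)
  qed
qed

section \<open>Moments of the operator norms\<close>

lemma softmax_bounds:
  fixes a :: "'v \<Rightarrow> real"
  assumes V: "finite V" "V \<noteq> {}" and \<beta>: "0 < \<beta>"
  shows "v \<in> V \<Longrightarrow> a v \<le> ln (\<Sum>v\<in>V. exp (\<beta> * a v)) / \<beta>"
    and "\<exists>v\<in>V. ln (\<Sum>v\<in>V. exp (\<beta> * a v)) / \<beta> \<le> a v + ln (real (card V)) / \<beta>"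
proof -
  let ?S = "\<Sum>v\<in>V. exp (\<beta> * a v)"
  have S: "0 < ?S" using V by (intro sum_pos) auto
  show "a v \<le> ln ?S / \<beta>" if "v \<in> V"
  proof -
    have "exp (\<beta> * a v) \<le> ?S" using V that by (intro member_le_sum) auto
    then have "\<beta> * a v \<le> ln ?S" using S by (simp add: ln_ge_iff)
    then show ?thesis using \<beta> by (simp add: pos_le_divide_eq mult.commute)
  qed
  have "Max (a ` V) \<in> a ` V" using V by (intro Max_in) auto
  then obtain w where w: "w \<in> V" "a w = Max (a ` V)" by force
  then have le: "a v \<le> a w" if "v \<in> V" for v using V that by simp
  have "?S \<le> (\<Sum>v\<in>V. exp (\<beta> * a w))" using le \<beta> by (intro sum_mono) simp
  also have "\<dots> = real (card V) * exp (\<beta> * a w)" by simp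
  finally have "ln ?S \<le> ln (real (card V) * exp (\<beta> * a w))" using S by (intro ln_mono) auto
  also have "\<dots> = ln (real (card V)) + \<beta> * a w"
    using V by (subst ln_mult_pos) (auto simp: card_gt_0_iff)
  finally have "ln ?S / \<beta> \<le> a w + ln (real (card V)) / \<beta>"
    using \<beta> by (simp add: field_simps)
  with w show "\<exists>v\<in>V. ln ?S / \<beta> \<le> a v + ln (real (card V)) / \<beta>" by blast
qed

text \<open>
  The softmax \<open>ln (\<Sum>v. exp (\<beta> * A v)) / \<beta>\<close> is differentiable, unlike the maximum, and its
  gradient is a convex combination of the gradients of the \<open>A v\<close>.
\<close>

lemma smooth_maximum:
  fixes A :: "'v \<Rightarrow> 'a::euclidean_space \<Rightarrow> real"
  assumes V: "finite V" "V \<noteq> {}" and \<epsilon>: "0 < \<epsilon>"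
    and A: "\<And>v \<theta>. v \<in> V \<Longrightarrow> \<theta> \<in> sphere 0 1 \<Longrightarrow> GDERIV (A v) \<theta> :> G v \<theta>"
    and G: "\<And>v. v \<in> V \<Longrightarrow> continuous_on (sphere 0 1) (G v)"
    and w: "\<And>v \<theta>. v \<in> V \<Longrightarrow> \<theta> \<in> sphere 0 1 \<Longrightarrow> norm (tangent_gradient (G v) \<theta>) \<le> w \<theta>"
  obtains F H where "\<And>\<theta>. \<theta> \<in> sphere 0 1 \<Longrightarrow> GDERIV F \<theta> :> H \<theta>" "continuous_on (sphere 0 1) H"
    "\<And>\<theta>. \<theta> \<in> sphere 0 1 \<Longrightarrow> norm (tangent_gradient H \<theta>) \<le> w \<theta>"
    "\<And>v \<theta>. v \<in> V \<Longrightarrow> A v \<theta> \<le> F \<theta>"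
    "\<And>\<theta>. \<exists>v\<in>V. F \<theta> \<le> A v \<theta> + \<epsilon>"
proof -
  \<comment> \<open>Large enough for an error of at most \<epsilon>; the summand 1 keeps it positive
    when \<open>V\<close> is a singleton.\<close>
  define \<beta> where "\<beta> = (ln (real (card V)) + 1) / \<epsilon>"
  have card: "1 \<le> real (card V)" using V by (simp add: Suc_le_eq card_gt_0_iff)
  then have \<beta>: "0 < \<beta>"
    unfolding \<beta>_def using \<epsilon> by (intro divide_pos_pos add_nonneg_pos ln_ge_zero) auto
  have small: "ln (real (card V)) / \<beta> \<le> \<epsilon>"
    using \<epsilon> ln_ge_zero[OF card] by (simp add: \<beta>_def field_simps)
  define S where "S \<theta> = (\<Sum>v\<in>V. exp (\<beta> * A v \<theta>))" for \<theta>
  define F where "F \<theta> = ln (S \<theta>) / \<beta>" for \<theta>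
  define p where "p v \<theta> = exp (\<beta> * A v \<theta>) / S \<theta>" for v \<theta>
  define H where "H \<theta> = (\<Sum>v\<in>V. p v \<theta> *\<^sub>R G v \<theta>)" for \<theta>
  have S: "0 < S \<theta>" for \<theta> unfolding S_def using V by (intro sum_pos) auto
  have p: "0 \<le> p v \<theta>" "(\<Sum>v\<in>V. p v \<theta>) = 1" for v \<theta>
    using S[of \<theta>] by (simp_all add: p_def sum_divide_distrib[symmetric] S_def[symmetric])
  have cA: "continuous_on (sphere 0 1) (A v)" if "v \<in> V" for v
    using A[OF that] by (intro continuous_at_imp_continuous_on ballI gderiv_imp_isCont)
  show ?thesis
  proof
    show "GDERIV F \<theta> :> H \<theta>" if \<theta>: "\<theta> \<in> sphere 0 1" for \<theta>
    proof -
      have dA: "(A v has_derivative (\<lambda>h. h \<bullet> G v \<theta>)) (at \<theta>)" if "v \<in> V" for v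
        using A[OF that \<theta>] by (simp add: gderiv_def)
      have dS: "(S has_derivative (\<lambda>h. \<Sum>v\<in>V. exp (\<beta> * A v \<theta>) * (\<beta> * (h \<bullet> G v \<theta>)))) (at \<theta>)"
        unfolding S_def
      proof (rule has_derivative_sum)
        fix v assume "v \<in> V"
        from DERIV_compose_FDERIV[OF DERIV_exp has_derivative_mult_right[OF dA[OF this], of \<beta>]]
        show "((\<lambda>x. exp (\<beta> * A v x)) has_derivative (\<lambda>h. exp (\<beta> * A v \<theta>) * (\<beta> * (h \<bullet> G v \<theta>)))) (at \<theta>)"
          by (simp only: mult.commute[of _ "exp _"])
      qed
      have dL: "((\<lambda>\<theta>. ln (S \<theta>)) has_derivative (\<lambda>h. (\<Sum>v\<in>V. exp (\<beta> * A v \<theta>) * (\<beta> * (h \<bullet> G v \<theta>))) * inverse (S \<theta>))) (at \<theta>)"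
        by (rule DERIV_compose_FDERIV[OF DERIV_ln[OF S] dS])
      have "(F has_derivative (\<lambda>h. ((\<Sum>v\<in>V. exp (\<beta> * A v \<theta>) * (\<beta> * (h \<bullet> G v \<theta>))) * inverse (S \<theta>)) / \<beta>)) (at \<theta>)"
        unfolding F_def divide_inverse by (rule has_derivative_mult_left[OF dL])
      moreover have "((\<Sum>v\<in>V. exp (\<beta> * A v \<theta>) * (\<beta> * (h \<bullet> G v \<theta>))) * inverse (S \<theta>)) / \<beta> = h \<bullet> H \<theta>" for h
        unfolding H_def p_def inner_sum_right sum_distrib_right sum_divide_distrib
        by (intro sum.cong refl) (use \<beta> S[of \<theta>] in \<open>simp add: field_simps\<close>)
      ultimately show ?thesis by (simp add: gderiv_def)
    qed
    show "continuous_on (sphere 0 1) H"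
      unfolding H_def p_def S_def using S[unfolded S_def]
      by (intro continuous_intros cA G) (auto simp: less_le)
    show "norm (tangent_gradient H \<theta>) \<le> w \<theta>" if \<theta>: "\<theta> \<in> sphere 0 1" for \<theta>
    proof -
      have "tangent_gradient H \<theta> = (\<Sum>v\<in>V. p v \<theta> *\<^sub>R tangent_gradient (G v) \<theta>)"
        by (simp add: H_def tangent_gradient_def inner_sum_left scaleR_sum_left sum_subtractf scaleR_diff_right)
      also have "norm \<dots> \<le> (\<Sum>v\<in>V. p v \<theta> * w \<theta>)"
        by (rule sum_norm_le) (use p(1) w \<theta> in \<open>auto intro!: mult_left_mono\<close>)
      also have "\<dots> = w \<theta>" by (simp add: sum_distrib_right[symmetric] p(2))
      finally show ?thesis .
    qed
    show "A v \<theta> \<le> F \<theta>" if "v \<in> V" for v \<theta>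
      unfolding F_def S_def by (rule softmax_bounds(1)[OF V \<beta> that])
    show "\<exists>v\<in>V. F \<theta> \<le> A v \<theta> + \<epsilon>" for \<theta>
      using softmax_bounds(2)[OF V \<beta>, of "\<lambda>v. A v \<theta>"] small unfolding F_def S_def by force
  qed
qed

text \<open>Compactness is used for the point \<theta>, not for the arguments: each \<open>v\<close>
  serves the relatively open set of points where its form is within \<epsilon> of the norm, and
  finitely many of these sets cover the sphere.\<close>

lemma sphere_op_norm_finite_net:
  fixes f :: "real ^ 'n \<Rightarrow> real"
  assumes f: "C_sphere d f" and k: "k \<le> d" and \<epsilon>: "0 < \<epsilon>"
  obtains V where "finite V" "V \<noteq> {}" "V \<subseteq> unit_args k"
    "\<And>\<theta>. \<theta> \<in> sphere 0 1 \<Longrightarrow> \<exists>v\<in>V. sphere_op_norm k f \<theta> \<le> sphere_form k f \<theta> v + \<epsilon>"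
proof -
  let ?S = "sphere (0 :: real ^ 'n) 1"
  let ?h = "\<lambda>v \<theta>. sphere_form k f \<theta> v - sphere_op_norm k f \<theta>"
  have cform: "continuous_on ?S (\<lambda>\<theta>. sphere_form k f \<theta> v)" for v
    unfolding sphere_form_def using k
    by (intro continuous_intros C_sphere_continuous[of "d - k"] C_sphere_derivs C_sphere_le[OF f]) auto
  have "\<exists>T. open T \<and> T \<inter> ?S = ?h v -` {- \<epsilon><..} \<inter> ?S" for v
  proof -
    have "continuous_on ?S (?h v)"
      by (intro continuous_on_diff cform continuous_on_sphere_op_norm[OF f k])
    then show ?thesis
      by (rule continuous_on_open_invariant[THEN iffD1, rule_format, OF _ open_greaterThan])
  qed
  then obtain T where T: "\<And>v. open (T v)" "\<And>v. T v \<inter> ?S = ?h v -` {- \<epsilon><..} \<inter> ?S" by metis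
  have cover: "?S \<subseteq> (\<Union>v\<in>unit_args k. T v)"
  proof
    fix \<theta> assume \<theta>: "\<theta> \<in> ?S"
    have "sphere_op_norm k f \<theta> - \<epsilon> < (SUP v\<in>unit_args k. sphere_form k f \<theta> v)"
      using \<epsilon> by (simp add: sphere_op_norm_def unit_args_def)
    then obtain v where v: "v \<in> unit_args k" "sphere_op_norm k f \<theta> - \<epsilon> < sphere_form k f \<theta> v"
      using less_cSUP_iff[OF unit_args_nonempty bdd_above_sphere_form] by blast
    then have "\<theta> \<in> ?h v -` {- \<epsilon><..} \<inter> ?S" using \<theta> by simp
    with v T(2) show "\<theta> \<in> (\<Union>v\<in>unit_args k. T v)" by blast
  qed
  obtain V where V: "V \<subseteq> unit_args k" "finite V" "?S \<subseteq> (\<Union>v\<in>V. T v)"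
    by (rule compactE_image[OF _ _ cover]) (use T in auto)
  have near: "\<exists>v\<in>V. sphere_op_norm k f \<theta> \<le> sphere_form k f \<theta> v + \<epsilon>" if \<theta>: "\<theta> \<in> ?S" for \<theta>
  proof -
    obtain v where "v \<in> V" "\<theta> \<in> T v" using V(3) \<theta> by blast
    then have "\<theta> \<in> ?h v -` {- \<epsilon><..} \<inter> ?S" using T(2) \<theta> by blast
    with \<open>v \<in> V\<close> show ?thesis by force
  qed
  have "V \<noteq> {}"
  proof -
    obtain e :: "real ^ 'n" where "norm e = 1" using vector_choose_size[of 1] by auto
    with near[of e] show ?thesis by auto
  qed
  with V near that show ?thesis by blast
qed

text \<open>The softmax of the forms in a finite net. The net errs only downwards and the softmax
  only upwards, so the two errors do not add.\<close>

lemma sphere_op_norm_smooth_approximation: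
  fixes f :: "real ^ 'n \<Rightarrow> real"
  assumes f: "C_sphere d f" and k: "k < d" and \<epsilon>: "0 < \<epsilon>"
  obtains F H where "\<And>\<theta>. \<theta> \<in> sphere 0 1 \<Longrightarrow> GDERIV F \<theta> :> H \<theta>" "continuous_on (sphere 0 1) H"
    "\<And>\<theta>. \<theta> \<in> sphere 0 1 \<Longrightarrow> norm (tangent_gradient H \<theta>) \<le> sphere_op_norm (Suc k) f \<theta>"
    "\<And>\<theta>. \<theta> \<in> sphere 0 1 \<Longrightarrow> \<bar>F \<theta> - sphere_op_norm k f \<theta>\<bar> \<le> \<epsilon>"
proof -
  let ?S = "sphere (0 :: real ^ 'n) 1"
  obtain V where V: "finite V" "V \<noteq> {}" "V \<subseteq> unit_args k"
    "\<And>\<theta>. \<theta> \<in> ?S \<Longrightarrow> \<exists>v\<in>V. sphere_op_norm k f \<theta> \<le> sphere_form k f \<theta> v + \<epsilon>"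
    using sphere_op_norm_finite_net[OF f less_imp_le[OF k] \<epsilon>] by blast
  have "\<forall>v\<in>V. \<exists>p. (\<forall>\<theta>\<in>?S. fst p \<theta> = sphere_form k f \<theta> v \<and> GDERIV (fst p) \<theta> :> snd p \<theta> \<and>
      norm (tangent_gradient (snd p) \<theta>) \<le> sphere_op_norm (Suc k) f \<theta>) \<and> continuous_on ?S (snd p)"
  proof
    fix v assume "v \<in> V"
    then have v: "v \<in> unit_args k" using V by blast
    show "\<exists>p. (\<forall>\<theta>\<in>?S. fst p \<theta> = sphere_form k f \<theta> v \<and> GDERIV (fst p) \<theta> :> snd p \<theta> \<and>
      norm (tangent_gradient (snd p) \<theta>) \<le> sphere_op_norm (Suc k) f \<theta>) \<and> continuous_on ?S (snd p)"
    proof (rule sphere_form_extension[OF f k v])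
      fix A H
      assume "\<And>\<theta>. \<theta> \<in> ?S \<Longrightarrow> A \<theta> = sphere_form k f \<theta> v" "\<And>\<theta>. \<theta> \<in> ?S \<Longrightarrow> GDERIV A \<theta> :> H \<theta>"
        "continuous_on ?S H" "\<And>\<theta>. \<theta> \<in> ?S \<Longrightarrow> norm (tangent_gradient H \<theta>) \<le> sphere_op_norm (Suc k) f \<theta>"
      then show ?thesis by (intro exI[of _ "(A, H)"]) simp
    qed
  qed
  from bchoice[OF this] obtain p where p: "\<forall>v\<in>V. (\<forall>\<theta>\<in>?S. fst (p v) \<theta> = sphere_form k f \<theta> v \<and>
      GDERIV (fst (p v)) \<theta> :> snd (p v) \<theta> \<and> norm (tangent_gradient (snd (p v)) \<theta>) \<le> sphere_op_norm (Suc k) f \<theta>)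
      \<and> continuous_on ?S (snd (p v))" by blast
  define A G where "A v = fst (p v)" and "G v = snd (p v)" for v
  have AG: "\<And>v \<theta>. v \<in> V \<Longrightarrow> \<theta> \<in> ?S \<Longrightarrow> A v \<theta> = sphere_form k f \<theta> v"
    "\<And>v \<theta>. v \<in> V \<Longrightarrow> \<theta> \<in> ?S \<Longrightarrow> GDERIV (A v) \<theta> :> G v \<theta>"
    "\<And>v. v \<in> V \<Longrightarrow> continuous_on ?S (G v)"
    "\<And>v \<theta>. v \<in> V \<Longrightarrow> \<theta> \<in> ?S \<Longrightarrow> norm (tangent_gradient (G v) \<theta>) \<le> sphere_op_norm (Suc k) f \<theta>"
    unfolding A_def G_def using p by blast+
  show ?thesis
  proof (rule smooth_maximum[OF V(1,2) \<epsilon>, where A=A and G=G and w="sphere_op_norm (Suc k) f", OF AG(2,3,4)])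
    fix F H
    assume FH: "\<And>\<theta>. \<theta> \<in> ?S \<Longrightarrow> GDERIV F \<theta> :> H \<theta>" "continuous_on ?S H"
      "\<And>\<theta>. \<theta> \<in> ?S \<Longrightarrow> norm (tangent_gradient H \<theta>) \<le> sphere_op_norm (Suc k) f \<theta>"
      "\<And>v \<theta>. v \<in> V \<Longrightarrow> A v \<theta> \<le> F \<theta>" "\<And>\<theta>. \<exists>v\<in>V. F \<theta> \<le> A v \<theta> + \<epsilon>"
    have close: "\<bar>F \<theta> - sphere_op_norm k f \<theta>\<bar> \<le> \<epsilon>" if \<theta>: "\<theta> \<in> ?S" for \<theta>
    proof -
      obtain v where v: "v \<in> V" "sphere_op_norm k f \<theta> \<le> sphere_form k f \<theta> v + \<epsilon>" using V(4)[OF \<theta>] by blast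
      obtain w where w: "w \<in> V" "F \<theta> \<le> A w \<theta> + \<epsilon>" using FH(5) by blast
      have "sphere_form k f \<theta> w \<le> sphere_op_norm k f \<theta>"
        using w V by (intro sphere_form_le_op_norm) auto
      then show ?thesis
        using v w AG(1)[OF v(1) \<theta>] AG(1)[OF w(1) \<theta>] FH(4)[OF v(1), of \<theta>] by linarith
    qed
    show thesis by (rule that[OF FH(1-3) close])
  qed
qed

section \<open>Limits, Minkowski's inequality and the descending induction\<close>

lemma ennreal_le_power_limit:
  assumes "\<And>b. a < b \<Longrightarrow> X \<le> ennreal (b ^ p)"
  shows "X \<le> ennreal (a ^ p)"
proof (rule LIMSEQ_le_const)
  have "(\<lambda>n. (a + inverse (real (Suc n))) ^ p) \<longlonglongrightarrow> (a + 0) ^ p"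
    by (intro tendsto_intros LIMSEQ_inverse_real_of_nat)
  then show "(\<lambda>n. ennreal ((a + inverse (real (Suc n))) ^ p)) \<longlonglongrightarrow> ennreal (a ^ p)"
    by simp
  show "\<exists>N. \<forall>n\<ge>N. X \<le> ennreal ((a + inverse (real (Suc n))) ^ p)"
    by (intro exI allI impI assms) simp
qed

text \<open>Minkowski's inequality for adding a constant: the even power is convex, and the weights
  \<open>l\<close> and \<open>l'\<close> are proportional to the two summands, which makes the
  estimate sharp.\<close>

lemma nn_integral_power_add_const:
  fixes g :: "'x \<Rightarrow> real"
  assumes M: "prob_space M" and [measurable]: "g \<in> borel_measurable M"
    and g: "(\<integral>\<^sup>+x. ennreal (g x ^ (2 * r)) \<partial>M) \<le> ennreal (a ^ (2 * r))" and a: "0 \<le> a" and c: "0 \<le> c"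
  shows "(\<integral>\<^sup>+x. ennreal ((\<bar>g x\<bar> + c) ^ (2 * r)) \<partial>M) \<le> ennreal ((a + c) ^ (2 * r))"
proof (cases "c = 0")
  case True
  then show ?thesis using g by (simp add: power_even_abs)
next
  case False
  then have c0: "0 < c" using c by simp
  interpret prob_space M by fact
  let ?p = "2 * r"
  show ?thesis
  proof (rule ennreal_le_power_limit)
    fix D assume D: "a + c < D"
    \<comment> \<open>Strictly above \<open>a\<close>, so that the weight \<open>l\<close> is
      positive even if \<open>a = 0\<close>.\<close>
    define b where "b = D - c"
    have b: "a < b" "0 < b" "D = b + c" using D a by (simp_all add: b_def)
    have D0: "0 < D" using b c0 by simp
    define l where "l = b / D"
    define l' where "l' = c / D"
    have l: "0 < l" "0 < l'" "l + l' = 1" using b c0 D0 by (simp_all add: l_def l'_def add_divide_distrib[symmetric])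
    have pt: "(\<bar>g x\<bar> + c) ^ ?p \<le> l / l ^ ?p * g x ^ ?p + l' * (c / l') ^ ?p" for x
    proof -
      have "((1 - l') *\<^sub>R (\<bar>g x\<bar> / l) + l' *\<^sub>R (c / l')) ^ ?p \<le> (1 - l') * (\<bar>g x\<bar> / l) ^ ?p + l' * (c / l') ^ ?p"
        using l by (intro convex_onD[OF convex_power_even]) auto
      moreover have "1 - l' = l" using l by simp
      ultimately show ?thesis using l by (simp add: power_divide power_even_abs)
    qed
    have "(\<integral>\<^sup>+x. ennreal ((\<bar>g x\<bar> + c) ^ ?p) \<partial>M)
        \<le> (\<integral>\<^sup>+x. ennreal (l / l ^ ?p) * ennreal (g x ^ ?p) + ennreal (l' * (c / l') ^ ?p) \<partial>M)"
      using l c0 by (intro nn_integral_mono order_trans[OF ennreal_leI[OF pt]])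
        (simp add: ennreal_mult'[symmetric] ennreal_plus[symmetric] del: ennreal_plus)
    also have "\<dots> = ennreal (l / l ^ ?p) * (\<integral>\<^sup>+x. ennreal (g x ^ ?p) \<partial>M) + ennreal (l' * (c / l') ^ ?p)"
      by (simp add: nn_integral_add nn_integral_cmult emeasure_space_1)
    also have "\<dots> \<le> ennreal (l / l ^ ?p) * ennreal (b ^ ?p) + ennreal (l' * (c / l') ^ ?p)"
      using a b by (intro add_right_mono mult_left_mono order_trans[OF g] ennreal_leI power_mono) auto
    also have "\<dots> = ennreal (l / l ^ ?p * b ^ ?p + l' * (c / l') ^ ?p)"
      using l c0 b by (simp add: ennreal_mult'[symmetric] ennreal_plus[symmetric] del: ennreal_plus)
    also have "l / l ^ ?p * b ^ ?p + l' * (c / l') ^ ?p = D ^ ?p"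
    proof -
      have "b / l = D" "c / l' = D" using b c0 D0 by (simp_all add: l_def l'_def)
      moreover have "l / l ^ ?p * b ^ ?p = l * (b / l) ^ ?p" by (simp add: power_divide)
      ultimately have "l / l ^ ?p * b ^ ?p + l' * (c / l') ^ ?p = (l + l') * D ^ ?p"
        by (simp only: distrib_right)
      then show ?thesis by (simp only: l(3) mult_1)
    qed
    finally show "(\<integral>\<^sup>+x. ennreal ((\<bar>g x\<bar> + c) ^ ?p) \<partial>M) \<le> ennreal (D ^ ?p)" .
  qed
qed

lemma measurable_sphere_measure:
  fixes g :: "real ^ 'n \<Rightarrow> real"
  assumes "continuous_on (sphere 0 1) g"
  shows "g \<in> borel_measurable sphere_measure"
  by (subst measurable_cong_sets[OF sets_sphere_measure refl])
    (rule borel_measurable_continuous_on_restrict[OF assms])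

lemma integrable_sphere_measure:
  fixes g :: "real ^ 'n \<Rightarrow> real"
  assumes g: "continuous_on (sphere 0 1) g"
  shows "integrable sphere_measure g"
proof -
  interpret prob_space "sphere_measure :: (real ^ 'n) measure" by (rule prob_space_sphere_measure)
  have "bounded (g ` sphere 0 1)" by (intro compact_imp_bounded compact_continuous_image g) simp
  then obtain B where "\<And>\<theta>. \<theta> \<in> sphere 0 1 \<Longrightarrow> norm (g \<theta>) \<le> B"
    unfolding bounded_iff ball_simps by blast
  then show ?thesis
    by (intro integrable_const_bound[of _ B] AE_I2 measurable_sphere_measure g) simp
qed

text \<open>Apply the moment inequality to a smooth approximation \<open>F\<close> of the norm: the
  fluctuation of \<open>F\<close> about its mean costs \<open>s * B\<close>, the mean itself at most
  \<open>E\<close>, and Minkowski's inequality adds them.\<close>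

lemma op_norm_moment_step:
  fixes f :: "real ^ 'n \<Rightarrow> real"
  assumes n: "2 \<le> CARD('n)" and r: "0 < r" and f: "C_sphere d f" and k: "0 < k" "k < d"
    and B: "0 \<le> B" "(\<integral>\<^sup>+\<theta>. ennreal (sphere_op_norm (Suc k) f \<theta> ^ (2 * r)) \<partial>sphere_measure) \<le> ennreal (B ^ (2 * r))"
    and E: "(\<integral>\<theta>. sphere_op_norm k f \<theta> \<partial>sphere_measure) \<le> E"
  defines "s \<equiv> pi / 2 * sqrt (real r / (real CARD('n) - 1))"
  shows "(\<integral>\<^sup>+\<theta>. ennreal (sphere_op_norm k f \<theta> ^ (2 * r)) \<partial>sphere_measure) \<le> ennreal ((s * B + E) ^ (2 * r))"
proof -
  let ?u = "sphere_op_norm k f"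
  interpret prob_space "sphere_measure :: (real ^ 'n) measure" by (rule prob_space_sphere_measure)
  have u0: "0 \<le> ?u \<theta>" for \<theta>
    using sphere_op_norm_nonneg[of "k - 1" f \<theta>] k by simp
  have E0: "0 \<le> E"
    by (rule order_trans[OF _ E]) (auto intro!: integral_nonneg_AE u0)
  have s0: "0 \<le> s" using n by (simp add: s_def)
  have cu: "continuous_on (sphere 0 1) ?u" using k by (intro continuous_on_sphere_op_norm[OF f]) simp
  show ?thesis
  proof (rule ennreal_le_power_limit)
    fix b assume b: "s * B + E < b"
    \<comment> \<open>\<epsilon> is spent twice, once in replacing the norm by \<open>F\<close> and
      once in the mean of \<open>F\<close>; halving the gap makes the total exactly
      \<open>b\<close>.\<close>
    define \<epsilon> where "\<epsilon> = (b - (s * B + E)) / 2"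
    have \<epsilon>: "0 < \<epsilon>" using b by (simp add: \<epsilon>_def)
    obtain F H where F: "\<And>\<theta>. \<theta> \<in> sphere 0 1 \<Longrightarrow> GDERIV F \<theta> :> H \<theta>" "continuous_on (sphere 0 1) H"
      "\<And>\<theta>. \<theta> \<in> sphere 0 1 \<Longrightarrow> norm (tangent_gradient H \<theta>) \<le> sphere_op_norm (Suc k) f \<theta>"
      "\<And>\<theta>. \<theta> \<in> sphere 0 1 \<Longrightarrow> \<bar>F \<theta> - ?u \<theta>\<bar> \<le> \<epsilon>"
      by (rule sphere_op_norm_smooth_approximation[OF f k(2) \<epsilon>]) blast
    have cF: "continuous_on (sphere 0 1) F"
      using F(1) by (intro continuous_at_imp_continuous_on ballI gderiv_imp_isCont)
    define e where "e = (\<integral>\<theta>. F \<theta> \<partial>sphere_measure)"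
    have "e \<le> (\<integral>\<theta>. ?u \<theta> + \<epsilon> \<partial>sphere_measure)"
      unfolding e_def using F(4) integrable_sphere_measure[OF cF] integrable_sphere_measure[OF cu]
      by (intro integral_mono) (auto simp: abs_le_iff algebra_simps)
    also have "\<dots> = (\<integral>\<theta>. ?u \<theta> \<partial>sphere_measure) + \<epsilon>"
      using integrable_sphere_measure[OF cu] prob_space by simp
    finally have e: "e \<le> E + \<epsilon>" using E by simp
    have m: "(\<lambda>\<theta>. F \<theta> - e) \<in> borel_measurable sphere_measure"
      using measurable_sphere_measure[OF cF] by simp
    have "(\<integral>\<^sup>+\<theta>. ennreal ((F \<theta> - e) ^ (2 * r)) \<partial>sphere_measure) \<le>
        ennreal ((pi / 2) ^ (2 * r) * (real r / (real CARD('n) - 1)) ^ r)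
        * (\<integral>\<^sup>+\<theta>. ennreal (norm (tangent_gradient H \<theta>) ^ (2 * r)) \<partial>sphere_measure)"
      unfolding e_def by (rule sphere_moment_inequality[OF n r F(1,2)])
    also have "\<dots> \<le> ennreal (s ^ (2 * r)) * ennreal (B ^ (2 * r))"
    proof (intro mult_mono)
      have "(pi / 2) ^ (2 * r) * (real r / (real CARD('n) - 1)) ^ r = s ^ (2 * r)"
        unfolding s_def power_mult_distrib power_mult[of "sqrt _"] using n by simp
      then show "ennreal ((pi / 2) ^ (2 * r) * (real r / (real CARD('n) - 1)) ^ r) \<le> ennreal (s ^ (2 * r))"
        by simp
      show "(\<integral>\<^sup>+\<theta>. ennreal (norm (tangent_gradient H \<theta>) ^ (2 * r)) \<partial>sphere_measure) \<le> ennreal (B ^ (2 * r))"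
        using F(3) by (intro order_trans[OF _ B(2)] nn_integral_mono ennreal_leI power_mono) auto
    qed auto
    also have "\<dots> = ennreal ((s * B) ^ (2 * r))"
      by (simp add: power_mult_distrib ennreal_mult'[symmetric] zero_le_even_power)
    finally have "(\<integral>\<^sup>+\<theta>. ennreal ((\<bar>F \<theta> - e\<bar> + (E + 2 * \<epsilon>)) ^ (2 * r)) \<partial>sphere_measure)
        \<le> ennreal ((s * B + (E + 2 * \<epsilon>)) ^ (2 * r))"
      using s0 B(1) E0 \<epsilon> by (intro nn_integral_power_add_const[OF prob_space_sphere_measure m]) auto
    moreover have "(\<integral>\<^sup>+\<theta>. ennreal (?u \<theta> ^ (2 * r)) \<partial>sphere_measure)
        \<le> (\<integral>\<^sup>+\<theta>. ennreal ((\<bar>F \<theta> - e\<bar> + (E + 2 * \<epsilon>)) ^ (2 * r)) \<partial>sphere_measure)"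
    proof (intro nn_integral_mono ennreal_leI power_mono u0)
      fix \<theta> :: "real ^ 'n" assume "\<theta> \<in> space sphere_measure"
      then show "?u \<theta> \<le> \<bar>F \<theta> - e\<bar> + (E + 2 * \<epsilon>)"
        using F(4)[of \<theta>] e abs_ge_self[of "F \<theta> - e"] by (simp add: abs_le_iff)
    qed
    ultimately have "(\<integral>\<^sup>+\<theta>. ennreal (?u \<theta> ^ (2 * r)) \<partial>sphere_measure) \<le> ennreal ((s * B + (E + 2 * \<epsilon>)) ^ (2 * r))"
      by (rule order_trans[rotated])
    also have "s * B + (E + 2 * \<epsilon>) = b" by (simp add: \<epsilon>_def field_simps)
    finally show "(\<integral>\<^sup>+\<theta>. ennreal (?u \<theta> ^ (2 * r)) \<partial>sphere_measure) \<le> ennreal (b ^ (2 * r))" .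
  qed
qed

text \<open>The last step of the descent, from order 1 to \<open>f\<close>. The form of order 0 is
  already differentiable and has mean 0, so neither an approximation nor a mean term enters.\<close>

lemma centered_moment_le:
  fixes f :: "real ^ 'n \<Rightarrow> real"
  assumes n: "2 \<le> CARD('n)" and r: "0 < r" and f: "C_sphere d f" and d: "0 < d"
    and mean: "(\<integral>\<theta>. f \<theta> \<partial>sphere_measure) = 0"
    and B: "(\<integral>\<^sup>+\<theta>. ennreal (sphere_op_norm 1 f \<theta> ^ (2 * r)) \<partial>sphere_measure) \<le> ennreal (B ^ (2 * r))"
  defines "s \<equiv> pi / 2 * sqrt (real r / (real CARD('n) - 1))"
  shows "(\<integral>\<^sup>+\<theta>. ennreal (f \<theta> ^ (2 * r)) \<partial>sphere_measure) \<le> ennreal ((s * B) ^ (2 * r))"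
proof -
  have "(\<lambda>_. 0) \<in> (unit_args 0 :: (nat \<Rightarrow> real ^ 'n) set)" by (simp add: unit_args_def)
  then obtain A H where A: "\<And>\<theta>. \<theta> \<in> sphere 0 1 \<Longrightarrow> A \<theta> = sphere_form 0 f \<theta> (\<lambda>_. 0)"
    "\<And>\<theta>. \<theta> \<in> sphere 0 1 \<Longrightarrow> GDERIV A \<theta> :> H \<theta>" "continuous_on (sphere 0 1) H"
    "\<And>\<theta>. \<theta> \<in> sphere 0 1 \<Longrightarrow> norm (tangent_gradient H \<theta>) \<le> sphere_op_norm (Suc 0) f \<theta>"
    by (rule sphere_form_extension[OF f d]) blast
  have Af: "A \<theta> = f \<theta>" if "\<theta> \<in> sphere 0 1" for \<theta>
    using A(1)[OF that] by (simp add: sphere_form_def sphere_derivs_def)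
  have eA: "(\<integral>\<theta>. A \<theta> \<partial>sphere_measure) = 0"
    unfolding mean[symmetric] by (rule Bochner_Integration.integral_cong) (simp_all add: Af)
  have "(\<integral>\<^sup>+\<theta>. ennreal (f \<theta> ^ (2 * r)) \<partial>sphere_measure) = (\<integral>\<^sup>+\<theta>. ennreal ((A \<theta> - (\<integral>\<theta>. A \<theta> \<partial>sphere_measure)) ^ (2 * r)) \<partial>sphere_measure)"
    by (rule nn_integral_cong) (simp add: Af eA)
  also have "\<dots> \<le> ennreal ((pi / 2) ^ (2 * r) * (real r / (real CARD('n) - 1)) ^ r)
      * (\<integral>\<^sup>+\<theta>. ennreal (norm (tangent_gradient H \<theta>) ^ (2 * r)) \<partial>sphere_measure)"
    by (rule sphere_moment_inequality[OF n r A(2,3)])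
  also have "\<dots> \<le> ennreal (s ^ (2 * r)) * ennreal (B ^ (2 * r))"
  proof (intro mult_mono)
    have "(pi / 2) ^ (2 * r) * (real r / (real CARD('n) - 1)) ^ r = s ^ (2 * r)"
      unfolding s_def power_mult_distrib power_mult[of "sqrt _"] using n by simp
    then show "ennreal ((pi / 2) ^ (2 * r) * (real r / (real CARD('n) - 1)) ^ r) \<le> ennreal (s ^ (2 * r))"
      by simp
    show "(\<integral>\<^sup>+\<theta>. ennreal (norm (tangent_gradient H \<theta>) ^ (2 * r)) \<partial>sphere_measure) \<le> ennreal (B ^ (2 * r))"
      using A(4) by (intro order_trans[OF _ B] nn_integral_mono ennreal_leI power_mono) auto
  qed auto
  also have "\<dots> = ennreal ((s * B) ^ (2 * r))"
    by (simp add: power_mult_distrib ennreal_mult'[symmetric] zero_le_even_power)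
  finally show ?thesis .
qed

lemma expectation_op_norm_le:
  fixes f :: "real ^ 'n \<Rightarrow> real"
  assumes f: "C_sphere d f" and k: "k \<le> d"
  shows "(\<integral>\<theta>. sphere_op_norm k f \<theta> \<partial>sphere_measure) \<le> sphere_op_norm_L2 k f"
proof -
  interpret prob_space "sphere_measure :: (real ^ 'n) measure" by (rule prob_space_sphere_measure)
  have c: "continuous_on (sphere 0 1) (sphere_op_norm k f)" by (rule continuous_on_sphere_op_norm[OF f k])
  have "(\<integral>\<theta>. sphere_op_norm k f \<theta> \<partial>sphere_measure)\<^sup>2 \<le> (\<integral>\<theta>. (sphere_op_norm k f \<theta>)\<^sup>2 \<partial>sphere_measure)"
    by (rule jensens_inequality[where I=UNIV and q=power2])
      (auto intro!: integrable_sphere_measure continuous_intros c convex_power2)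
  then show ?thesis unfolding sphere_op_norm_L2_def by (rule real_le_rsqrt)
qed

text \<open>Descending induction on the order \<open>d - i\<close>. Passing to the next lower order
  multiplies the bound by \<open>s\<close> and adds a mean of at most \<open>s ^ Suc i\<close>, so
  all contributions have equal size and are merely counted.\<close>

lemma op_norm_moment_le:
  fixes f :: "real ^ 'n \<Rightarrow> real"
  assumes n: "2 \<le> CARD('n)" and r: "0 < r" and f: "C_sphere d f"
    and L2: "\<And>k. k \<in> {1..d - 1} \<Longrightarrow> sphere_op_norm_L2 k f \<le> real CARD('n) powr (- (real d - real k) / 2)"
    and top: "\<And>\<theta>. \<theta> \<in> sphere 0 1 \<Longrightarrow> sphere_op_norm d f \<theta> \<le> 1"
    and i: "i < d"
  defines "s \<equiv> pi / 2 * sqrt (real r / (real CARD('n) - 1))"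
  shows "(\<integral>\<^sup>+\<theta>. ennreal (sphere_op_norm (d - i) f \<theta> ^ (2 * r)) \<partial>sphere_measure)
    \<le> ennreal ((real (Suc i) * s ^ i) ^ (2 * r))"
  using i
proof (induction i)
  case 0
  interpret prob_space "sphere_measure :: (real ^ 'n) measure" by (rule prob_space_sphere_measure)
  have "0 \<le> sphere_op_norm d f \<theta>" for \<theta>
    using sphere_op_norm_nonneg[of "d - 1" f \<theta>] 0 by simp
  then have "(\<integral>\<^sup>+\<theta>. ennreal (sphere_op_norm d f \<theta> ^ (2 * r)) \<partial>sphere_measure) \<le> (\<integral>\<^sup>+\<theta>. 1 \<partial>(sphere_measure :: (real ^ 'n) measure))"
    using top by (intro nn_integral_mono) (simp add: power_le_one)
  then show ?case using emeasure_space_1 by simp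
next
  case (Suc i)
  let ?k = "d - Suc i" and ?m = "real CARD('n) - 1"
  have k: "0 < ?k" "?k < d" "Suc ?k = d - i" "real d - real ?k = real (Suc i)" using Suc.prems by auto
  have m: "1 \<le> ?m" using n by simp
  have s0: "0 \<le> s" using m by (simp add: s_def)
  \<comment> \<open>The assumed decay in powers of \<open>1 / sqrt n\<close> is thus no larger than
    powers of \<open>s\<close>, because \<open>pi / 2 * sqrt r\<close> is at least 1.\<close>
  have s: "1 / sqrt ?m \<le> s"
  proof -
    have "1 \<le> sqrt (real r)" using r by simp
    then have "1 * 1 \<le> pi / 2 * sqrt (real r)" using pi_ge_two by (intro mult_mono) auto
    then have "1 / sqrt ?m \<le> pi / 2 * sqrt (real r) / sqrt ?m" using m by (intro divide_right_mono) auto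
    then show ?thesis by (simp add: s_def real_sqrt_divide)
  qed
  have "(\<integral>\<theta>. sphere_op_norm ?k f \<theta> \<partial>sphere_measure) \<le> sphere_op_norm_L2 ?k f"
    using k by (intro expectation_op_norm_le[OF f]) simp
  also have "\<dots> \<le> real CARD('n) powr (- real (Suc i) / 2)"
    using L2[of ?k] k by (simp add: k(4))
  also have "\<dots> = (1 / sqrt (real CARD('n))) ^ Suc i"
  proof -
    have half: "- a / 2 = - (1 / 2) * a" for a :: real by simp
    have "real CARD('n) powr (- real (Suc i) / 2) = (real CARD('n) powr (- (1 / 2))) powr real (Suc i)"
      by (simp only: powr_powr half[of "real (Suc i)"])
    also have "\<dots> = (real CARD('n) powr (- (1 / 2))) ^ Suc i"
      by (rule powr_realpow) simp
    also have "real CARD('n) powr (- (1 / 2)) = 1 / sqrt (real CARD('n))"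
      by (simp only: powr_minus powr_half_sqrt of_nat_0_le_iff inverse_eq_divide)
    finally show ?thesis .
  qed
  also have "\<dots> \<le> (1 / sqrt ?m) ^ Suc i"
    using m by (intro power_mono divide_left_mono) auto
  also have "\<dots> \<le> s ^ Suc i" using s m by (intro power_mono) auto
  finally have E: "(\<integral>\<theta>. sphere_op_norm ?k f \<theta> \<partial>sphere_measure) \<le> s ^ Suc i" .
  have "(\<integral>\<^sup>+\<theta>. ennreal (sphere_op_norm (Suc ?k) f \<theta> ^ (2 * r)) \<partial>sphere_measure)
      \<le> ennreal ((real (Suc i) * s ^ i) ^ (2 * r))"
    unfolding k(3) using Suc.prems by (intro Suc.IH) simp
  moreover have "0 \<le> real (Suc i) * s ^ i" using s0 by simp
  ultimately have "(\<integral>\<^sup>+\<theta>. ennreal (sphere_op_norm ?k f \<theta> ^ (2 * r)) \<partial>sphere_measure)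
      \<le> ennreal ((s * (real (Suc i) * s ^ i) + s ^ Suc i) ^ (2 * r))"
    using op_norm_moment_step[OF n r f k(1,2) _ _ E, folded s_def] by blast
  also have "s * (real (Suc i) * s ^ i) + s ^ Suc i = real (Suc (Suc i)) * s ^ Suc i"
    by (simp add: algebra_simps)
  finally show ?case .
qed

section \<open>Exponential integrability\<close>

text \<open>Bernoulli's inequality, scaled by the mean, is the tangent line of the power at the
  mean. For odd \<open>d\<close> the power is convex only on the nonnegative half-line, which is why
  \<open>X\<close> is nonnegative.\<close>

lemma (in prob_space) expectation_power_le:
  fixes X :: "'a \<Rightarrow> real"
  assumes X: "integrable M X" and Xd: "integrable M (\<lambda>x. X x ^ d)" and X0: "\<And>x. 0 \<le> X x"
  shows "expectation X ^ d \<le> expectation (\<lambda>x. X x ^ d)"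
proof (cases "expectation X = 0 \<or> d = 0")
  case True
  have "0 \<le> expectation (\<lambda>x. X x ^ d)" by (rule Bochner_Integration.integral_nonneg) (simp add: X0)
  with True show ?thesis by (cases "d = 0") (auto simp: prob_space power_0_left)
next
  case False
  define \<mu> where "\<mu> = expectation X"
  have "0 \<le> \<mu>" unfolding \<mu>_def by (rule Bochner_Integration.integral_nonneg) (simp add: X0)
  with False have \<mu>: "0 < \<mu>" unfolding \<mu>_def by linarith
  have "\<mu> ^ d * (1 + real d * (X x / \<mu> - 1)) \<le> X x ^ d" for x
  proof -
    have "1 + real d * (X x / \<mu> - 1) \<le> (1 + (X x / \<mu> - 1)) ^ d"
      by (rule Bernoulli_inequality) (use X0[of x] \<mu> in simp)
    then have "\<mu> ^ d * (1 + real d * (X x / \<mu> - 1)) \<le> \<mu> ^ d * (X x / \<mu>) ^ d"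
      using \<mu> by (intro mult_left_mono) auto
    then show ?thesis using \<mu> by (simp add: power_divide)
  qed
  then have "expectation (\<lambda>x. \<mu> ^ d * (1 + real d * (X x / \<mu> - 1))) \<le> expectation (\<lambda>x. X x ^ d)"
    using X Xd by (intro integral_mono) auto
  also have "expectation (\<lambda>x. \<mu> ^ d * (1 + real d * (X x / \<mu> - 1))) = \<mu> ^ d"
    using X \<mu> by (simp add: prob_space \<mu>_def[symmetric])
  finally show ?thesis by (simp add: \<mu>_def)
qed

text \<open>The exponent \<open>r - 1\<close> instead of \<open>r\<close> saves a factor
  \<open>e\<close>, and this is decisive: the geometric series then starts with \<open>x\<close>
  (about 0.26) rather than with \<open>x * e\<close> (about 0.69), for which its sum would exceed
  1.\<close>

lemma self_power_le_fact: "0 < r \<Longrightarrow> real r ^ r \<le> exp (real r - 1) * fact r"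
proof (induction r rule: nat_induct_non_zero)
  case (Suc r)
  have "1 + 1 / real r \<le> exp (1 / real r)" by (rule exp_ge_add_one_self)
  then have "(1 + 1 / real r) ^ r \<le> exp (1 / real r) ^ r" by (intro power_mono) auto
  also have "\<dots> = exp 1" using Suc.hyps by (simp add: exp_of_nat_mult[symmetric])
  finally have e: "(1 + 1 / real r) ^ r \<le> exp 1" .
  have "real (Suc r) ^ Suc r = real (Suc r) * ((1 + 1 / real r) ^ r * real r ^ r)"
    using Suc.hyps by (simp add: power_mult_distrib[symmetric] field_simps)
  also have "\<dots> \<le> real (Suc r) * (exp 1 * (exp (real r - 1) * fact r))"
    by (intro mult_left_mono mult_mono e Suc.IH) auto
  also have "\<dots> = exp (real (Suc r) - 1) * fact (Suc r)"
    by (simp add: exp_add[symmetric] mult_ac)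
  finally show ?case .
qed simp

text \<open>Turns the number \<open>d\<close> of contributions into a constant under the
  \<open>d\<close>-th root. The induction step needs \<open>d + 1 \<le> 3 / 2 * d\<close>, that is
  \<open>d \<ge> 2\<close>.\<close>

lemma real_le_three_halves_power: "real d \<le> (3 / 2) ^ d"
proof (induction d)
  case (Suc d)
  show ?case
  proof (cases "2 \<le> d")
    case True
    then have "real (Suc d) \<le> 3 / 2 * real d" by simp
    also have "\<dots> \<le> 3 / 2 * (3 / 2) ^ d" using Suc.IH by (intro mult_left_mono) auto
    finally show ?thesis by simp
  next
    case False
    then have "d = 0 \<or> d = 1" by auto
    then show ?thesis by (auto simp: power2_eq_square)
  qed
qed simp

text \<open>\<open>x\<close> is \<open>1 / (8 * e)\<close> times \<open>9 / 4\<close> times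
  \<open>pi\<^sup>2 / 4\<close>. The margin is narrow: with \<open>pi \<le> 3.2\<close> from
  Machin's formula and \<open>e \<ge> 2.6\<close>, the value \<open>x * e\<close> is at most 0.72
  and \<open>x\<close> at most 0.277, to be compared with 0.28.\<close>

lemma exponential_series_constant:
  defines "x \<equiv> 9 * pi\<^sup>2 / (128 * exp 1)"
  shows "0 < x" "x * exp 1 < 1" "x / (1 - x * exp 1) \<le> 1"
proof -
  have "pi / 4 = 4 * arctan (1 / 5) - arctan (1 / 239)" by (rule machin)
  moreover have "arctan (1 / 5) \<le> 1 / 5" by (rule arctan_le_self) simp
  moreover have "0 \<le> arctan (1 / 239)" by simp
  ultimately have "pi \<le> 16 / 5" by linarith
  then have "pi\<^sup>2 \<le> (16 / 5)\<^sup>2" by (intro power_mono) auto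
  then have pi2: "pi\<^sup>2 \<le> 256 / 25" by (simp add: power2_eq_square)
  have "13 / 8 \<le> exp (1 / 2 :: real)"
    using exp_lower_Taylor_quadratic[of "1 / 2"] by (simp add: power2_eq_square)
  then have "(13 / 8)\<^sup>2 \<le> (exp (1 / 2 :: real))\<^sup>2" by (intro power_mono) auto
  also have "(exp (1 / 2 :: real))\<^sup>2 = exp 1" by (simp add: power2_eq_square exp_add[symmetric])
  finally have e: "2.6 \<le> exp (1 :: real)" by (simp add: power2_eq_square)
  show "0 < x" by (simp add: x_def)
  have xe: "x * exp 1 = 9 * pi\<^sup>2 / 128" by (simp add: x_def)
  then show "x * exp 1 < 1" using pi2 by simp
  have "x \<le> 9 * pi\<^sup>2 / (128 * 2.6)"
    unfolding x_def using e by (intro divide_left_mono mult_left_mono) auto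
  then have "x \<le> 1 - x * exp 1" unfolding xe using pi2 by simp
  then show "x / (1 - x * exp 1) \<le> 1" using \<open>x * exp 1 < 1\<close> by simp
qed

text \<open>The exponential series asks for moments of order \<open>2 * r / d\<close>, while the
  descent gives those of order \<open>2 * r\<close>. The \<open>d\<close>-th power of
  \<open>X\<close> is \<open>f ^ (2 * r)\<close>, so Jensen's inequality and a \<open>d\<close>-th
  root connect them.\<close>

lemma fractional_moment_le:
  fixes f :: "real ^ 'n \<Rightarrow> real"
  assumes n: "2 \<le> CARD('n)" and r: "0 < r" and d: "1 \<le> d" and f: "C_sphere d f"
    and mean: "(\<integral>\<theta>. f \<theta> \<partial>sphere_measure) = 0"
    and L2: "\<And>k. k \<in> {1..d - 1} \<Longrightarrow> sphere_op_norm_L2 k f \<le> real CARD('n) powr (- (real d - real k) / 2)"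
    and top: "\<And>\<theta>. \<theta> \<in> sphere 0 1 \<Longrightarrow> sphere_op_norm d f \<theta> \<le> 1"
  shows "(\<integral>\<^sup>+\<theta>. ennreal ((\<bar>f \<theta>\<bar> powr (2 / real d)) ^ r) \<partial>sphere_measure)
    \<le> ennreal ((9 / 4 * (pi\<^sup>2 / 4 * (real r / (real CARD('n) - 1)))) ^ r)"
proof -
  let ?m = "real CARD('n) - 1"
  interpret prob_space "sphere_measure :: (real ^ 'n) measure" by (rule prob_space_sphere_measure)
  define s where "s = pi / 2 * sqrt (real r / ?m)"
  define X where "X \<theta> = (\<bar>f \<theta>\<bar> powr (2 / real d)) ^ r" for \<theta>
  have m: "1 \<le> ?m" using n by simp
  have s0: "0 \<le> s" using m by (simp add: s_def)
  have s2: "s\<^sup>2 = pi\<^sup>2 / 4 * (real r / ?m)" using m by (simp add: s_def power_mult_distrib power_divide)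
  have cf: "continuous_on (sphere 0 1) f" by (rule C_sphere_continuous[OF f])
  have cX: "continuous_on (sphere 0 1) X"
    unfolding X_def using d by (intro continuous_intros cf continuous_on_powr') auto
  have Xd: "X \<theta> ^ d = f \<theta> ^ (2 * r)" for \<theta>
  proof -
    have "(\<bar>f \<theta>\<bar> powr (2 / real d)) ^ d = (f \<theta>)\<^sup>2"
    proof (cases "f \<theta> = 0")
      case False
      then have "(\<bar>f \<theta>\<bar> powr (2 / real d)) ^ d = \<bar>f \<theta>\<bar> powr (2 / real d * real d)"
        by (subst powr_powr[symmetric], subst powr_realpow) auto
      also have "\<dots> = (f \<theta>)\<^sup>2" using False d by (simp add: powr_numeral)
      finally show ?thesis .
    qed (use d in auto)
    moreover have "X \<theta> ^ d = ((\<bar>f \<theta>\<bar> powr (2 / real d)) ^ d) ^ r"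
      by (simp only: X_def power_mult[symmetric] mult.commute)
    ultimately show ?thesis by (simp only: power_mult)
  qed
  have "(\<integral>\<^sup>+\<theta>. ennreal (f \<theta> ^ (2 * r)) \<partial>sphere_measure) \<le> ennreal ((s * (real d * s ^ (d - 1))) ^ (2 * r))"
    using op_norm_moment_le[OF n r f L2 top, of "d - 1"] d
    unfolding s_def by (intro centered_moment_le[OF n r f _ mean]) auto
  also have "s * (real d * s ^ (d - 1)) = real d * s ^ d"
    using d by (cases d) auto
  finally have moment: "(\<integral>\<^sup>+\<theta>. ennreal (f \<theta> ^ (2 * r)) \<partial>sphere_measure) \<le> ennreal ((real d * s ^ d) ^ (2 * r))" .
  have ip: "integrable sphere_measure (\<lambda>\<theta>. X \<theta> ^ d)" by (intro integrable_sphere_measure continuous_intros cX)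
  have iX: "integrable sphere_measure X" by (rule integrable_sphere_measure[OF cX])
  have X0: "0 \<le> X \<theta>" for \<theta> by (simp add: X_def)
  have "ennreal (\<integral>\<theta>. X \<theta> ^ d \<partial>sphere_measure) = (\<integral>\<^sup>+\<theta>. ennreal (X \<theta> ^ d) \<partial>sphere_measure)"
    by (rule nn_integral_eq_integral[OF ip, symmetric]) (simp add: X0)
  also have "\<dots> \<le> ennreal ((real d * s ^ d) ^ (2 * r))" unfolding Xd by (rule moment)
  finally have "(\<integral>\<theta>. X \<theta> ^ d \<partial>sphere_measure) \<le> (real d * s ^ d) ^ (2 * r)"
    by (subst (asm) ennreal_le_iff) (simp_all add: zero_le_even_power)
  also have "\<dots> \<le> ((3 / 2) ^ d * s ^ d) ^ (2 * r)"
    using s0 by (intro power_mono mult_right_mono real_le_three_halves_power) auto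
  also have "\<dots> = ((9 / 4 * s\<^sup>2) ^ r) ^ d"
  proof -
    have "9 / 4 * s\<^sup>2 = (3 / 2 * s)\<^sup>2" by (simp add: power_mult_distrib power2_eq_square)
    then have "((9 / 4 * s\<^sup>2) ^ r) ^ d = (3 / 2 * s) ^ (2 * r * d)"
      by (simp only: power_mult)
    also have "2 * r * d = d * (2 * r)" by simp
    also have "(3 / 2 * s) ^ (d * (2 * r)) = ((3 / 2) ^ d * s ^ d) ^ (2 * r)"
      by (simp only: power_mult power_mult_distrib)
    finally show ?thesis ..
  qed
  finally have Xd_le: "(\<integral>\<theta>. X \<theta> ^ d \<partial>sphere_measure) \<le> ((9 / 4 * s\<^sup>2) ^ r) ^ d" .
  have "(\<integral>\<theta>. X \<theta> \<partial>sphere_measure) ^ d \<le> (\<integral>\<theta>. X \<theta> ^ d \<partial>sphere_measure)"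
    by (rule expectation_power_le[OF iX ip X0])
  with Xd_le have "(\<integral>\<theta>. X \<theta> \<partial>sphere_measure) ^ d \<le> ((9 / 4 * s\<^sup>2) ^ r) ^ d" by (rule order_trans[rotated])
  moreover obtain d' where "d = Suc d'" using d by (cases d) auto
  ultimately have "(\<integral>\<theta>. X \<theta> \<partial>sphere_measure) \<le> (9 / 4 * s\<^sup>2) ^ r"
    by (simp only:) (erule power_le_imp_le_base, simp)
  then have "ennreal (\<integral>\<theta>. X \<theta> \<partial>sphere_measure) \<le> ennreal ((9 / 4 * s\<^sup>2) ^ r)" by (rule ennreal_leI)
  also have "ennreal (\<integral>\<theta>. X \<theta> \<partial>sphere_measure) = (\<integral>\<^sup>+\<theta>. ennreal (X \<theta>) \<partial>sphere_measure)"
    by (rule nn_integral_eq_integral[symmetric, OF iX]) (simp add: X0)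
  finally show ?thesis by (simp only: X_def s2)
qed

theorem theorem1p15:
  fixes f :: "real ^ 'n \<Rightarrow> real" and d :: nat
  assumes "CARD('n) \<ge> 2" and "d \<ge> 1"
    and "C_sphere d f"
    and "(\<integral>\<theta>. f \<theta> \<partial>sphere_measure) = 0"
    and "\<And>k. k \<in> {1..d - 1} \<Longrightarrow>
           sphere_op_norm_L2 k f \<le> real CARD('n) powr (- (real d - real k) / 2)"
    and "\<And>\<theta>. \<theta> \<in> sphere 0 1 \<Longrightarrow> sphere_op_norm d f \<theta> \<le> 1"
  shows "(\<integral>\<^sup>+\<theta>. ennreal (exp ((real CARD('n) - 1) * \<bar>f \<theta>\<bar> powr (2 / real d) / (8 * exp 1)))
           \<partial>sphere_measure) \<le> 2"
proof -
  let ?m = "real CARD('n) - 1"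
  interpret prob_space "sphere_measure :: (real ^ 'n) measure" by (rule prob_space_sphere_measure)
  have m: "1 \<le> ?m" using assms(1) by simp
  define c where "c = ?m / (8 * exp 1)"
  have c: "0 \<le> c" using m by (simp add: c_def)
  define Y where "Y \<theta> = \<bar>f \<theta>\<bar> powr (2 / real d)" for \<theta>
  have Y0: "0 \<le> Y \<theta>" for \<theta> by (simp add: Y_def)
  have "continuous_on (sphere 0 1) Y"
    unfolding Y_def using assms(2)
    by (intro continuous_on_powr' continuous_intros C_sphere_continuous[OF assms(3)]) auto
  then have [measurable]: "Y \<in> borel_measurable sphere_measure" by (rule measurable_sphere_measure)
  define x where "x = 9 * pi\<^sup>2 / (128 * exp (1::real))"
  note x = exponential_series_constant[folded x_def]
  \<comment> \<open>For positive \<open>k\<close> this is \<open>x ^ k * exp (k - 1)\<close>. The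
    term at 0 equals 1 and stays outside the geometric series.\<close>
  define b where "b k = (if k = 0 then 1 else x * (x * exp 1) ^ (k - 1))" for k
  have b0: "0 \<le> b k" for k using x by (simp add: b_def)
  have "(\<lambda>k. x * (x * exp 1) ^ k) sums (x * (1 / (1 - x * exp 1)))"
    using x by (intro sums_mult geometric_sums) simp
  then have "(\<lambda>k. b (Suc k)) sums (x / (1 - x * exp 1))" by (simp add: b_def)
  then have "b sums (x / (1 - x * exp 1) + b 0)" by (rule sums_Suc)
  then have b: "summable b" "suminf b \<le> 2"
    using x(3) by (simp_all add: sums_iff b_def)
  have term_le: "ennreal (c ^ k / fact k) * (\<integral>\<^sup>+\<theta>. ennreal (Y \<theta> ^ k) \<partial>sphere_measure) \<le> ennreal (b k)" for k
  proof (cases "k = 0")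
    case True
    then show ?thesis using emeasure_space_1 by (simp add: b_def)
  next
    case False
    then have k: "0 < k" by simp
    have "(\<integral>\<^sup>+\<theta>. ennreal (Y \<theta> ^ k) \<partial>sphere_measure) \<le> ennreal ((9 / 4 * (pi\<^sup>2 / 4 * (real k / ?m))) ^ k)"
      unfolding Y_def by (rule fractional_moment_le[OF assms(1) k assms(2-6)])
    then have "ennreal (c ^ k / fact k) * (\<integral>\<^sup>+\<theta>. ennreal (Y \<theta> ^ k) \<partial>sphere_measure)
        \<le> ennreal (c ^ k / fact k) * ennreal ((9 / 4 * (pi\<^sup>2 / 4 * (real k / ?m))) ^ k)"
      by (rule mult_left_mono) simp
    also have "\<dots> = ennreal (c ^ k / fact k * (9 / 4 * (pi\<^sup>2 / 4 * (real k / ?m))) ^ k)"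
      by (rule ennreal_mult'[symmetric]) (use c in simp)
    \<comment> \<open>The dimension cancels between \<open>c\<close> and the moment bound, which
      leaves \<open>x * k\<close> under the power.\<close>
    also have "c ^ k / fact k * (9 / 4 * (pi\<^sup>2 / 4 * (real k / ?m))) ^ k = (x ^ k / fact k) * real k ^ k"
    proof -
      have "M / (8 * e) * (9 / 4 * (p / 4 * (q / M))) = 9 * p / (128 * e) * q" if "M \<noteq> 0" for M e p q :: real
        using that by simp
      from this[of ?m] have "c * (9 / 4 * (pi\<^sup>2 / 4 * (real k / ?m))) = x * real k"
        using m by (simp only: c_def x_def)
      then have "c ^ k * (9 / 4 * (pi\<^sup>2 / 4 * (real k / ?m))) ^ k = x ^ k * real k ^ k"
        by (simp only: power_mult_distrib[symmetric])
      then show ?thesis by (simp only: times_divide_eq_left)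
    qed
    also have "ennreal \<dots> \<le> ennreal ((x ^ k / fact k) * (exp (real k - 1) * fact k))"
      using x(1) by (intro ennreal_leI mult_left_mono self_power_le_fact k) auto
    also have "(x ^ k / fact k) * (exp (real k - 1) * fact k) = b k"
    proof -
      obtain l where l: "k = Suc l" using k by (cases k) auto
      show ?thesis by (simp add: l b_def power_mult_distrib exp_of_nat_mult[symmetric])
    qed
    finally show ?thesis .
  qed
  have "(\<integral>\<^sup>+\<theta>. ennreal (exp (?m * \<bar>f \<theta>\<bar> powr (2 / real d) / (8 * exp 1))) \<partial>sphere_measure)
      = (\<integral>\<^sup>+\<theta>. (\<Sum>k. ennreal (c ^ k / fact k) * ennreal (Y \<theta> ^ k)) \<partial>sphere_measure)"
  proof (rule nn_integral_cong)
    fix \<theta>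
    have "(\<lambda>k. c ^ k / fact k * Y \<theta> ^ k) sums exp (c * Y \<theta>)"
      using exp_converges[of "c * Y \<theta>"]
      by (simp only: real_scaleR_def power_mult_distrib divide_inverse mult_ac)
    then have "(\<Sum>k. ennreal (c ^ k / fact k * Y \<theta> ^ k)) = ennreal (exp (c * Y \<theta>))"
      using c Y0[of \<theta>] by (intro suminf_ennreal_eq) auto
    moreover have "?m * \<bar>f \<theta>\<bar> powr (2 / real d) / (8 * exp 1) = c * Y \<theta>"
      by (simp only: c_def Y_def times_divide_eq_left)
    moreover have "ennreal (c ^ k / fact k * Y \<theta> ^ k) = ennreal (c ^ k / fact k) * ennreal (Y \<theta> ^ k)" for k
      by (rule ennreal_mult') (use c in simp)
    ultimately show "ennreal (exp (?m * \<bar>f \<theta>\<bar> powr (2 / real d) / (8 * exp 1))) = (\<Sum>k. ennreal (c ^ k / fact k) * ennreal (Y \<theta> ^ k))"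
      by (simp only:)
  qed
  also have "\<dots> = (\<Sum>k. ennreal (c ^ k / fact k) * (\<integral>\<^sup>+\<theta>. ennreal (Y \<theta> ^ k) \<partial>sphere_measure))"
    by (subst nn_integral_suminf) (simp_all add: nn_integral_cmult)
  also have "\<dots> \<le> (\<Sum>k. ennreal (b k))"
    by (intro suminf_le term_le summableI)
  also have "\<dots> = ennreal (suminf b)"
    by (rule suminf_ennreal2[OF b0 b(1)])
  also have "\<dots> \<le> 2"
    using ennreal_leI[OF b(2)] by simp
  finally show ?thesis .
qed

end
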